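(* Let $\mu\in\mathbb R$, let $B^\mu$ be a Brownian motion with drift $\mu$ started at $0$, let $t>0$, and let ${}^{\mu}T_{0,t}=\sup\{s<t:B^\mu(s)=0\}$ and ${}^{\mu}T_{t,0}=\inf\{s>t:B^\mu(s)=0\}$. For $0<a<t<b<\infty$ the following hold. (i) The conditional law of ${}^{\mu}T_{0,t}$ given ${}^{\mu}T_{t,0}=b$ has density on $(0,t)$ $$\frac{P({}^{\mu}T_{0,t}\in da\mid{}^{\mu}T_{t,0}=b)}{da}=\frac12\,\frac{b}{\sqrt{at}}\sqrt{\frac{b-t}{(b-a)^3}} ,$$ which does not depend on $\mu$. (ii) The conditional law of ${}^{\mu}T_{t,0}$ given ${}^{\mu}T_{0,t}=a$ has on $(t,\infty)$ the density $$\frac{P({}^{\mu}T_{t,0}\in db\mid{}^{\mu}T_{0,t}=a)}{db}=\frac{\frac12\sqrt{\frac{t-a}{(b-a)^3}}\;e^{-\frac{\mu^2}{2}(b-t)}}{1+\mu^2\sqrt{a(t-a)}\,e^{\frac{\mu^2}{2}(t-a)}\int_0^{\sqrt{\frac{t-a}{a}}}e^{-\frac{\mu^2y^2a}{2}}\,dy},$$ and at $+\infty$ the mass $$P({}^{\mu}T_{t,0}=\infty\mid{}^{\mu}T_{0,t}=a)=\frac{\sqrt{\frac\pi2}\,|\mu|\sqrt{t-a}\;e^{\frac{\mu^2}{2}(t-a)}}{1+\mu^2\sqrt{a(t-a)}\,e^{\frac{\mu^2}{2}(t-a)}\int_0^{\sqrt{\frac{t-a}{a}}}e^{-\frac{\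mu^2y^2a}{2}}\,dy}.$$
   Context: A Brownian motion with drift $\mu$ started at $0$ is $B^\mu(s)=B(s)+\mu s$, $s\ge 0$, with $B$ a standard one-dimensional Brownian motion, $B(0)=0$. The supremum is over $s\in[0,t)$, and $\inf\emptyset=+\infty$. Conditional laws are regular conditional distributions (i.e. the stated formulas give a version of them, for almost every value of the conditioning variable). *)

theory Defs
  imports "HOL-Probability.Probability"
begin

text \<open>Standard one-dimensional Brownian motion. Only the times \<open>s \<ge> 0\<close> are constrained; the
  process starts at \<open>0\<close> and every path is continuous.  The second argument of
  \<^const>\<open>normal_density\<close> is the standard deviation.\<close>

locale brownian_motion = prob_space M for M :: "'a measure" +
  fixes B :: "real \<Rightarrow> 'a \<Rightarrow> real"
  assumes random_variable_B: "\<And>s. 0 \<le> s \<Longrightarrow> random_variable borel (B s)"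
    and start_at_0: "\<And>\<omega>. \<omega> \<in> space M \<Longrightarrow> B 0 \<omega> = 0"
    and independent_increments:
      "\<And>(n::nat) \<tau>. 0 \<le> \<tau> 0 \<Longrightarrow> strict_mono_on {..n} \<tau> \<Longrightarrow>
         indep_vars (\<lambda>_. borel) (\<lambda>i \<omega>. B (\<tau> (Suc i)) \<omega> - B (\<tau> i) \<omega>) {..<n}"
    and gaussian_increments:
      "\<And>r s. 0 \<le> r \<Longrightarrow> r < s \<Longrightarrow>
         distributed M lborel (\<lambda>\<omega>. B s \<omega> - B r \<omega>) (normal_density 0 (sqrt (s - r)))"
    and continuous_paths: "\<And>\<omega>. \<omega> \<in> space M \<Longrightarrow> continuous_on {0..} (\<lambda>s. B s \<omega>)"

definition with_drift :: "real \<Rightarrow> (real \<Rightarrow> 'a \<Rightarrow> real) \<Rightarrow> real \<Rightarrow> 'a \<Rightarrow> real" where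
  "with_drift \<mu> B s \<omega> = B s \<omega> + \<mu> * s"

text \<open>For a process started at \<open>0\<close> and \<open>t > 0\<close> the set below contains \<open>0\<close> and is bounded by \<open>t\<close>,
  so the real supremum is the intended one.\<close>

definition last_zero_before :: "(real \<Rightarrow> 'a \<Rightarrow> real) \<Rightarrow> real \<Rightarrow> 'a \<Rightarrow> real" where
  "last_zero_before X t \<omega> = Sup {s. 0 \<le> s \<and> s < t \<and> X s \<omega> = 0}"

text \<open>In \<^typ>\<open>ereal\<close> the infimum of the empty set is \<open>\<infinity>\<close>.\<close>

definition first_zero_after :: "(real \<Rightarrow> 'a \<Rightarrow> real) \<Rightarrow> real \<Rightarrow> 'a \<Rightarrow> ereal" where
  "first_zero_after X t \<omega> = Inf (ereal ` {s. t < s \<and> X s \<omega> = 0})"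

text \<open>\<open>\<kappa>\<close> is a regular conditional distribution of \<open>X\<close> (with values in \<open>N\<close>) given \<open>Y\<close> (with values
  in \<open>L\<close>): a probability kernel from \<open>L\<close> to \<open>N\<close> such that, for every measurable \<open>A\<close>,
  \<open>\<omega> \<mapsto> \<kappa> (Y \<omega>) A\<close> is a version of the conditional probability of \<open>X \<in> A\<close> given \<open>\<sigma>(Y)\<close>.\<close>

definition regular_conditional_distribution ::
  "'a measure \<Rightarrow> 'b measure \<Rightarrow> ('a \<Rightarrow> 'b) \<Rightarrow> 'c measure \<Rightarrow> ('a \<Rightarrow> 'c) \<Rightarrow> ('c \<Rightarrow> 'b measure) \<Rightarrow> bool"
where
  "regular_conditional_distribution M N X L Y \<kappa> \<longleftrightarrow>
     X \<in> measurable M N \<and> Y \<in> measurable M L \<and> \<kappa> \<in> measurable L (prob_algebra N) \<and>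
     (\<forall>A\<in>sets N. AE \<omega> in M.
        real_cond_exp M (vimage_algebra (space M) Y L) (indicator (X -` A \<inter> space M)) \<omega>
          = measure (\<kappa> (Y \<omega>)) A)"

end

theory Submission
  imports Defs "HOL-Real_Asymp.Real_Asymp"
begin

text \<open>Both conditional laws are read off the joint law of the last zero before and the first zero
  after \<open>t\<close>.  Up to null sets, \<open>{last zero \<le> x, next zero \<ge> y}\<close> is the event that the drifted motion
  \<open>X\<close> has no zero in \<open>(x, y)\<close>, so everything reduces to \<open>P(X > 0 on [x, y))\<close>, the negative side being
  the same with \<open>-B\<close> and \<open>-\<mu>\<close>.

  Let \<open>\<psi>(w) = 1\<close> for \<open>w \<ge> 0\<close> and \<open>\<psi>(w) = -exp(-2\<mu>w)\<close> for \<open>w < 0\<close>.  The function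
  \<open>u(w, s) = E \<psi>(w + \<mu>s + B(s))\<close> vanishes at \<open>w = 0\<close> for every \<open>s > 0\<close>, and \<open>u(X(r), T - r)\<close> is a
  martingale.  Stopping at the first negative value on a finer and finer grid makes the overshoot
  negligible and gives \<open>P(X \<ge> 0 on [x, T)) = E[\<psi>(X(T)); X(x) \<ge> 0]\<close>, a reflection principle with drift
  that needs neither the strong Markov property nor Girsanov's theorem.  Differentiating \<open>u\<close> in \<open>s\<close> and
  integrating out \<open>X(x)\<close> produces the joint density
  \<open>exp(-\<mu>\<^sup>2b/2) / (2\<pi> sqrt(a (b - a)\<^sup>3))\<close> and the density \<open>|\<mu>| exp(-\<mu>\<^sup>2a/2) / sqrt(2\<pi>a)\<close> on
  \<open>{next zero = \<infinity>}\<close>.\<close>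

section \<open>Gaussian calculus\<close>

text \<open>The weight of \<psi> on the negative half-line is forced by symmetry: multiplied by
  exp(-2 \<mu> v), the law of \<mu> s + B(s) becomes its own mirror image, so started at 0 the two
  half-lines cancel. For \<mu> = 0, \<psi> is the sign function of the classical reflection
  principle. Three limits shape the rest. The value of u slightly below 0 is small only while the
  remaining time is bounded below, so the stopping argument runs on [x, y] with y < T, and y tends
  to T afterwards. A path may touch 0 without crossing it, so having no zero lies between staying
  beyond a level \<eta> > 0 and staying weakly on one side; letting \<eta> tend to 0 closes the gap
  without any study of the path near its zeros. The formula for a zero-free (x, y) is proved for 0 <
  x < y, so the corners x = 0 and x = y = t of the joint law are reached by monotone limits. Every
  density is checked against an explicit antiderivative; the boundary term at infinity supplies the
  atom.\<close>

text \<open>Nonnegativity gives integrability for free, and only one-sided limits are asked of F, so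
  integrands singular at an end, such as \<open>1 / sqrt a\<close> at 0, are covered.\<close>

lemma nn_integral_FTC_einterval:
  fixes f F :: "real \<Rightarrow> real" and a b :: ereal
  assumes ab: "a < b"
    and F: "\<And>x. a < ereal x \<Longrightarrow> ereal x < b \<Longrightarrow> DERIV F x :> f x"
    and f: "\<And>x. a < ereal x \<Longrightarrow> ereal x < b \<Longrightarrow> isCont f x"
    and nn: "\<And>x. a < ereal x \<Longrightarrow> ereal x < b \<Longrightarrow> 0 \<le> f x"
    and A: "((F \<circ> real_of_ereal) \<longlongrightarrow> A) (at_right a)"
    and B: "((F \<circ> real_of_ereal) \<longlongrightarrow> B) (at_left b)"
  shows "(\<integral>\<^sup>+x\<in>einterval a b. ennreal (f x) \<partial>lborel) = ennreal (B - A)"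
proof -
  have I: "set_integrable lborel (einterval a b) f" and E: "(LBINT x=a..b. f x) = B - A"
    using interval_integral_FTC_nonneg[OF ab F f _ A B] nn by auto
  have "(\<integral>\<^sup>+x\<in>einterval a b. ennreal (f x) \<partial>lborel)
      = (\<integral>\<^sup>+x. ennreal (indicator (einterval a b) x *\<^sub>R f x) \<partial>lborel)"
    by (intro nn_integral_cong) (auto split: split_indicator)
  also have "\<dots> = ennreal (\<integral>x. indicator (einterval a b) x *\<^sub>R f x \<partial>lborel)"
    using I nn by (intro nn_integral_eq_integral)
      (auto simp: set_integrable_def einterval_iff split: split_indicator)
  also have "(\<integral>x. indicator (einterval a b) x *\<^sub>R f x \<partial>lborel) = B - A"
    using E less_imp_le[OF ab] by (simp add: interval_lebesgue_integral_def set_lebesgue_integral_def)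
  finally show ?thesis .
qed

lemma nn_integral_FTC_greaterThanLessThan:
  fixes f F :: "real \<Rightarrow> real"
  assumes "a < b"
    and "\<And>x. a < x \<Longrightarrow> x < b \<Longrightarrow> DERIV F x :> f x"
    and "\<And>x. a < x \<Longrightarrow> x < b \<Longrightarrow> isCont f x"
    and "\<And>x. a < x \<Longrightarrow> x < b \<Longrightarrow> 0 \<le> f x"
    and "(F \<longlongrightarrow> A) (at_right a)" "(F \<longlongrightarrow> B) (at_left b)"
  shows "(\<integral>\<^sup>+x\<in>{a<..<b}. ennreal (f x) \<partial>lborel) = ennreal (B - A)"
  using nn_integral_FTC_einterval[of "ereal a" "ereal b" F f A B] assms
  by (simp add: ereal_tendsto_simps)

lemma nn_integral_FTC_greaterThan:
  fixes f F :: "real \<Rightarrow> real"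
  assumes "\<And>x. a < x \<Longrightarrow> DERIV F x :> f x"
    and "\<And>x. a < x \<Longrightarrow> isCont f x"
    and "\<And>x. a < x \<Longrightarrow> 0 \<le> f x"
    and "(F \<longlongrightarrow> A) (at_right a)" "(F \<longlongrightarrow> B) at_top"
  shows "(\<integral>\<^sup>+x\<in>{a<..}. ennreal (f x) \<partial>lborel) = ennreal (B - A)"
  using nn_integral_FTC_einterval[of "ereal a" "\<infinity>" F f A B] assms
  by (simp add: ereal_tendsto_simps)

lemma nn_integral_FTC_lessThan:
  fixes f F :: "real \<Rightarrow> real"
  assumes "\<And>x. x < b \<Longrightarrow> DERIV F x :> f x"
    and "\<And>x. x < b \<Longrightarrow> isCont f x"
    and "\<And>x. x < b \<Longrightarrow> 0 \<le> f x"
    and "(F \<longlongrightarrow> A) at_bot" "(F \<longlongrightarrow> B) (at_left b)"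
  shows "(\<integral>\<^sup>+x\<in>{..<b}. ennreal (f x) \<partial>lborel) = ennreal (B - A)"
  using nn_integral_FTC_einterval[of "-\<infinity>" "ereal b" F f A B] assms
  by (simp add: ereal_tendsto_simps)

section \<open>The standard normal distribution function\<close>

definition Phi :: "real \<Rightarrow> real" where
  "Phi = cdf std_normal_distribution"

lemma isCont_std_normal_density [continuous_intros]: "isCont std_normal_density x"
  unfolding normal_density_def by (intro continuous_intros) auto

lemma Phi_at_top: "(Phi \<longlongrightarrow> 1) at_top"
  unfolding Phi_def using real_distribution.cdf_lim_at_top_prob[OF real_dist_normal_dist] .

lemma Phi_at_bot: "(Phi \<longlongrightarrow> 0) at_bot"
proof -
  interpret real_distribution std_normal_distribution by (rule real_dist_normal_dist)
  show ?thesis unfolding Phi_def by (rule cdf_lim_at_bot)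
qed

lemma Phi_mono: "x \<le> y \<Longrightarrow> Phi x \<le> Phi y"
proof -
  interpret real_distribution std_normal_distribution by (rule real_dist_normal_dist)
  show "x \<le> y \<Longrightarrow> Phi x \<le> Phi y" unfolding Phi_def by (rule cdf_nondecreasing)
qed

lemma Phi_bounds: "0 \<le> Phi x" "Phi x \<le> 1"
proof -
  interpret real_distribution std_normal_distribution by (rule real_dist_normal_dist)
  show "0 \<le> Phi x" "Phi x \<le> 1" unfolding Phi_def by (rule cdf_nonneg, rule cdf_bounded_prob)
qed

lemma Phi_diff: "a \<le> b \<Longrightarrow> Phi b - Phi a = integral {a..b} std_normal_density"
proof -
  interpret real_distribution std_normal_distribution by (rule real_dist_normal_dist)
  assume ab: "a \<le> b"
  then have "Phi b - Phi a = measure std_normal_distribution {a<..b}"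
    unfolding Phi_def by (cases "a = b") (auto simp: cdf_diff_eq)
  also have "\<dots> = (\<integral>x. indicator {a<..b} x * std_normal_density x \<partial>lborel)"
    using integral_density[of "indicator {a<..b} :: real \<Rightarrow> real" lborel std_normal_density]
    by (simp add: mult.commute)
  also have "\<dots> = (LBINT x:{a..b}. std_normal_density x)"
    unfolding set_lebesgue_integral_def
    by (intro integral_cong_AE) (auto intro!: AE_I'[of "{a}"] split: split_indicator)
  also have "\<dots> = integral {a..b} std_normal_density"
    by (intro set_borel_integral_eq_integral borel_integrable_atLeastAtMost'
          continuous_at_imp_continuous_on ballI isCont_std_normal_density)
  finally show ?thesis .
qed

lemma DERIV_Phi: "DERIV Phi x :> std_normal_density x"
proof -
  have "((\<lambda>u. integral {x - 1..u} std_normal_density) has_vector_derivative std_normal_density x)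
      (at x within {x - 1..x + 1})"
    by (rule integral_has_vector_derivative)
       (auto intro!: continuous_at_imp_continuous_on isCont_std_normal_density)
  then have "((\<lambda>u. Phi (x - 1) + integral {x - 1..u} std_normal_density) has_real_derivative std_normal_density x)
      (at x within {x - 1..x + 1})"
    by (auto simp: has_real_derivative_iff_has_vector_derivative intro!: derivative_eq_intros)
  then have "(Phi has_real_derivative std_normal_density x) (at x within {x - 1..x + 1})"
    by (rule has_field_derivative_transform_within[where d = 1]) (auto simp: Phi_diff[symmetric])
  then show ?thesis
    using at_within_Icc_at[of "x - 1" x "x + 1"] by simp
qed

lemma DERIV_Phi_chain [derivative_intros]:
  "(g has_real_derivative D) (at x) \<Longrightarrow>
    ((\<lambda>x. Phi (g x)) has_real_derivative (std_normal_density (g x) * D)) (at x)"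
  using DERIV_chain2[OF DERIV_Phi] .

lemma isCont_Phi: "isCont Phi x"
  using DERIV_Phi DERIV_isCont by blast

lemma continuous_on_Phi [continuous_intros]:
  "continuous_on S g \<Longrightarrow> continuous_on S (\<lambda>x. Phi (g x))"
  by (rule continuous_on_compose2[of UNIV Phi]) (auto intro: continuous_at_imp_continuous_on isCont_Phi)

lemma tendsto_Phi [tendsto_intros]:
  "(g \<longlongrightarrow> l) F \<Longrightarrow> ((\<lambda>x. Phi (g x)) \<longlongrightarrow> Phi l) F"
  using isCont_tendsto_compose[OF isCont_Phi] .

lemma borel_measurable_Phi [measurable]: "Phi \<in> borel_measurable borel"
  by (intro borel_measurable_continuous_onI continuous_intros)

text \<open>The density is even, so \<open>Phi x + Phi (- x)\<close> has derivative 0; its constant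
  value 1 is read off at infinity.\<close>

lemma Phi_minus: "Phi (- x) = 1 - Phi x"
proof -
  have D: "((\<lambda>x. Phi x + Phi (- x)) has_real_derivative 0) (at x)" for x
    by (rule derivative_eq_intros refl DERIV_Phi)+ (simp add: std_normal_density_def)
  then have c: "Phi y + Phi (- y) = Phi x + Phi (- x)" for y
    using DERIV_isconst_all by blast
  have "((\<lambda>y. Phi y + Phi (- y)) \<longlongrightarrow> 1 + 0) at_top"
    by (intro tendsto_add Phi_at_top filterlim_compose[OF Phi_at_bot] filterlim_uminus_at_bot_at_top)
  moreover have "(\<lambda>y. Phi y + Phi (- y)) = (\<lambda>_. Phi x + Phi (- x))"
    by (intro ext c)
  ultimately have "((\<lambda>y::real. Phi x + Phi (- x)) \<longlongrightarrow> 1) at_top"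
    by simp
  then show ?thesis
    by (simp add: tendsto_const_iff)
qed

lemma Phi_0: "Phi 0 = 1 / 2"
  using Phi_minus[of 0] by simp

lemma std_normal_density_le_1: "std_normal_density x \<le> 1"
proof -
  have "1 \<le> sqrt (2 * pi)" using pi_ge_two by (simp add: real_le_rsqrt)
  then have "1 / sqrt (2 * pi) \<le> 1" by simp
  then have "1 / sqrt (2 * pi) * exp (- x\<^sup>2 / 2) \<le> 1 * 1"
    by (intro mult_mono) auto
  then show ?thesis
    unfolding std_normal_density_def by simp
qed

text \<open>Mean value theorem with the density bounded by 1. The constant is not sharp; for
  \<open>survival_bound\<close> it only has to be uniform.\<close>

lemma Phi_Lipschitz: "\<bar>Phi x - Phi y\<bar> \<le> \<bar>x - y\<bar>"
proof -
  have *: "Phi b - Phi a \<le> b - a" if ab: "a < b" for a b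
  proof -
    obtain z where "Phi b - Phi a = (b - a) * std_normal_density z"
      using MVT2[OF ab DERIV_Phi] by blast
    then show ?thesis
      using that std_normal_density_le_1[of z] mult_left_mono[of "std_normal_density z" 1 "b - a"] by simp
  qed
  show ?thesis
    using *[of x y] *[of y x] Phi_mono[of x y] Phi_mono[of y x]
    by (cases x y rule: linorder_cases) auto
qed

lemma std_normal_density_shift:
  "0 < \<sigma> \<Longrightarrow> std_normal_density ((v - m) / \<sigma>) / \<sigma> = normal_density m \<sigma> v"
  by (simp add: std_normal_density_def normal_density_def power_divide real_sqrt_mult)

lemma DERIV_Phi_affine:
  assumes "0 < \<sigma>"
  shows "((\<lambda>v. Phi ((v - m) / \<sigma>)) has_real_derivative normal_density m \<sigma> x) (at x)"
proof -
  have "((\<lambda>v. (v - m) / \<sigma>) has_real_derivative 1 / \<sigma>) (at x)"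
    using assms by (auto intro!: derivative_eq_intros)
  from DERIV_Phi_chain[OF this] show ?thesis
    using std_normal_density_shift[OF assms, of x m] by simp
qed

lemma isCont_normal_density: "0 < \<sigma> \<Longrightarrow> isCont (normal_density m \<sigma>) x"
  unfolding normal_density_def by (intro continuous_intros) auto

lemma isCont_Phi_affine: "0 < \<sigma> \<Longrightarrow> isCont (\<lambda>v. Phi ((v - m) / \<sigma>)) x"
  using DERIV_Phi_affine DERIV_isCont by blast

lemma nn_integral_normal_greaterThan:
  assumes "0 < \<sigma>"
  shows "(\<integral>\<^sup>+v\<in>{c<..}. ennreal (normal_density m \<sigma> v) \<partial>lborel) = ennreal (Phi ((m - c) / \<sigma>))"
proof -
  have "(\<integral>\<^sup>+v\<in>{c<..}. ennreal (normal_density m \<sigma> v) \<partial>lborel) = ennreal (1 - Phi ((c - m) / \<sigma>))"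
  proof (rule nn_integral_FTC_greaterThan)
    show "((\<lambda>v. Phi ((v - m) / \<sigma>)) has_real_derivative normal_density m \<sigma> x) (at x)" for x
      by (rule DERIV_Phi_affine[OF assms])
    show "isCont (normal_density m \<sigma>) x" for x
      by (rule isCont_normal_density[OF assms])
    show "((\<lambda>v. Phi ((v - m) / \<sigma>)) \<longlongrightarrow> Phi ((c - m) / \<sigma>)) (at_right c)"
      using isCont_Phi_affine[OF assms, of c m]
      by (simp add: isCont_def filterlim_at_split)
    have "filterlim (\<lambda>v. (v - m) / \<sigma>) at_top at_top"
      using assms by real_asymp
    then show "((\<lambda>v. Phi ((v - m) / \<sigma>)) \<longlongrightarrow> 1) at_top"
      by (rule filterlim_compose[OF Phi_at_top])
  qed simp
  then show ?thesis
    using Phi_minus[of "(c - m) / \<sigma>"] by (simp add: minus_divide_left)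
qed

lemma nn_integral_normal_lessThan:
  assumes "0 < \<sigma>"
  shows "(\<integral>\<^sup>+v\<in>{..<c}. ennreal (normal_density m \<sigma> v) \<partial>lborel) = ennreal (Phi ((c - m) / \<sigma>))"
proof -
  have "(\<integral>\<^sup>+v\<in>{..<c}. ennreal (normal_density m \<sigma> v) \<partial>lborel) = ennreal (Phi ((c - m) / \<sigma>) - 0)"
  proof (rule nn_integral_FTC_lessThan)
    show "((\<lambda>v. Phi ((v - m) / \<sigma>)) has_real_derivative normal_density m \<sigma> x) (at x)" for x
      by (rule DERIV_Phi_affine[OF assms])
    show "isCont (normal_density m \<sigma>) x" for x
      by (rule isCont_normal_density[OF assms])
    show "((\<lambda>v. Phi ((v - m) / \<sigma>)) \<longlongrightarrow> Phi ((c - m) / \<sigma>)) (at_left c)"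
      using isCont_Phi_affine[OF assms, of c m]
      by (simp add: isCont_def filterlim_at_split)
    have "filterlim (\<lambda>v. (v - m) / \<sigma>) at_bot at_bot"
      using assms by real_asymp
    then show "((\<lambda>v. Phi ((v - m) / \<sigma>)) \<longlongrightarrow> 0) at_bot"
      by (rule filterlim_compose[OF Phi_at_bot])
  qed simp
  then show ?thesis by simp
qed

text \<open>The closed half-line here and the open one in \<open>integral_normal_lessThan\<close>
  are the two pieces on which \<open>reflected\<close> is defined, with 0 counted as
  nonnegative.\<close>

lemma integral_normal_atLeast:
  assumes "0 < \<sigma>"
  shows "(\<integral>v. indicator {c..} v * normal_density m \<sigma> v \<partial>lborel) = Phi ((m - c) / \<sigma>)"
proof -
  have "(\<integral>v. indicator {c..} v * normal_density m \<sigma> v \<partial>lborel)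
      = enn2real (\<integral>\<^sup>+v. ennreal (indicator {c..} v * normal_density m \<sigma> v) \<partial>lborel)"
    by (rule integral_eq_nn_integral) auto
  also have "(\<integral>\<^sup>+v. ennreal (indicator {c..} v * normal_density m \<sigma> v) \<partial>lborel)
      = (\<integral>\<^sup>+v\<in>{c<..}. ennreal (normal_density m \<sigma> v) \<partial>lborel)"
    by (intro nn_integral_cong_AE) (auto intro!: AE_I'[of "{c}"] split: split_indicator)
  finally show ?thesis
    using nn_integral_normal_greaterThan[OF assms] Phi_bounds by simp
qed

lemma integral_normal_lessThan:
  assumes "0 < \<sigma>"
  shows "(\<integral>v. indicator {..<c} v * normal_density m \<sigma> v \<partial>lborel) = Phi ((c - m) / \<sigma>)"
proof -
  have "(\<integral>v. indicator {..<c} v * normal_density m \<sigma> v \<partial>lborel)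
      = enn2real (\<integral>\<^sup>+v. ennreal (indicator {..<c} v * normal_density m \<sigma> v) \<partial>lborel)"
    by (rule integral_eq_nn_integral) auto
  also have "(\<integral>\<^sup>+v. ennreal (indicator {..<c} v * normal_density m \<sigma> v) \<partial>lborel)
      = (\<integral>\<^sup>+v\<in>{..<c}. ennreal (normal_density m \<sigma> v) \<partial>lborel)"
    by (intro nn_integral_cong) (auto split: split_indicator)
  finally show ?thesis
    using nn_integral_normal_lessThan[OF assms] Phi_bounds by simp
qed

text \<open>The values on the negative half-line are chosen such that the mean \<open>survival \<mu> w s\<close> of
  \<open>reflected \<mu> (w + \<mu> s + B s)\<close> vanishes at \<open>w = 0\<close>; for \<open>w > 0\<close> that mean is the probability that
  the motion started at \<open>w\<close> stays positive up to time \<open>s\<close>.\<close>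

definition reflected :: "real \<Rightarrow> real \<Rightarrow> real" where
  "reflected \<mu> w = (if 0 \<le> w then 1 else - exp (- (2 * \<mu> * w)))"

definition survival :: "real \<Rightarrow> real \<Rightarrow> real \<Rightarrow> real" where
  "survival \<mu> w s = Phi ((w + \<mu> * s) / sqrt s) - exp (- (2 * \<mu> * w)) * Phi ((\<mu> * s - w) / sqrt s)"

lemma borel_measurable_reflected [measurable]: "reflected \<mu> \<in> borel_measurable borel"
  unfolding reflected_def by measurable

lemma borel_measurable_survival [measurable]: "(\<lambda>x. survival \<mu> (f x) s) \<in> borel_measurable M"
  if [measurable]: "f \<in> borel_measurable M"
  unfolding survival_def by measurable

text \<open>Completing the square: the exponential weight reverses the drift. It does the work of a
  change of measure, but for a single Gaussian variable.\<close>

lemma normal_density_exp_tilt: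
  assumes "0 < s"
  shows "exp (- (2 * \<mu> * v)) * normal_density (\<mu> * s) (sqrt s) v = normal_density (- (\<mu> * s)) (sqrt s) v"
proof -
  have "- (2 * \<mu> * v) + - (v - \<mu> * s)\<^sup>2 / (2 * s) = - (v + \<mu> * s)\<^sup>2 / (2 * s)"
    using assms by (simp add: field_simps power2_eq_square)
  then show ?thesis
    using assms by (simp add: normal_density_def exp_add[symmetric])
qed

text \<open>On the negative half-line the weight reverses the drift, so both pieces are Gaussian
  tails; their difference is the Bachelier-Levy formula.\<close>

lemma integral_reflected:
  assumes s: "0 < s"
  shows "integrable lborel (\<lambda>v. reflected \<mu> (w + v) * normal_density (\<mu> * s) (sqrt s) v)"
    and "(\<integral>v. reflected \<mu> (w + v) * normal_density (\<mu> * s) (sqrt s) v \<partial>lborel) = survival \<mu> w s"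
proof -
  let ?f = "\<lambda>v. indicator {- w..} v * normal_density (\<mu> * s) (sqrt s) v"
  let ?g = "\<lambda>v. indicator {..<- w} v * normal_density (- (\<mu> * s)) (sqrt s) v"
  have eq: "reflected \<mu> (w + v) * normal_density (\<mu> * s) (sqrt s) v = ?f v - exp (- (2 * \<mu> * w)) * ?g v" for v
    using normal_density_exp_tilt[OF s, of \<mu> v, symmetric]
    by (auto simp: reflected_def exp_add[symmetric] algebra_simps split: split_indicator)
  have int: "integrable lborel (\<lambda>v. indicator A v * normal_density m (sqrt s) v)" if "A \<in> sets borel" for A m
    using integrable_mult_indicator[of A lborel "normal_density m (sqrt s)"] that s by simp
  show "integrable lborel (\<lambda>v. reflected \<mu> (w + v) * normal_density (\<mu> * s) (sqrt s) v)"
    unfolding eq by (intro Bochner_Integration.integrable_diff integrable_mult_right int) auto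
  show "(\<integral>v. reflected \<mu> (w + v) * normal_density (\<mu> * s) (sqrt s) v \<partial>lborel) = survival \<mu> w s"
    unfolding eq
    by (subst Bochner_Integration.integral_diff)
       (auto intro!: integrable_mult_right int
             simp: s integral_normal_atLeast integral_normal_lessThan survival_def add.commute)
qed

text \<open>The two terms of \<open>survival\<close> cancel at w = 0. Near 0 the error splits into a
  Lipschitz difference of \<open>Phi\<close> and the deviation of the exponential from 1, uniformly
  over remaining times s of at least \<open>s\<^sub>0\<close>.\<close>

lemma survival_bound:
  assumes "0 < s\<^sub>0" "s\<^sub>0 \<le> s" "\<bar>w\<bar> \<le> \<epsilon>"
  shows "\<bar>survival \<mu> w s\<bar> \<le> 2 * \<epsilon> / sqrt s\<^sub>0 + (exp (2 * \<bar>\<mu>\<bar> * \<epsilon>) - 1)"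
proof -
  have e: "0 \<le> \<epsilon>" using assms by auto
  have "\<bar>Phi ((w + \<mu> * s) / sqrt s) - Phi ((\<mu> * s - w) / sqrt s)\<bar> \<le> \<bar>(w + \<mu> * s) / sqrt s - (\<mu> * s - w) / sqrt s\<bar>"
    by (rule Phi_Lipschitz)
  also have "\<dots> = 2 * \<bar>w\<bar> / sqrt s"
    using assms by (simp add: diff_divide_distrib[symmetric] abs_mult)
  also have "\<dots> \<le> 2 * \<epsilon> / sqrt s\<^sub>0"
    using assms by (intro frac_le) auto
  finally have 1: "\<bar>Phi ((w + \<mu> * s) / sqrt s) - Phi ((\<mu> * s - w) / sqrt s)\<bar> \<le> 2 * \<epsilon> / sqrt s\<^sub>0" .
  have exp1: "\<bar>1 - exp z\<bar> \<le> exp \<bar>z\<bar> - 1" for z :: real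
  proof (cases "0 \<le> z")
    case False
    \<comment> \<open>For negative z the claim amounts to exp z + exp (-z) >= 2, a perfect
      square.\<close>
    have "0 \<le> (exp (z / 2) - exp (- z / 2))\<^sup>2" by simp
    also have "\<dots> = exp z + exp (- z) - 2"
      by (simp add: power2_eq_square algebra_simps exp_add[symmetric])
    finally show ?thesis using False by simp
  qed auto
  have "\<bar>(1 - exp (- (2 * \<mu> * w))) * Phi ((\<mu> * s - w) / sqrt s)\<bar> \<le> (exp \<bar>- (2 * \<mu> * w)\<bar> - 1) * 1"
    unfolding abs_mult using exp1[of "- (2 * \<mu> * w)"] Phi_bounds by (intro mult_mono) auto
  also have "\<dots> \<le> exp (2 * \<bar>\<mu>\<bar> * \<epsilon>) - 1"
    using assms by (simp add: abs_mult mult_left_mono)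
  finally have 2: "\<bar>(1 - exp (- (2 * \<mu> * w))) * Phi ((\<mu> * s - w) / sqrt s)\<bar> \<le> exp (2 * \<bar>\<mu>\<bar> * \<epsilon>) - 1" .
  have "survival \<mu> w s = (Phi ((w + \<mu> * s) / sqrt s) - Phi ((\<mu> * s - w) / sqrt s))
      + (1 - exp (- (2 * \<mu> * w))) * Phi ((\<mu> * s - w) / sqrt s)"
    by (simp add: survival_def algebra_simps)
  then show ?thesis using 1 2 by linarith
qed

section \<open>Survival as the tail of the hitting time of 0\<close>

text \<open>The limit of \<open>survival \<mu> w s\<close> as s grows; for w > 0, the probability
  that the motion started at w never reaches 0.\<close>

definition survival_forever :: "real \<Rightarrow> real \<Rightarrow> real" where
  "survival_forever \<mu> w = (if 0 < \<mu> then 1 - exp (- (2 * \<mu> * w)) else 0)"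

text \<open>For w > 0 this is the density of the first time r at which w + \<mu> r + B(r) hits 0:
  inverse Gaussian, of total mass below 1 if \<mu> > 0. The proof uses it only as minus the time
  derivative of \<open>survival\<close>.\<close>

definition hitting_density :: "real \<Rightarrow> real \<Rightarrow> real \<Rightarrow> real" where
  "hitting_density \<mu> w r = w / (r * sqrt r) * std_normal_density ((w + \<mu> * r) / sqrt r)"

lemma borel_measurable_survival_forever [measurable]: "survival_forever \<mu> \<in> borel_measurable borel"
  unfolding survival_forever_def by measurable

lemma borel_measurable_hitting_density [measurable]:
  assumes [measurable]: "f \<in> borel_measurable M" "g \<in> borel_measurable M"
  shows "(\<lambda>x. hitting_density \<mu> (f x) (g x)) \<in> borel_measurable M"
  unfolding hitting_density_def by measurable

lemma survival_forever_nonneg: "0 \<le> w \<Longrightarrow> 0 \<le> survival_forever \<mu> w"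
  unfolding survival_forever_def by simp

text \<open>The tilt makes both Gaussian factors equal, so the \<mu> / (2 q) contributions cancel
  and only the two terms in w remain, with the same sign.\<close>

lemma DERIV_survival:
  assumes r: "0 < r"
  shows "((\<lambda>r. survival \<mu> w r) has_real_derivative - hitting_density \<mu> w r) (at r)"
proof -
  define q where "q = sqrt r"
  have q: "0 < q" "r = q * q" using r by (auto simp: q_def)
  have D1: "((\<lambda>r. (w + \<mu> * r) / sqrt r) has_real_derivative \<mu> / (2 * q) - w / (2 * r * q)) (at r)"
    using r q by (auto intro!: derivative_eq_intros simp: q_def[symmetric] field_simps)
  have D2: "((\<lambda>r. (\<mu> * r - w) / sqrt r) has_real_derivative \<mu> / (2 * q) + w / (2 * r * q)) (at r)"
    using r q by (auto intro!: derivative_eq_intros simp: q_def[symmetric] field_simps)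
  have "- (2 * \<mu> * w) + - ((\<mu> * r - w) / sqrt r)\<^sup>2 / 2 = - ((w + \<mu> * r) / sqrt r)\<^sup>2 / 2"
    using r by (simp add: power_divide field_simps power2_eq_square)
  then have refl: "exp (- (2 * \<mu> * w)) * std_normal_density ((\<mu> * r - w) / sqrt r)
      = std_normal_density ((w + \<mu> * r) / sqrt r)"
    by (simp add: std_normal_density_def exp_add[symmetric])
  have "((\<lambda>r. survival \<mu> w r) has_real_derivative
      std_normal_density ((w + \<mu> * r) / sqrt r) * (\<mu> / (2 * q) - w / (2 * r * q))
      - exp (- (2 * \<mu> * w)) * (std_normal_density ((\<mu> * r - w) / sqrt r) * (\<mu> / (2 * q) + w / (2 * r * q)))) (at r)"
    unfolding survival_def
    by (intro DERIV_diff DERIV_cmult DERIV_Phi_chain D1 D2)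
  also have "std_normal_density ((w + \<mu> * r) / sqrt r) * (\<mu> / (2 * q) - w / (2 * r * q))
      - exp (- (2 * \<mu> * w)) * (std_normal_density ((\<mu> * r - w) / sqrt r) * (\<mu> / (2 * q) + w / (2 * r * q)))
      = std_normal_density ((w + \<mu> * r) / sqrt r) * ((\<mu> / (2 * q) - w / (2 * r * q)) - (\<mu> / (2 * q) + w / (2 * r * q)))"
    unfolding refl[symmetric] by (simp only: algebra_simps)
  also have "\<dots> = - hitting_density \<mu> w r"
    using r by (simp add: hitting_density_def q_def)
  finally show ?thesis .
qed

lemma survival_tendsto:
  "((\<lambda>r. survival \<mu> w r) \<longlongrightarrow> survival_forever \<mu> w) at_top"
proof -
  consider "0 < \<mu>" | "\<mu> = 0" | "\<mu> < 0" by linarith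
  then show ?thesis
  proof cases
    case 1
    have "filterlim (\<lambda>r. (w + \<mu> * r) / sqrt r) at_top at_top" "filterlim (\<lambda>r. (\<mu> * r - w) / sqrt r) at_top at_top"
      using 1 by real_asymp+
    then have "((\<lambda>r. survival \<mu> w r) \<longlongrightarrow> 1 - exp (- (2 * \<mu> * w)) * 1) at_top"
      unfolding survival_def by (intro tendsto_intros filterlim_compose[OF Phi_at_top])
    then show ?thesis using 1 by (simp add: survival_forever_def)
  next
    case 2
    have "((\<lambda>r. w / sqrt r) \<longlongrightarrow> 0) at_top" "((\<lambda>r. - w / sqrt r) \<longlongrightarrow> 0) at_top"
      by real_asymp+
    then have "((\<lambda>r. survival \<mu> w r) \<longlongrightarrow> Phi 0 - exp (- (2 * \<mu> * w)) * Phi 0) at_top"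
      unfolding survival_def 2 by (intro tendsto_diff tendsto_mult tendsto_const tendsto_Phi) auto
    then show ?thesis using 2 by (simp add: survival_forever_def)
  next
    case 3
    have "filterlim (\<lambda>r. (w + \<mu> * r) / sqrt r) at_bot at_top" "filterlim (\<lambda>r. (\<mu> * r - w) / sqrt r) at_bot at_top"
      using 3 by real_asymp+
    then have "((\<lambda>r. survival \<mu> w r) \<longlongrightarrow> 0 - exp (- (2 * \<mu> * w)) * 0) at_top"
      unfolding survival_def by (intro tendsto_diff tendsto_mult tendsto_const filterlim_compose[OF Phi_at_bot])
    then show ?thesis using 3 by (simp add: survival_forever_def)
  qed
qed

text \<open>To survive s is to hit 0 later than s or never. Monotonicity in time keeps the
  difference of the end values nonnegative, so that it can be moved across in
  \<open>ennreal\<close>.\<close>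

lemma survival_eq_nn_integral:
  assumes w: "0 < w" and s: "0 < s"
  shows "ennreal (survival \<mu> w s) = ennreal (survival_forever \<mu> w)
      + (\<integral>\<^sup>+r\<in>{s<..}. ennreal (hitting_density \<mu> w r) \<partial>lborel)"
    and "0 \<le> survival \<mu> w s"
proof -
  have nn: "0 \<le> hitting_density \<mu> w r" if "s < r" for r
    using w s that by (simp add: hitting_density_def)
  have "survival \<mu> w r \<le> survival \<mu> w s" if "s \<le> r" for r
    by (rule DERIV_nonpos_imp_nonincreasing[OF that])
       (use s w in \<open>auto intro!: exI[of _ "- hitting_density \<mu> w _"] DERIV_survival simp: hitting_density_def\<close>)
  then have le: "survival_forever \<mu> w \<le> survival \<mu> w s"
    by (intro tendsto_upperbound[OF survival_tendsto])
       (auto simp: eventually_at_top_linorder)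
  then show "0 \<le> survival \<mu> w s"
    using survival_forever_nonneg[of w \<mu>] w by simp
  have "(\<integral>\<^sup>+r\<in>{s<..}. ennreal (hitting_density \<mu> w r) \<partial>lborel)
      = ennreal (- survival_forever \<mu> w - - survival \<mu> w s)"
  proof (rule nn_integral_FTC_greaterThan)
    show "((\<lambda>r. - survival \<mu> w r) has_real_derivative hitting_density \<mu> w r) (at r)" if "s < r" for r
      using DERIV_minus[OF DERIV_survival[of r \<mu> w]] that s by simp
    show "isCont (hitting_density \<mu> w) r" if "s < r" for r
      unfolding hitting_density_def std_normal_density_def using that s by (intro continuous_intros) auto
    show "((\<lambda>r. - survival \<mu> w r) \<longlongrightarrow> - survival \<mu> w s) (at_right s)"
      using DERIV_isCont[OF DERIV_survival[OF s, of \<mu> w]]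
      by (intro tendsto_minus) (auto simp: isCont_def filterlim_at_split)
  qed (auto intro: nn tendsto_minus survival_tendsto)
  then show "ennreal (survival \<mu> w s) = ennreal (survival_forever \<mu> w)
      + (\<integral>\<^sup>+r\<in>{s<..}. ennreal (hitting_density \<mu> w r) \<partial>lborel)"
    using le w by (simp add: ennreal_plus[symmetric] survival_forever_nonneg del: ennreal_plus)
qed

section \<open>Densities of the last and the next zero\<close>

text \<open>Minus the mixed derivative, at x = a and y = b, of the probability that (x, y) contains
  no zero; t enters only through the constraint a < t < b.\<close>

definition joint_density :: "real \<Rightarrow> real \<Rightarrow> real \<Rightarrow> real" where
  "joint_density \<mu> a b = exp (- (\<mu>\<^sup>2 * b / 2)) / (2 * pi * sqrt (a * (b - a) ^ 3))"

text \<open>Density of the last zero over all times: a Gamma law of shape 1/2 if \<mu> is nonzero,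
  and 0 for \<mu> = 0. When the next zero is infinite, the last zero before t is the last one of
  all.\<close>

definition last_zero_density :: "real \<Rightarrow> real \<Rightarrow> real" where
  "last_zero_density \<mu> a = \<bar>\<mu>\<bar> / sqrt (2 * pi * a) * exp (- (\<mu>\<^sup>2 * a / 2))"

text \<open>Density at b > x of the first zero after time x, on the event that there is one.\<close>

definition next_zero_density :: "real \<Rightarrow> real \<Rightarrow> real \<Rightarrow> real" where
  "next_zero_density \<mu> x b = exp (- (\<mu>\<^sup>2 * b / 2)) * sqrt (x / (b - x)) / (pi * b)"

lemma borel_measurable_densities [measurable]:
  assumes [measurable]: "f \<in> borel_measurable M" "g \<in> borel_measurable M"
  shows "(\<lambda>x. joint_density \<mu> (f x) (g x)) \<in> borel_measurable M"
    and "(\<lambda>x. last_zero_density \<mu> (f x)) \<in> borel_measurable M"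
    and "(\<lambda>x. next_zero_density \<mu> (f x) (g x)) \<in> borel_measurable M"
  unfolding joint_density_def last_zero_density_def next_zero_density_def by measurable

lemma sqrt_cube: "0 \<le> z \<Longrightarrow> sqrt (z ^ 3) = z * sqrt z"
  by (simp add: power3_eq_cube real_sqrt_mult)

text \<open>The terms linear in w cancel between the two exponents, so \<mu> separates from w and
  what is left is w times a centred Gaussian exponential. Half of \<open>next_zero_density\<close>
  appears because only paths positive at x are counted.\<close>

lemma nn_integral_normal_hitting_density:
  assumes x: "0 < x" and r: "0 < r"
  shows "(\<integral>\<^sup>+w\<in>{0<..}. ennreal (normal_density (\<mu> * x) (sqrt x) w) * ennreal (hitting_density \<mu> w r) \<partial>lborel)
    = ennreal (next_zero_density \<mu> x (x + r) / 2)"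
proof -
  \<comment> \<open>Half the sum of 1 / x and 1 / r: the coefficient of the square of w after the
    exponents are added.\<close>
  define \<alpha> where "\<alpha> = (x + r) / (2 * x * r)"
  define K where "K = next_zero_density \<mu> x (x + r) / 2"
  have \<alpha>: "0 < \<alpha>" using x r by (simp add: \<alpha>_def)
  have eq: "normal_density (\<mu> * x) (sqrt x) w * hitting_density \<mu> w r = 2 * \<alpha> * K * w * exp (- (\<alpha> * w\<^sup>2))" for w
  proof -
    have e: "- (w - \<mu> * x)\<^sup>2 / (2 * x) + - ((w + \<mu> * r) / sqrt r)\<^sup>2 / 2 = - (\<mu>\<^sup>2 * (x + r) / 2) + - (\<alpha> * w\<^sup>2)"
      using x r by (simp add: \<alpha>_def power_divide field_simps power2_eq_square)
    have "normal_density (\<mu> * x) (sqrt x) w * hitting_density \<mu> w r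
      = w / (sqrt (2 * pi * x) * (r * sqrt r) * sqrt (2 * pi))
        * exp (- (w - \<mu> * x)\<^sup>2 / (2 * x) + - ((w + \<mu> * r) / sqrt r)\<^sup>2 / 2)"
      unfolding exp_add using x by (simp add: normal_density_def hitting_density_def mult_ac)
    also have "\<dots> = w / (sqrt (2 * pi * x) * (r * sqrt r) * sqrt (2 * pi))
        * (exp (- (\<mu>\<^sup>2 * (x + r) / 2)) * exp (- (\<alpha> * w\<^sup>2)))"
      unfolding e exp_add ..
    also have "w / (sqrt (2 * pi * x) * (r * sqrt r) * sqrt (2 * pi)) = 2 * \<alpha> * w * (sqrt (x / r) / (2 * pi * (x + r)))"
    proof -
      have "sqrt (2 * pi * x) * (r * sqrt r) * sqrt (2 * pi)
          = (sqrt (2 * pi) * sqrt (2 * pi)) * (sqrt x * (r * sqrt r))"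
        unfolding real_sqrt_mult[of "2 * pi" x] by (simp only: mult_ac)
      then have "sqrt (2 * pi * x) * (r * sqrt r) * sqrt (2 * pi) = 2 * pi * (sqrt x * (r * sqrt r))"
        by simp
      moreover have "2 * \<alpha> * w * (sqrt (x / r) / (2 * pi * (x + r))) = w * (sqrt x / x) / (2 * pi * (r * sqrt r))"
      proof -
        define z where "z = x + r"
        have "z \<noteq> 0" using x r by (simp add: z_def)
        then show ?thesis
          using x r unfolding \<alpha>_def z_def[symmetric] by (simp add: real_sqrt_divide mult_ac)
      qed
      moreover have "sqrt x / x = 1 / sqrt x"
        using x by (simp add: real_divide_square_eq field_simps)
      ultimately show ?thesis by (simp add: mult_ac)
    qed
    finally show ?thesis
      by (simp add: K_def next_zero_density_def)
  qed
  have K: "0 \<le> K" using x r by (simp add: K_def next_zero_density_def)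
  have "(\<integral>\<^sup>+w\<in>{0<..}. ennreal (2 * \<alpha> * K * w * exp (- (\<alpha> * w\<^sup>2))) \<partial>lborel) = ennreal (0 - (- K))"
  proof (rule nn_integral_FTC_greaterThan)
    show "((\<lambda>w. - K * exp (- (\<alpha> * w\<^sup>2))) has_real_derivative 2 * \<alpha> * K * w * exp (- (\<alpha> * w\<^sup>2))) (at w)" for w
      by (auto intro!: derivative_eq_intros)
    have "isCont (\<lambda>w. - K * exp (- (\<alpha> * w\<^sup>2))) 0" by (intro continuous_intros)
    then show "((\<lambda>w. - K * exp (- (\<alpha> * w\<^sup>2))) \<longlongrightarrow> - K) (at_right 0)"
      by (simp add: isCont_def filterlim_at_split)
    have "((\<lambda>w. exp (- (\<alpha> * w\<^sup>2))) \<longlongrightarrow> 0) at_top" using \<alpha> by real_asymp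
    then show "((\<lambda>w. - K * exp (- (\<alpha> * w\<^sup>2))) \<longlongrightarrow> 0) at_top"
      using tendsto_mult_right_zero by blast
  qed (use K \<alpha> in \<open>auto intro!: continuous_intros\<close>)
  moreover have "(\<integral>\<^sup>+w\<in>{0<..}. ennreal (normal_density (\<mu> * x) (sqrt x) w) * ennreal (hitting_density \<mu> w r) \<partial>lborel)
      = (\<integral>\<^sup>+w\<in>{0<..}. ennreal (2 * \<alpha> * K * w * exp (- (\<alpha> * w\<^sup>2))) \<partial>lborel)"
    by (intro nn_integral_cong) (auto simp: eq[symmetric] ennreal_mult'' ennreal_mult' split: split_indicator)
  ultimately show ?thesis by (simp add: K_def)
qed

text \<open>The substitution u = |\<mu>| sqrt a turns the density into twice the standard normal
  one.\<close>

lemma nn_integral_last_zero_density: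
  assumes x: "0 < x"
  shows "(\<integral>\<^sup>+a\<in>{0<..<x}. ennreal (last_zero_density \<mu> a) \<partial>lborel) = ennreal (2 * Phi (\<bar>\<mu>\<bar> * sqrt x) - 1)"
proof -
  have "(\<integral>\<^sup>+a\<in>{0<..<x}. ennreal (last_zero_density \<mu> a) \<partial>lborel) = ennreal (2 * Phi (\<bar>\<mu>\<bar> * sqrt x) - 2 * Phi (\<bar>\<mu>\<bar> * sqrt 0))"
  proof (rule nn_integral_FTC_greaterThanLessThan[OF x])
    fix a :: real assume a: "0 < a"
    have "((\<lambda>a. \<bar>\<mu>\<bar> * sqrt a) has_real_derivative \<bar>\<mu>\<bar> * (inverse (sqrt a) / 2)) (at a)"
      by (intro DERIV_cmult DERIV_real_sqrt a)
    from DERIV_cmult[OF DERIV_Phi_chain[OF this], of 2]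
    show "((\<lambda>a. 2 * Phi (\<bar>\<mu>\<bar> * sqrt a)) has_real_derivative last_zero_density \<mu> a) (at a)"
      using a by (simp add: last_zero_density_def std_normal_density_def power_mult_distrib real_sqrt_mult field_simps)
    show "isCont (last_zero_density \<mu>) a"
      unfolding last_zero_density_def using a by (intro continuous_intros) auto
    show "0 \<le> last_zero_density \<mu> a"
      unfolding last_zero_density_def using a by simp
  next
    have c: "isCont (\<lambda>a. 2 * Phi (\<bar>\<mu>\<bar> * sqrt a)) a" for a
      by (intro continuous_intros isCont_o2[OF _ isCont_Phi])
    show "((\<lambda>a. 2 * Phi (\<bar>\<mu>\<bar> * sqrt a)) \<longlongrightarrow> 2 * Phi (\<bar>\<mu>\<bar> * sqrt 0)) (at_right 0)"
      using c[of 0] by (simp add: isCont_def filterlim_at_split)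
    show "((\<lambda>a. 2 * Phi (\<bar>\<mu>\<bar> * sqrt a)) \<longlongrightarrow> 2 * Phi (\<bar>\<mu>\<bar> * sqrt x)) (at_left x)"
      using c[of x] by (simp add: isCont_def filterlim_at_split)
  qed
  then show ?thesis by (simp add: Phi_0)
qed

text \<open>By the tilt, the integrand for \<mu> > 0 is a difference of normal densities with means
  \<mu> x and -\<mu> x. The value is then the mass of \<open>last_zero_density\<close> on (0, x):
  only the side towards which the drift points can escape.\<close>

lemma nn_integral_survival_forever:
  assumes x: "0 < x"
  shows "(\<integral>\<^sup>+w\<in>{0<..}. ennreal (normal_density (\<mu> * x) (sqrt x) w) * ennreal (survival_forever \<mu> w) \<partial>lborel)
    = (if 0 < \<mu> then ennreal (2 * Phi (\<mu> * sqrt x) - 1) else 0)"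
proof (cases "0 < \<mu>")
  case True
  have s: "0 < sqrt x" using x by simp
  have eq: "normal_density (\<mu> * x) (sqrt x) w * survival_forever \<mu> w
      = normal_density (\<mu> * x) (sqrt x) w - normal_density (- (\<mu> * x)) (sqrt x) w" for w
    using normal_density_exp_tilt[OF x, of \<mu> w] True by (simp add: survival_forever_def algebra_simps)
  have "(\<integral>\<^sup>+w\<in>{0<..}. ennreal (normal_density (\<mu> * x) (sqrt x) w - normal_density (- (\<mu> * x)) (sqrt x) w) \<partial>lborel)
    = ennreal (1 - 1 - (Phi ((0 - \<mu> * x) / sqrt x) - Phi ((0 - (- (\<mu> * x))) / sqrt x)))"
  proof (rule nn_integral_FTC_greaterThan)
    show "((\<lambda>w. Phi ((w - \<mu> * x) / sqrt x) - Phi ((w - (- (\<mu> * x))) / sqrt x)) has_real_derivative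
      normal_density (\<mu> * x) (sqrt x) w - normal_density (- (\<mu> * x)) (sqrt x) w) (at w)" for w
      by (intro DERIV_diff DERIV_Phi_affine s)
    show "isCont (\<lambda>w. normal_density (\<mu> * x) (sqrt x) w - normal_density (- (\<mu> * x)) (sqrt x) w) w" for w
      by (intro continuous_diff isCont_normal_density s)
    show "0 \<le> normal_density (\<mu> * x) (sqrt x) w - normal_density (- (\<mu> * x)) (sqrt x) w" if "0 < w" for w
      unfolding eq[symmetric] using that by (intro mult_nonneg_nonneg survival_forever_nonneg) auto
    have "isCont (\<lambda>w. Phi ((w - \<mu> * x) / sqrt x) - Phi ((w - (- (\<mu> * x))) / sqrt x)) 0"
      by (intro continuous_diff isCont_Phi_affine s)
    then show "((\<lambda>w. Phi ((w - \<mu> * x) / sqrt x) - Phi ((w - (- (\<mu> * x))) / sqrt x)) \<longlongrightarrow>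
      Phi ((0 - \<mu> * x) / sqrt x) - Phi ((0 - (- (\<mu> * x))) / sqrt x)) (at_right 0)"
      by (simp add: isCont_def filterlim_at_split)
    have "filterlim (\<lambda>w. (w - \<mu> * x) / sqrt x) at_top at_top" "filterlim (\<lambda>w. (w - (- (\<mu> * x))) / sqrt x) at_top at_top"
      using s by real_asymp+
    then show "((\<lambda>w. Phi ((w - \<mu> * x) / sqrt x) - Phi ((w - (- (\<mu> * x))) / sqrt x)) \<longlongrightarrow> 1 - 1) at_top"
      by (intro tendsto_diff filterlim_compose[OF Phi_at_top])
  qed
  also have "1 - 1 - (Phi ((0 - \<mu> * x) / sqrt x) - Phi ((0 - (- (\<mu> * x))) / sqrt x)) = 2 * Phi (\<mu> * sqrt x) - 1"
    using x Phi_minus[of "\<mu> * sqrt x"] real_div_sqrt[of x] by (simp flip: times_divide_eq_right)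
  also have "(\<integral>\<^sup>+w\<in>{0<..}. ennreal (normal_density (\<mu> * x) (sqrt x) w - normal_density (- (\<mu> * x)) (sqrt x) w) \<partial>lborel)
    = (\<integral>\<^sup>+w\<in>{0<..}. ennreal (normal_density (\<mu> * x) (sqrt x) w) * ennreal (survival_forever \<mu> w) \<partial>lborel)"
    by (intro nn_integral_cong)
       (auto simp: eq[symmetric] ennreal_mult survival_forever_nonneg split: split_indicator)
  finally show ?thesis using True by simp
next
  case False
  then show ?thesis by (simp add: survival_forever_def)
qed

text \<open>Insert the tail formula for \<open>survival\<close>, exchange the integrals, and shift
  the residual time r to the absolute time b = x + r.\<close>

lemma nn_integral_normal_survival:
  assumes x: "0 < x" and y: "x < y"
  shows "(\<integral>\<^sup>+w\<in>{0<..}. ennreal (normal_density (\<mu> * x) (sqrt x) w) * ennreal (survival \<mu> w (y - x)) \<partial>lborel)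
    = (if 0 < \<mu> then ennreal (2 * Phi (\<mu> * sqrt x) - 1) else 0)
      + (\<integral>\<^sup>+b\<in>{y<..}. ennreal (next_zero_density \<mu> x b / 2) \<partial>lborel)"
proof -
  let ?n = "\<lambda>w. ennreal (normal_density (\<mu> * x) (sqrt x) w)"
  let ?h = "\<lambda>w r. ennreal (hitting_density \<mu> w r)"
  have "(\<integral>\<^sup>+w\<in>{0<..}. ?n w * ennreal (survival \<mu> w (y - x)) \<partial>lborel)
      = (\<integral>\<^sup>+w. ?n w * ennreal (survival_forever \<mu> w) * indicator {0<..} w
          + (\<integral>\<^sup>+r. ?n w * ?h w r * indicator {0<..} w * indicator {y - x<..} r \<partial>lborel) \<partial>lborel)"
    using survival_eq_nn_integral(1)[of _ "y - x" \<mu>] y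
    by (intro nn_integral_cong)
       (auto simp: distrib_left nn_integral_cmult mult.assoc split: split_indicator)
  also have "\<dots> = (\<integral>\<^sup>+w\<in>{0<..}. ?n w * ennreal (survival_forever \<mu> w) \<partial>lborel)
      + (\<integral>\<^sup>+w. \<integral>\<^sup>+r. ?n w * ?h w r * indicator {0<..} w * indicator {y - x<..} r \<partial>lborel \<partial>lborel)"
    by (intro nn_integral_add) measurable
  also have "(\<integral>\<^sup>+w. \<integral>\<^sup>+r. ?n w * ?h w r * indicator {0<..} w * indicator {y - x<..} r \<partial>lborel \<partial>lborel)
      = (\<integral>\<^sup>+r. \<integral>\<^sup>+w. ?n w * ?h w r * indicator {0<..} w * indicator {y - x<..} r \<partial>lborel \<partial>lborel)"
    by (rule lborel_pair.Fubini') measurable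
  also have "\<dots> = (\<integral>\<^sup>+r\<in>{y - x<..}. ennreal (next_zero_density \<mu> x (x + r) / 2) \<partial>lborel)"
    using nn_integral_normal_hitting_density[OF x, of _ \<mu>] y
    by (intro nn_integral_cong) (auto simp: nn_integral_multc split: split_indicator)
  also have "\<dots> = (\<integral>\<^sup>+b\<in>{y<..}. ennreal (next_zero_density \<mu> x b / 2) \<partial>lborel)"
    using nn_integral_real_affine[of "\<lambda>b. ennreal (next_zero_density \<mu> x b / 2) * indicator {y<..} b" 1 x]
    by (auto intro!: nn_integral_cong split: split_indicator)
  finally show ?thesis
    unfolding nn_integral_survival_forever[OF x] .
qed

text \<open>As a function of its first argument, \<open>next_zero_density\<close> is an
  antiderivative of \<open>joint_density\<close> and vanishes at 0.\<close>

lemma nn_integral_joint_density: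
  assumes x: "0 < x" and b: "x < b"
  shows "(\<integral>\<^sup>+a\<in>{0<..<x}. ennreal (joint_density \<mu> a b) \<partial>lborel) = ennreal (next_zero_density \<mu> x b)"
proof -
  let ?e = "exp (- (\<mu>\<^sup>2 * b / 2))"
  have "(\<integral>\<^sup>+a\<in>{0<..<x}. ennreal (joint_density \<mu> a b) \<partial>lborel) = ennreal (next_zero_density \<mu> x b - next_zero_density \<mu> 0 b)"
  proof (rule nn_integral_FTC_greaterThanLessThan[OF x])
    fix a :: real assume a: "0 < a" "a < x"
    then have ba: "0 < b - a" using b by simp
    have D: "((\<lambda>a. a / (b - a)) has_real_derivative b / (b - a)\<^sup>2) (at a)"
      using ba by (auto intro!: derivative_eq_intros simp: power2_eq_square)
    have "((\<lambda>a. ?e * sqrt (a / (b - a)) / (pi * b)) has_real_derivative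
        ?e * (inverse (sqrt (a / (b - a))) / 2 * (b / (b - a)\<^sup>2)) / (pi * b)) (at a)"
      using a ba by (intro DERIV_cdivide DERIV_cmult DERIV_chain2[OF DERIV_real_sqrt D]) auto
    also have "?e * (inverse (sqrt (a / (b - a))) / 2 * (b / (b - a)\<^sup>2)) / (pi * b) = joint_density \<mu> a b"
      using a ba b x by (simp add: joint_density_def real_sqrt_mult sqrt_cube real_sqrt_divide divide_simps power2_eq_square)
    finally show "((\<lambda>a. next_zero_density \<mu> a b) has_real_derivative joint_density \<mu> a b) (at a)"
      unfolding next_zero_density_def .
    show "isCont (\<lambda>a. joint_density \<mu> a b) a"
      unfolding joint_density_def using a ba by (intro continuous_intros) auto
    show "0 \<le> joint_density \<mu> a b"
      unfolding joint_density_def using a ba by simp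
  next
    have c: "isCont (\<lambda>a. next_zero_density \<mu> a b) a" if "a < b" for a
      unfolding next_zero_density_def using that b x by (intro continuous_intros) auto
    show "((\<lambda>a. next_zero_density \<mu> a b) \<longlongrightarrow> next_zero_density \<mu> 0 b) (at_right 0)"
      using c[of 0] b x by (simp add: isCont_def filterlim_at_split)
    show "((\<lambda>a. next_zero_density \<mu> a b) \<longlongrightarrow> next_zero_density \<mu> x b) (at_left x)"
      using c[of x] b x by (simp add: isCont_def filterlim_at_split)
  qed
  then show ?thesis by (simp add: next_zero_density_def)
qed

text \<open>Density at a of the last zero before t. Written with \<open>Phi\<close> so that it can
  be differentiated in t; \<open>last_zero_marginal_eq\<close> recovers the denominator of the
  theorem from it.\<close>

definition last_zero_marginal :: "real \<Rightarrow> real \<Rightarrow> real \<Rightarrow> real" where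
  "last_zero_marginal \<mu> t a =
    1 / (pi * sqrt a) * (exp (- (\<mu>\<^sup>2 * t / 2)) / sqrt (t - a)
      + \<bar>\<mu>\<bar> * sqrt (2 * pi) * exp (- (\<mu>\<^sup>2 * a / 2)) * (Phi (\<bar>\<mu>\<bar> * sqrt (t - a)) - 1 / 2))"

lemma last_zero_marginal_pos:
  assumes "0 < a" "a < t"
  shows "0 < last_zero_marginal \<mu> t a"
proof -
  have "1 / 2 \<le> Phi (\<bar>\<mu>\<bar> * sqrt (t - a))"
    using Phi_mono[of 0 "\<bar>\<mu>\<bar> * sqrt (t - a)"] assms by (simp add: Phi_0)
  then show ?thesis
    using assms unfolding last_zero_marginal_def by (intro mult_pos_pos add_pos_nonneg) auto
qed

text \<open>As a function of t, minus \<open>last_zero_marginal\<close> is an antiderivative of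
  \<open>joint_density\<close> in b, and the limit of \<open>last_zero_marginal\<close> at infinity
  is \<open>last_zero_density\<close>: the boundary term is the mass of paths with no later
  zero.\<close>

lemma nn_integral_joint_density_right:
  assumes a: "0 < a" "a < t"
  shows "(\<integral>\<^sup>+b\<in>{t<..}. ennreal (joint_density \<mu> a b) \<partial>lborel) + ennreal (last_zero_density \<mu> a)
    = ennreal (last_zero_marginal \<mu> t a)"
proof -
  let ?q = "last_zero_density \<mu> a"
  have q: "?q = 1 / (pi * sqrt a) * (\<bar>\<mu>\<bar> * sqrt (2 * pi) * exp (- (\<mu>\<^sup>2 * a / 2)) * (1 - 1 / 2))"
    using a by (simp add: last_zero_density_def real_sqrt_mult field_simps)
  have D: "((\<lambda>b. last_zero_marginal \<mu> b a) has_real_derivative - joint_density \<mu> a b) (at b)" if b: "a < b" for b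
  proof -
    define c where "c = sqrt (b - a)"
    have c: "0 < c" "b - a = c\<^sup>2" using b by (auto simp: c_def)
    have S: "((\<lambda>b. sqrt (b - a)) has_real_derivative 1 / (2 * c)) (at b)"
      using b by (auto intro!: derivative_eq_intros simp: c_def field_simps)
    have E: "((\<lambda>b. exp (- (\<mu>\<^sup>2 * b / 2))) has_real_derivative - (\<mu>\<^sup>2 / 2) * exp (- (\<mu>\<^sup>2 * b / 2))) (at b)"
    proof -
      have "((\<lambda>b. - (\<mu>\<^sup>2 * b / 2)) has_real_derivative - (\<mu>\<^sup>2 / 2)) (at b)"
        using DERIV_cmult[OF DERIV_ident, of "- (\<mu>\<^sup>2 / 2)" b UNIV] by simp
      from DERIV_chain2[OF DERIV_exp this] show ?thesis by (simp only: mult.commute)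
    qed
    have Q: "((\<lambda>b. exp (- (\<mu>\<^sup>2 * b / 2)) / sqrt (b - a)) has_real_derivative
        (- (\<mu>\<^sup>2 / 2) * exp (- (\<mu>\<^sup>2 * b / 2)) * c - exp (- (\<mu>\<^sup>2 * b / 2)) * (1 / (2 * c))) / (c * c)) (at b)"
      using DERIV_divide[OF E S] b by (simp add: c_def)
    have P: "((\<lambda>b. Phi (\<bar>\<mu>\<bar> * sqrt (b - a))) has_real_derivative
        std_normal_density (\<bar>\<mu>\<bar> * c) * (\<bar>\<mu>\<bar> * (1 / (2 * c)))) (at b)"
      using DERIV_Phi_chain[OF DERIV_cmult[OF S, of "\<bar>\<mu>\<bar>"]] by (simp add: c_def)
    have "((\<lambda>b. last_zero_marginal \<mu> b a) has_real_derivative 1 / (pi * sqrt a) *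
       ((- (\<mu>\<^sup>2 / 2) * exp (- (\<mu>\<^sup>2 * b / 2)) * c - exp (- (\<mu>\<^sup>2 * b / 2)) * (1 / (2 * c))) / (c * c)
        + \<bar>\<mu>\<bar> * sqrt (2 * pi) * exp (- (\<mu>\<^sup>2 * a / 2)) * (std_normal_density (\<bar>\<mu>\<bar> * c) * (\<bar>\<mu>\<bar> * (1 / (2 * c))) - 0))) (at b)"
      unfolding last_zero_marginal_def
      by (intro DERIV_cmult DERIV_add Q DERIV_diff P DERIV_const)
    moreover have "exp (- (\<mu>\<^sup>2 * a / 2)) * (std_normal_density (\<bar>\<mu>\<bar> * c) * (\<bar>\<mu>\<bar> * (1 / (2 * c))) - 0)
        = exp (- (\<mu>\<^sup>2 * b / 2)) / sqrt (2 * pi) * (\<bar>\<mu>\<bar> * (1 / (2 * c)))"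
    proof -
      have "- (\<mu>\<^sup>2 * a / 2) + - (\<bar>\<mu>\<bar> * c)\<^sup>2 / 2 = - (\<mu>\<^sup>2 * b / 2)"
        using c(2) by (simp add: power_mult_distrib field_simps)
      then have "exp (- (\<mu>\<^sup>2 * a / 2)) * exp (- (\<bar>\<mu>\<bar> * c)\<^sup>2 / 2) = exp (- (\<mu>\<^sup>2 * b / 2))"
        by (simp only: exp_add[symmetric])
      then show ?thesis by (simp add: std_normal_density_def)
    qed
    ultimately have *: "((\<lambda>b. last_zero_marginal \<mu> b a) has_real_derivative 1 / (pi * sqrt a) *
       ((- (\<mu>\<^sup>2 / 2) * exp (- (\<mu>\<^sup>2 * b / 2)) * c - exp (- (\<mu>\<^sup>2 * b / 2)) * (1 / (2 * c))) / (c * c)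
        + \<bar>\<mu>\<bar> * sqrt (2 * pi) * (exp (- (\<mu>\<^sup>2 * b / 2)) / sqrt (2 * pi) * (\<bar>\<mu>\<bar> * (1 / (2 * c)))))) (at b)"
      by (simp only: mult.assoc)
    have "1 / (pi * sqrt a) *
       ((- (\<mu>\<^sup>2 / 2) * exp (- (\<mu>\<^sup>2 * b / 2)) * c - exp (- (\<mu>\<^sup>2 * b / 2)) * (1 / (2 * c))) / (c * c)
        + \<bar>\<mu>\<bar> * sqrt (2 * pi) * (exp (- (\<mu>\<^sup>2 * b / 2)) / sqrt (2 * pi) * (\<bar>\<mu>\<bar> * (1 / (2 * c)))))
      = 1 / (pi * sqrt a) * exp (- (\<mu>\<^sup>2 * b / 2)) *
       ((- (\<mu>\<^sup>2 / 2) * c - 1 / (2 * c)) / (c * c) + \<bar>\<mu>\<bar> * \<bar>\<mu>\<bar> / (2 * c))"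
      by (simp add: field_simps)
    \<comment> \<open>The drift term from the exponential cancels against the one from
      \<open>Phi\<close>.\<close>
    also have "(- (\<mu>\<^sup>2 / 2) * c - 1 / (2 * c)) / (c * c) + \<bar>\<mu>\<bar> * \<bar>\<mu>\<bar> / (2 * c) = - 1 / (2 * c ^ 3)"
      using c by (simp add: field_simps power2_eq_square power3_eq_cube)
    also have "1 / (pi * sqrt a) * exp (- (\<mu>\<^sup>2 * b / 2)) * (- 1 / (2 * c ^ 3)) = - joint_density \<mu> a b"
    proof -
      have "sqrt (a * (b - a) ^ 3) = sqrt a * c ^ 3"
        by (simp add: real_sqrt_mult real_sqrt_power c_def)
      then show ?thesis by (simp add: joint_density_def)
    qed
    finally show ?thesis using * by simp
  qed
  have 1: "((\<lambda>b. exp (- (\<mu>\<^sup>2 * b / 2)) / sqrt (b - a)) \<longlongrightarrow> 0) at_top"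
  proof (cases "\<mu> = 0")
    case True
    have "((\<lambda>b. 1 / sqrt (b - a)) \<longlongrightarrow> 0) at_top" by real_asymp
    then show ?thesis using True by simp
  next
    case False
    define m where "m = \<mu>\<^sup>2"
    have "0 < m" using False by (simp add: m_def)
    then have "((\<lambda>b. exp (- (m * b / 2)) / sqrt (b - a)) \<longlongrightarrow> 0) at_top" by real_asymp
    then show ?thesis by (simp add: m_def)
  qed
  have "((\<lambda>b. \<bar>\<mu>\<bar> * sqrt (2 * pi) * exp (- (\<mu>\<^sup>2 * a / 2)) * (Phi (\<bar>\<mu>\<bar> * sqrt (b - a)) - 1 / 2))
      \<longlongrightarrow> \<bar>\<mu>\<bar> * sqrt (2 * pi) * exp (- (\<mu>\<^sup>2 * a / 2)) * (1 - 1 / 2)) at_top"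
  proof (cases "\<mu> = 0")
    case False
    define m where "m = \<bar>\<mu>\<bar>"
    have "0 < m" using False by (simp add: m_def)
    then have "filterlim (\<lambda>b. m * sqrt (b - a)) at_top at_top" by real_asymp
    then show ?thesis unfolding m_def
      by (intro tendsto_mult tendsto_diff tendsto_const filterlim_compose[OF Phi_at_top])
  qed simp
  from tendsto_mult[OF tendsto_const tendsto_add[OF 1 this], of "1 / (pi * sqrt a)"]
  have lim: "((\<lambda>b. last_zero_marginal \<mu> b a) \<longlongrightarrow> ?q) at_top"
    unfolding last_zero_marginal_def q by simp
  have "(\<integral>\<^sup>+b\<in>{t<..}. ennreal (joint_density \<mu> a b) \<partial>lborel) = ennreal (- ?q - - last_zero_marginal \<mu> t a)"
  proof (rule nn_integral_FTC_greaterThan)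
    show "((\<lambda>b. - last_zero_marginal \<mu> b a) has_real_derivative joint_density \<mu> a b) (at b)" if "t < b" for b
      using DERIV_minus[OF D[of b]] that a by simp
    show "isCont (joint_density \<mu> a) b" if "t < b" for b
      unfolding joint_density_def using a that by (intro continuous_intros) auto
    show "0 \<le> joint_density \<mu> a b" if "t < b" for b
      unfolding joint_density_def using a that by simp
    show "((\<lambda>b. - last_zero_marginal \<mu> b a) \<longlongrightarrow> - last_zero_marginal \<mu> t a) (at_right t)"
      using DERIV_isCont[OF D[OF a(2)]]
      by (intro tendsto_minus) (auto simp: isCont_def filterlim_at_split)
    show "((\<lambda>b. - last_zero_marginal \<mu> b a) \<longlongrightarrow> - ?q) at_top"
      by (intro tendsto_minus lim)
  qed
  moreover have "0 \<le> ?q" using a by (simp add: last_zero_density_def)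
  \<comment> \<open>\<open>last_zero_marginal\<close> decreases in t, so the difference of the end
    values is nonnegative and \<open>ennreal\<close> does not truncate it.\<close>
  moreover have "?q \<le> last_zero_marginal \<mu> t a"
  proof (rule tendsto_upperbound[OF lim])
    have "last_zero_marginal \<mu> b a \<le> last_zero_marginal \<mu> t a" if "t \<le> b" for b
    proof (rule DERIV_nonpos_imp_nonincreasing[OF that])
      fix x assume "t \<le> x" "x \<le> b"
      with a have "((\<lambda>b. last_zero_marginal \<mu> b a) has_real_derivative - joint_density \<mu> a x) (at x)"
        and "0 \<le> joint_density \<mu> a x"
        using D[of x] by (simp_all add: joint_density_def)
      then show "\<exists>y. ((\<lambda>b. last_zero_marginal \<mu> b a) has_real_derivative y) (at x) \<and> y \<le> 0"
        by force
    qed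
    then show "\<forall>\<^sub>F b in at_top. last_zero_marginal \<mu> b a \<le> last_zero_marginal \<mu> t a"
      by (auto simp: eventually_at_top_linorder)
  qed simp
  ultimately show ?thesis
    by (simp add: ennreal_plus[symmetric] del: ennreal_plus)
qed

text \<open>The substitution u = |\<mu>| sqrt a y sends the upper limit to |\<mu>| sqrt (t - a) and
  turns the integral into a difference of values of \<open>Phi\<close>. For \<mu> = 0 both sides of
  the key identity \<open>I\<close> vanish.\<close>

lemma last_zero_marginal_eq:
  assumes a: "0 < a" "a < t"
  shows "last_zero_marginal \<mu> t a = exp (- (\<mu>\<^sup>2 * t / 2)) / (pi * sqrt (a * (t - a)))
    * (1 + \<mu>\<^sup>2 * sqrt (a * (t - a)) * exp (\<mu>\<^sup>2 / 2 * (t - a)) *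
        (LBINT y:{0..sqrt ((t - a) / a)}. exp (- (\<mu>\<^sup>2 * y\<^sup>2 * a / 2))))"
proof -
  let ?I = "LBINT y:{0..sqrt ((t - a) / a)}. exp (- (\<mu>\<^sup>2 * y\<^sup>2 * a / 2))"
  let ?c = "sqrt (t - a)"
  let ?P = "\<bar>\<mu>\<bar> * sqrt (2 * pi) * (Phi (\<bar>\<mu>\<bar> * ?c) - 1 / 2)"
  have I: "\<mu>\<^sup>2 * sqrt a * ?I = ?P"
  proof (cases "\<mu> = 0")
    case False
    let ?k = "\<bar>\<mu>\<bar> * sqrt a"
    have k: "0 < ?k" using False a by simp
    have "?I = Phi (?k * sqrt ((t - a) / a)) * (sqrt (2 * pi) / ?k) - Phi (?k * 0) * (sqrt (2 * pi) / ?k)"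
      unfolding set_lebesgue_integral_def real_scaleR_def
    proof (subst mult.commute, rule integral_FTC_Icc_real)
      fix y :: real
      have "((\<lambda>y. ?k * y) has_real_derivative ?k) (at y)"
        by (auto intro!: derivative_eq_intros)
      from DERIV_cmult_right[OF DERIV_Phi_chain[OF this], of "sqrt (2 * pi) / ?k"]
      have "((\<lambda>y. Phi (?k * y) * (sqrt (2 * pi) / ?k)) has_real_derivative
          std_normal_density (?k * y) * ?k * (sqrt (2 * pi) / ?k)) (at y)" .
      also have "std_normal_density (?k * y) * ?k * (sqrt (2 * pi) / ?k) = exp (- (\<mu>\<^sup>2 * y\<^sup>2 * a / 2))"
        using k a False by (simp add: std_normal_density_def power_mult_distrib mult_ac)
      finally show "((\<lambda>y. Phi (?k * y) * (sqrt (2 * pi) / ?k)) has_real_derivative exp (- (\<mu>\<^sup>2 * y\<^sup>2 * a / 2))) (at y)" .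
      show "isCont (\<lambda>y. exp (- (\<mu>\<^sup>2 * y\<^sup>2 * a / 2))) y"
        by (intro continuous_intros) auto
    qed (use a in auto)
    also have "?k * sqrt ((t - a) / a) = \<bar>\<mu>\<bar> * ?c"
      using a by (simp add: real_sqrt_divide)
    finally have "?I = (sqrt (2 * pi) / ?k) * (Phi (\<bar>\<mu>\<bar> * ?c) - 1 / 2)"
      by (simp add: Phi_0 algebra_simps)
    then have "?k * \<bar>\<mu>\<bar> * ?I = ?P"
      using False a by simp
    moreover have "?k * \<bar>\<mu>\<bar> = \<mu>\<^sup>2 * sqrt a"
      by (simp add: power2_eq_square)
    ultimately show ?thesis by simp
  qed simp
  have e: "exp (- (\<mu>\<^sup>2 * t / 2)) * exp (\<mu>\<^sup>2 / 2 * (t - a)) = exp (- (\<mu>\<^sup>2 * a / 2))"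
    by (simp add: exp_add[symmetric] field_simps)
  have "exp (- (\<mu>\<^sup>2 * t / 2)) / (pi * sqrt (a * (t - a)))
    * (1 + \<mu>\<^sup>2 * sqrt (a * (t - a)) * exp (\<mu>\<^sup>2 / 2 * (t - a)) * ?I)
    = 1 / (pi * sqrt a) * (exp (- (\<mu>\<^sup>2 * t / 2)) / ?c
       + (exp (- (\<mu>\<^sup>2 * t / 2)) * exp (\<mu>\<^sup>2 / 2 * (t - a))) * (\<mu>\<^sup>2 * sqrt a * ?I))"
  proof -
    have *: "X / (pi * (A * c)) * (1 + m * (A * c) * Y * Z) = 1 / (pi * A) * (X / c + (X * Y) * (m * A * Z))"
      if "0 < A" "0 < c" for X Y Z A c m :: real
      using that by (simp add: field_simps)
    show ?thesis
      unfolding real_sqrt_mult[of a "t - a"] by (rule *) (use a in auto)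
  qed
  then show ?thesis
    unfolding e I last_zero_marginal_def by (simp add: mult_ac)
qed

section \<open>Regular conditional distributions from joint densities\<close>

text \<open>\<open>K\<^sub>0\<close> is a junk value, taken where the marginal density of the conditioning variable is \<open>0\<close> or
  \<open>\<infinity>\<close>.\<close>

definition conditional_kernel :: "'b measure \<Rightarrow> 'b measure \<Rightarrow> ('c \<Rightarrow> 'b \<Rightarrow> ennreal) \<Rightarrow> 'c \<Rightarrow> 'b measure" where
  "conditional_kernel K\<^sub>0 S f y =
    (if (\<integral>\<^sup>+x. f y x \<partial>S) = 0 \<or> (\<integral>\<^sup>+x. f y x \<partial>S) = \<infinity> then K\<^sub>0
     else density S (\<lambda>x. f y x / (\<integral>\<^sup>+x. f y x \<partial>S)))"

text \<open>Bayes' formula relative to reference measures R and S. Sets generated by Y are preimages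
  of measurable sets, so knowing the joint law on rectangles is enough to characterize the
  conditional expectation.\<close>

lemma regular_conditional_distribution_conditional_kernel:
  fixes f :: "'c \<Rightarrow> 'b \<Rightarrow> ennreal"
  assumes M: "prob_space M"
    and X: "X \<in> measurable M N" and Y: "Y \<in> measurable M L"
    and S: "sigma_finite_measure S" "sets S = sets N" and R: "sets R = sets L"
    and f: "(\<lambda>(y, x). f y x) \<in> borel_measurable (R \<Otimes>\<^sub>M S)"
    and joint: "\<And>A C. A \<in> sets N \<Longrightarrow> C \<in> sets L \<Longrightarrow>
      emeasure M {\<omega> \<in> space M. X \<omega> \<in> A \<and> Y \<omega> \<in> C} = (\<integral>\<^sup>+y\<in>C. (\<integral>\<^sup>+x\<in>A. f y x \<partial>S) \<partial>R)"
    and K: "prob_space K\<^sub>0" "sets K\<^sub>0 = sets N"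
  shows "regular_conditional_distribution M N X L Y (conditional_kernel K\<^sub>0 S f)"
proof -
  interpret M: prob_space M by fact
  interpret S: sigma_finite_measure S by fact
  note [measurable] = X Y f
  note [measurable_cong] = S(2) R K(2)
  define h where "h y = (\<integral>\<^sup>+x. f y x \<partial>S)" for y
  let ?\<kappa> = "conditional_kernel K\<^sub>0 S f"
  have \<kappa>: "?\<kappa> y = (if h y = 0 \<or> h y = \<infinity> then K\<^sub>0 else density S (\<lambda>x. f y x / h y))" for y
    by (simp add: conditional_kernel_def h_def)
  have fy [measurable]: "f y \<in> borel_measurable S" if "y \<in> space L" for y
    using measurable_compose_Pair1[OF _ f, of y] that sets_eq_imp_space_eq[OF R] by simp
  have fA [measurable]: "(\<lambda>y. \<integral>\<^sup>+x\<in>A. f y x \<partial>S) \<in> borel_measurable L" if [measurable]: "A \<in> sets N" for A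
    by measurable
  have h [measurable]: "h \<in> borel_measurable L"
    unfolding h_def by measurable
  have em: "emeasure (?\<kappa> y) A = (if h y = 0 \<or> h y = \<infinity> then emeasure K\<^sub>0 A else (\<integral>\<^sup>+x\<in>A. f y x \<partial>S) / h y)"
    if "y \<in> space L" "A \<in> sets N" for y A
  proof -
    have [measurable]: "f y \<in> borel_measurable S" "A \<in> sets S" using that S fy by auto
    have "(\<integral>\<^sup>+x\<in>A. f y x / h y \<partial>S) = (\<integral>\<^sup>+x. f y x * indicator A x / h y \<partial>S)"
      by (intro nn_integral_cong) (simp add: divide_ennreal_def mult_ac)
    also have "\<dots> = (\<integral>\<^sup>+x\<in>A. f y x \<partial>S) / h y"
      by (rule nn_integral_divide) measurable
    finally show ?thesis
      by (simp add: \<kappa> emeasure_density)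
  qed
  have sets\<kappa>: "sets (?\<kappa> y) = sets N" for y
    by (simp add: \<kappa> S K)
  have prob\<kappa>: "prob_space (?\<kappa> y)" if "y \<in> space L" for y
  proof (cases "h y = 0 \<or> h y = \<infinity>")
    case False
    have sp: "space N = space S" using S(2) by (rule sets_eq_imp_space_eq[symmetric])
    have "(\<integral>\<^sup>+x\<in>space N. f y x \<partial>S) = h y"
      unfolding h_def sp by (intro nn_integral_cong) auto
    then have "emeasure (?\<kappa> y) (space N) = 1"
      using False em[OF that sets.top] by (auto simp: less_top intro!: ennreal_divide_self)
    then show ?thesis
      using sets_eq_imp_space_eq[OF sets\<kappa>] by (intro prob_spaceI) simp
  qed (simp add: \<kappa> K)
  have em_meas: "(\<lambda>y. emeasure (?\<kappa> y) A) \<in> borel_measurable L" if [measurable]: "A \<in> sets N" for A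
  proof -
    have "(\<lambda>y. if h y = 0 \<or> h y = \<infinity> then emeasure K\<^sub>0 A else (\<integral>\<^sup>+x\<in>A. f y x \<partial>S) / h y) \<in> borel_measurable L"
      by measurable
    then show ?thesis
      by (rule measurable_cong[THEN iffD1, rotated]) (simp add: em)
  qed
  have \<kappa>_meas [measurable]: "?\<kappa> \<in> measurable L (prob_algebra N)"
    by (intro measurable_prob_algebraI measurable_subprob_algebra em_meas prob\<kappa> sets\<kappa>
          prob_space_imp_subprob_space)
  have distrY: "distr M L Y = density R h"
  proof (rule measure_eqI)
    show "sets (distr M L Y) = sets (density R h)" by (simp add: R)
    fix C assume "C \<in> sets (distr M L Y)"
    then have C [measurable]: "C \<in> sets L" by simp
    have "emeasure (distr M L Y) C = emeasure M {\<omega> \<in> space M. X \<omega> \<in> space N \<and> Y \<omega> \<in> C}"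
      using measurable_space[OF X] by (subst emeasure_distr) (auto intro!: arg_cong[of _ _ "emeasure M"])
    also have "\<dots> = (\<integral>\<^sup>+y\<in>C. (\<integral>\<^sup>+x\<in>space N. f y x \<partial>S) \<partial>R)"
      by (rule joint) auto
    also have "\<dots> = (\<integral>\<^sup>+y\<in>C. h y \<partial>R)"
      unfolding h_def using sets_eq_imp_space_eq[OF S(2)]
      by (intro nn_integral_cong arg_cong2[where f = "(*)"] refl) auto
    finally show "emeasure (distr M L Y) C = emeasure (density R h) C"
      by (subst emeasure_density) auto
  qed
  have "emeasure (density R h) (space L) = 1"
    unfolding distrY[symmetric] using M.prob_space_distr[OF Y] prob_space.emeasure_space_1 by fastforce
  then have "(\<integral>\<^sup>+y. h y \<partial>R) = 1"
    using sets_eq_imp_space_eq[OF R]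
    by (subst (asm) emeasure_density) (auto simp: nn_integral_set_ennreal[symmetric] cong: nn_integral_cong_simp)
  \<comment> \<open>Total mass 1 makes the marginal density finite almost everywhere, so the junk
    case of an infinite marginal is a null set.\<close>
  then have fin: "AE y in R. h y \<noteq> \<infinity>"
    by (intro nn_integral_noteq_infinite) auto
  have int: "(\<integral>\<^sup>+\<omega>. indicator C (Y \<omega>) * emeasure (?\<kappa> (Y \<omega>)) A \<partial>M)
      = emeasure M {\<omega> \<in> space M. X \<omega> \<in> A \<and> Y \<omega> \<in> C}"
    if A [measurable]: "A \<in> sets N" and C [measurable]: "C \<in> sets L" for A C
  proof -
    note em_meas[OF A, measurable]
    have "(\<integral>\<^sup>+\<omega>. indicator C (Y \<omega>) * emeasure (?\<kappa> (Y \<omega>)) A \<partial>M)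
        = (\<integral>\<^sup>+y. indicator C y * emeasure (?\<kappa> y) A \<partial>distr M L Y)"
      by (subst nn_integral_distr) auto
    also have "\<dots> = (\<integral>\<^sup>+y. h y * (indicator C y * emeasure (?\<kappa> y) A) \<partial>R)"
      unfolding distrY by (subst nn_integral_density) auto
    also have "\<dots> = (\<integral>\<^sup>+y\<in>C. (\<integral>\<^sup>+x\<in>A. f y x \<partial>S) \<partial>R)"
    proof (intro nn_integral_cong_AE)
      show "AE y in R. h y * (indicator C y * emeasure (?\<kappa> y) A) = (\<integral>\<^sup>+x\<in>A. f y x \<partial>S) * indicator C y"
        using fin AE_space
      proof eventually_elim
        fix y assume y: "h y \<noteq> \<infinity>" "y \<in> space R"
        then have yL: "y \<in> space L" using sets_eq_imp_space_eq[OF R] by simp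
        show "h y * (indicator C y * emeasure (?\<kappa> y) A) = (\<integral>\<^sup>+x\<in>A. f y x \<partial>S) * indicator C y"
        proof (cases "h y = 0")
          case True
          \<comment> \<open>A vanishing marginal forces the partial integral to vanish too, so the
            junk kernel contributes nothing.\<close>
          have "(\<integral>\<^sup>+x\<in>A. f y x \<partial>S) \<le> h y"
            unfolding h_def by (intro nn_integral_mono) (auto split: split_indicator)
          then show ?thesis using True by simp
        next
          case False
          then have "h y * ((\<integral>\<^sup>+x\<in>A. f y x \<partial>S) / h y) = (\<integral>\<^sup>+x\<in>A. f y x \<partial>S)"
            using y(1) unfolding ennreal_times_divide
            by (subst mult.commute) (simp add: mult_divide_eq_ennreal)
          then show ?thesis
            using False y(1) em[OF yL A] by (auto split: split_indicator)
        qed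
      qed
    qed
    also have "\<dots> = emeasure M {\<omega> \<in> space M. X \<omega> \<in> A \<and> Y \<omega> \<in> C}"
      by (rule joint[symmetric]) auto
    finally show ?thesis .
  qed
  let ?F = "vimage_algebra (space M) Y L"
  have sub: "subalgebra M ?F"
    using measurable_sets[OF Y] measurable_space[OF Y]
    by (auto simp: subalgebra_def sets_vimage_algebra2)
  interpret F: finite_measure_subalgebra M ?F
    by (standard) (rule sub)
  have \<kappa>p: "prob_space (?\<kappa> (Y \<omega>))" if "\<omega> \<in> space M" for \<omega>
    using prob\<kappa> measurable_space[OF Y that] .
  have "AE \<omega> in M. real_cond_exp M ?F (indicator (X -` A \<inter> space M)) \<omega> = measure (?\<kappa> (Y \<omega>)) A"
    if A [measurable]: "A \<in> sets N" for A
  proof (rule F.real_cond_exp_charact)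
    note em_meas[OF A, measurable]
    have m_meas [measurable]: "(\<lambda>y. measure (?\<kappa> y) A) \<in> borel_measurable L"
      unfolding measure_def by measurable
    have "Y \<in> measurable ?F L"
      using measurable_space[OF Y] by (intro measurable_vimage_algebra1) auto
    then show "(\<lambda>\<omega>. measure (?\<kappa> (Y \<omega>)) A) \<in> borel_measurable ?F"
      by measurable
    show "integrable M (indicator (X -` A \<inter> space M) :: _ \<Rightarrow> real)"
      by (intro integrable_real_indicator) (auto simp: less_top[symmetric])
    show "integrable M (\<lambda>\<omega>. measure (?\<kappa> (Y \<omega>)) A)"
      using \<kappa>p prob_space.prob_le_1 by (intro M.integrable_const_bound[of _ 1]) (auto intro!: AE_I2)
    fix D assume "D \<in> sets ?F"
    then obtain C where C [measurable]: "C \<in> sets L" and D: "D = Y -` C \<inter> space M"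
      using measurable_space[OF Y] by (auto simp: sets_vimage_algebra2)
    have "(\<integral>\<omega>\<in>D. indicator (X -` A \<inter> space M) \<omega> \<partial>M) = (\<integral>\<omega>. indicator {\<omega> \<in> space M. X \<omega> \<in> A \<and> Y \<omega> \<in> C} \<omega> \<partial>M)"
      unfolding set_lebesgue_integral_def D
      by (intro Bochner_Integration.integral_cong) (auto split: split_indicator)
    also have "\<dots> = measure M {\<omega> \<in> space M. X \<omega> \<in> A \<and> Y \<omega> \<in> C}"
      by simp
    also have "\<dots> = enn2real (\<integral>\<^sup>+\<omega>. indicator C (Y \<omega>) * emeasure (?\<kappa> (Y \<omega>)) A \<partial>M)"
      unfolding int[OF A C] by (simp add: measure_def)
    also have "(\<integral>\<^sup>+\<omega>. indicator C (Y \<omega>) * emeasure (?\<kappa> (Y \<omega>)) A \<partial>M)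
        = (\<integral>\<^sup>+\<omega>. ennreal (indicator C (Y \<omega>) * measure (?\<kappa> (Y \<omega>)) A) \<partial>M)"
    proof (intro nn_integral_cong)
      fix \<omega> assume "\<omega> \<in> space M"
      then interpret k: prob_space "?\<kappa> (Y \<omega>)" by (rule \<kappa>p)
      show "indicator C (Y \<omega>) * emeasure (?\<kappa> (Y \<omega>)) A = ennreal (indicator C (Y \<omega>) * measure (?\<kappa> (Y \<omega>)) A)"
        by (simp add: k.emeasure_eq_measure split: split_indicator)
    qed
    also have "enn2real \<dots> = (\<integral>\<omega>. indicator C (Y \<omega>) * measure (?\<kappa> (Y \<omega>)) A \<partial>M)"
      by (rule integral_eq_nn_integral[symmetric]) auto
    also have "\<dots> = (\<integral>\<omega>\<in>D. measure (?\<kappa> (Y \<omega>)) A \<partial>M)"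
      unfolding set_lebesgue_integral_def D
      by (intro Bochner_Integration.integral_cong) (auto split: split_indicator)
    finally show "(\<integral>\<omega>\<in>D. indicator (X -` A \<inter> space M) \<omega> \<partial>M) = (\<integral>\<omega>\<in>D. measure (?\<kappa> (Y \<omega>)) A \<partial>M)" .
  qed
  then show ?thesis
    unfolding regular_conditional_distribution_def by (auto intro: X Y \<kappa>_meas)
qed

section \<open>A reflection principle with drift\<close>

lemma borel_measurable_indicator_Collect [measurable (raw)]:
  "Measurable.pred M P \<Longrightarrow> (\<lambda>\<omega>. indicator (Collect P) \<omega> :: real) \<in> borel_measurable M"
  unfolding indicator_def by measurable

lemma abs_lebesgue_integral_le:
  fixes f g :: "'a \<Rightarrow> real"
  assumes "f \<in> borel_measurable M" "integrable M g" "\<And>x. x \<in> space M \<Longrightarrow> \<bar>f x\<bar> \<le> g x"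
  shows "\<bar>\<integral>x. f x \<partial>M\<bar> \<le> (\<integral>x. g x \<partial>M)"
proof -
  have "integrable M f"
    by (rule Bochner_Integration.integrable_bound[OF assms(2,1)]) (use assms(3) in force)
  then show ?thesis
    using assms by (intro order_trans[OF integral_abs_bound integral_mono]) auto
qed

context brownian_motion
begin

section \<open>Drifted increments and independence of the past\<close>

lemma brownian_motion_uminus: "brownian_motion M (\<lambda>s \<omega>. - B s \<omega>)"
proof unfold_locales
  show "random_variable borel (\<lambda>\<omega>. - B s \<omega>)" if "0 \<le> s" for s
    using random_variable_B[OF that] by measurable
  show "- B 0 \<omega> = 0" if "\<omega> \<in> space M" for \<omega>
    using start_at_0[OF that] by simp
  show "indep_vars (\<lambda>_. borel) (\<lambda>i \<omega>. - B (\<tau> (Suc i)) \<omega> - - B (\<tau> i) \<omega>) {..<n}"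
    if "0 \<le> \<tau> 0" "strict_mono_on {..n} \<tau>" for n :: nat and \<tau>
    using indep_vars_compose2[OF independent_increments[OF that], of "\<lambda>_ z. - z" "\<lambda>_. borel"] by simp
  show "distributed M lborel (\<lambda>\<omega>. - B s \<omega> - - B r \<omega>) (normal_density 0 (sqrt (s - r)))"
    if "0 \<le> r" "r < s" for r s
    using normal_density_affine[OF gaussian_increments[OF that], of "-1" 0] that by simp
  show "continuous_on {0..} (\<lambda>s. - B s \<omega>)" if "\<omega> \<in> space M" for \<omega>
    using continuous_paths[OF that] by (rule continuous_on_minus)
qed

lemma distributed_drift_increment:
  assumes "0 \<le> r" "r < s"
  shows "distributed M lborel (\<lambda>\<omega>. B s \<omega> - B r \<omega> + \<mu> * (s - r)) (normal_density (\<mu> * (s - r)) (sqrt (s - r)))"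
  using normal_density_affine[OF gaussian_increments[OF assms], of 1 "\<mu> * (s - r)"] assms
  by (simp add: add.commute)

lemma distributed_drift:
  assumes "0 < s"
  shows "distributed M lborel (\<lambda>\<omega>. B s \<omega> + \<mu> * s) (normal_density (\<mu> * s) (sqrt s))"
proof -
  have D: "distributed M lborel (\<lambda>\<omega>. B s \<omega> - B 0 \<omega> + \<mu> * s) (normal_density (\<mu> * s) (sqrt s))"
    using distributed_drift_increment[of 0 s \<mu>] assms by simp
  have "random_variable lborel (\<lambda>\<omega>. B s \<omega> + \<mu> * s)"
    using random_variable_B[of s] assms by simp
  moreover have "distr M lborel (\<lambda>\<omega>. B s \<omega> + \<mu> * s) = distr M lborel (\<lambda>\<omega>. B s \<omega> - B 0 \<omega> + \<mu> * s)"
    by (intro distr_cong) (auto simp: start_at_0)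
  ultimately show ?thesis
    using D by (simp add: distributed_def)
qed

text \<open>The values at the times r i are partial sums of consecutive increments, hence functions
  of a block of increments that is independent of the last one.\<close>

lemma indep_past_increment:
  fixes r :: "nat \<Rightarrow> real"
  assumes r0: "0 < r 0" and mono: "strict_mono_on {..k} r" and T: "r k < T"
  shows "distr M (PiM {..k} (\<lambda>_. borel) \<Otimes>\<^sub>M borel)
      (\<lambda>\<omega>. (\<lambda>i\<in>{..k}. B (r i) \<omega> - B 0 \<omega>, B T \<omega> - B (r k) \<omega>))
    = distr M (PiM {..k} (\<lambda>_. borel)) (\<lambda>\<omega>. \<lambda>i\<in>{..k}. B (r i) \<omega> - B 0 \<omega>)
      \<Otimes>\<^sub>M distr M borel (\<lambda>\<omega>. B T \<omega> - B (r k) \<omega>)"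
proof -
  \<comment> \<open>Time 0 is put in front and T at the end: increments 0 to k make up the past,
    with increment i ending at r i, and increment k + 1 runs from r k to T.\<close>
  define \<tau> where "\<tau> i = (case i of 0 \<Rightarrow> 0 | Suc j \<Rightarrow> if j \<le> k then r j else T)" for i :: nat
  have le: "r i \<le> r j" if "i \<le> j" "j \<le> k" for i j
    using strict_mono_on_leD[OF mono, of i j] that by simp
  have "strict_mono_on {..Suc (Suc k)} \<tau>"
  proof (rule strict_mono_onI)
    fix i j assume ij: "i \<in> {..Suc (Suc k)}" "j \<in> {..Suc (Suc k)}" "i < j"
    then obtain j' where j: "j = Suc j'" by (cases j) auto
    show "\<tau> i < \<tau> j"
    proof (cases i)
      case 0
      then show ?thesis
        using le[of 0 j'] le[of 0 k] r0 T by (auto simp: \<tau>_def j)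
    next
      case (Suc i')
      then show ?thesis
        using strict_mono_onD[OF mono, of i' j'] le[of i' k] ij T by (auto simp: \<tau>_def j)
    qed
  qed
  then have "indep_vars (\<lambda>_. borel) (\<lambda>i \<omega>. B (\<tau> (Suc i)) \<omega> - B (\<tau> i) \<omega>) {..<Suc (Suc k)}"
    by (rule independent_increments[rotated]) (simp add: \<tau>_def)
  from indep_var_restrict[OF this, of "{..k}" "{Suc k}"]
  have ind: "indep_var (PiM {..k} (\<lambda>_. borel)) (\<lambda>\<omega>. \<lambda>i\<in>{..k}. B (\<tau> (Suc i)) \<omega> - B (\<tau> i) \<omega>)
      (PiM {Suc k} (\<lambda>_. borel)) (\<lambda>\<omega>. \<lambda>i\<in>{Suc k}. B (\<tau> (Suc i)) \<omega> - B (\<tau> i) \<omega>)"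
    (is "indep_var ?P ?W ?P' ?V")
    by (simp add: subset_iff)
  then have [measurable]: "random_variable ?P ?W" "random_variable ?P' ?V"
    by (auto dest: indep_var_rv1 indep_var_rv2)
  let ?sums = "\<lambda>g. \<lambda>i\<in>{..k}. \<Sum>j\<le>i. g j :: real"
  let ?last = "\<lambda>g. g (Suc k) :: real"
  have [measurable]: "?sums \<in> measurable ?P ?P"
    by (auto intro!: measurable_restrict borel_measurable_sum measurable_component_singleton)
  have [measurable]: "?last \<in> measurable ?P' borel"
    by (rule measurable_component_singleton) simp
  have W: "?sums (?W \<omega>) = (\<lambda>i\<in>{..k}. B (r i) \<omega> - B 0 \<omega>)" for \<omega>
  proof
    fix i
    have "(\<Sum>j\<le>i. B (\<tau> (Suc j)) \<omega> - B (\<tau> j) \<omega>) = B (\<tau> (Suc i)) \<omega> - B (\<tau> 0) \<omega>"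
      using sum_lessThan_telescope[of "\<lambda>j. B (\<tau> j) \<omega>" "Suc i"] by (simp add: lessThan_Suc_atMost)
    then show "?sums (?W \<omega>) i = (\<lambda>i\<in>{..k}. B (r i) \<omega> - B 0 \<omega>) i"
      by (auto simp: \<tau>_def restrict_def cong: sum.cong_simp)
  qed
  have V: "?last (?V \<omega>) = B T \<omega> - B (r k) \<omega>" for \<omega>
    by (simp add: \<tau>_def)
  have "distr M (?P \<Otimes>\<^sub>M borel) (\<lambda>\<omega>. (?sums (?W \<omega>), ?last (?V \<omega>)))
      = distr (distr M (?P \<Otimes>\<^sub>M ?P') (\<lambda>\<omega>. (?W \<omega>, ?V \<omega>))) (?P \<Otimes>\<^sub>M borel) (\<lambda>(w, v). (?sums w, ?last v))"
    by (subst distr_distr) (auto simp: comp_def)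
  also have "\<dots> = distr (distr M ?P ?W \<Otimes>\<^sub>M distr M ?P' ?V) (?P \<Otimes>\<^sub>M borel) (\<lambda>(w, v). (?sums w, ?last v))"
    using ind unfolding indep_var_distribution_eq by simp
  also have "\<dots> = distr (distr M ?P ?W) ?P ?sums \<Otimes>\<^sub>M distr (distr M ?P' ?V) borel ?last"
  proof (rule pair_measure_distr[symmetric])
    interpret V: prob_space "distr M ?P' ?V" by (rule prob_space_distr) simp
    interpret D: prob_space "distr (distr M ?P' ?V) borel ?last" by (rule V.prob_space_distr) simp
    show "sigma_finite_measure (distr (distr M ?P' ?V) borel ?last)" ..
  qed simp_all
  also have "\<dots> = distr M ?P (\<lambda>\<omega>. ?sums (?W \<omega>)) \<Otimes>\<^sub>M distr M borel (\<lambda>\<omega>. ?last (?V \<omega>))"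
    by (simp add: distr_distr comp_def)
  finally show ?thesis
    unfolding W V .
qed

lemma integrable_reflected:
  assumes "0 < T"
  shows "integrable M (\<lambda>\<omega>. reflected \<mu> (B T \<omega> + \<mu> * T + c))"
  using integral_reflected(1)[OF assms, of \<mu> c]
  by (subst distributed_integrable[OF distributed_drift[OF assms, of \<mu>], of "\<lambda>w. reflected \<mu> (w + c)", symmetric])
     (auto simp: add.commute mult.commute)

text \<open>The Markov property in the only form used, tested on finitely many past values: the
  increment after r k is independent of them, and Fubini replaces \<open>reflected\<close> by its
  Gaussian mean \<open>survival\<close>.\<close>

lemma integral_reflected_past:
  fixes r :: "nat \<Rightarrow> real"
  assumes r0: "0 < r 0" and mono: "strict_mono_on {..k} r" and T: "r k < T"
    and Q: "Q \<in> sets (PiM {..k} (\<lambda>_. borel))"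
  shows "(\<integral>\<omega>. indicator Q (\<lambda>i\<in>{..k}. B (r i) \<omega>) * reflected \<mu> (B T \<omega> + \<mu> * T + c) \<partial>M)
    = (\<integral>\<omega>. indicator Q (\<lambda>i\<in>{..k}. B (r i) \<omega>) * survival \<mu> (B (r k) \<omega> + \<mu> * r k + c) (T - r k) \<partial>M)"
proof -
  note [measurable] = Q
  have rk: "0 < r k"
    using strict_mono_on_leD[OF mono, of 0 k] r0 by auto
  define s where "s = T - r k"
  have s: "0 < s" using T by (simp add: s_def)
  let ?P = "PiM {..k} (\<lambda>_. borel :: real measure)"
  define W where "W \<omega> = (\<lambda>i\<in>{..k}. B (r i) \<omega> - B 0 \<omega>)" for \<omega>
  define V where "V \<omega> = B T \<omega> - B (r k) \<omega> + \<mu> * s" for \<omega>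
  define N where "N = density lborel (\<lambda>v. ennreal (normal_density (\<mu> * s) (sqrt s) v))"
  have W0: "W \<omega> = (\<lambda>i\<in>{..k}. B (r i) \<omega>)" if "\<omega> \<in> space M" for \<omega>
    using start_at_0[OF that] by (simp add: W_def)
  have WV: "B T \<omega> + \<mu> * T + c = W \<omega> k + \<mu> * r k + c + V \<omega>" if "\<omega> \<in> space M" for \<omega>
    using start_at_0[OF that] by (simp add: W_def V_def s_def algebra_simps)
  have rv: "random_variable borel (B (r i))" if "i \<le> k" for i
    using strict_mono_on_leD[OF mono, of 0 i] r0 that by (intro random_variable_B) auto
  have W_rv [measurable]: "random_variable ?P W"
    unfolding W_def using rv random_variable_B[of 0] by (intro measurable_restrict borel_measurable_diff) auto
  have V_rv [measurable]: "random_variable borel V"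
    unfolding V_def using rv[of k] random_variable_B[of T] rk T by (intro borel_measurable_add borel_measurable_diff) auto
  have "distributed M lborel V (normal_density (\<mu> * s) (sqrt s))"
    using distributed_drift_increment[of "r k" T \<mu>] rk T by (simp add: V_def[abs_def] s_def)
  then have dV: "distr M borel V = N"
    unfolding N_def distributed_def by (simp cong: distr_cong)
  \<comment> \<open>Adding the deterministic drift to the second component preserves the product
    form of the joint law.\<close>
  have dWV: "distr M (?P \<Otimes>\<^sub>M borel) (\<lambda>\<omega>. (W \<omega>, V \<omega>)) = distr M ?P W \<Otimes>\<^sub>M N"
  proof -
    let ?U = "\<lambda>\<omega>. B T \<omega> - B (r k) \<omega>"
    have U [measurable]: "random_variable borel ?U"
      using rv[of k] random_variable_B[of T] rk T by (intro borel_measurable_diff) auto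
    have "distr M (?P \<Otimes>\<^sub>M borel) (\<lambda>\<omega>. (W \<omega>, V \<omega>))
        = distr (distr M (?P \<Otimes>\<^sub>M borel) (\<lambda>\<omega>. (W \<omega>, ?U \<omega>))) (?P \<Otimes>\<^sub>M borel) (\<lambda>(w, v). (w, v + \<mu> * s))"
      by (subst distr_distr) (auto simp: comp_def V_def)
    also have "distr M (?P \<Otimes>\<^sub>M borel) (\<lambda>\<omega>. (W \<omega>, ?U \<omega>)) = distr M ?P W \<Otimes>\<^sub>M distr M borel ?U"
      unfolding W_def by (rule indep_past_increment[OF r0 mono T])
    also have "distr (distr M ?P W \<Otimes>\<^sub>M distr M borel ?U) (?P \<Otimes>\<^sub>M borel) (\<lambda>(w, v). (w, v + \<mu> * s))
        = distr (distr M ?P W) ?P (\<lambda>w. w) \<Otimes>\<^sub>M distr (distr M borel ?U) borel (\<lambda>v. v + \<mu> * s)"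
    proof (rule pair_measure_distr[symmetric])
      interpret U: prob_space "distr M borel ?U" by (rule prob_space_distr) simp
      interpret D: prob_space "distr (distr M borel ?U) borel (\<lambda>v. v + \<mu> * s)" by (rule U.prob_space_distr) simp
      show "sigma_finite_measure (distr (distr M borel ?U) borel (\<lambda>v. v + \<mu> * s))" ..
    qed simp_all
    also have "distr (distr M borel ?U) borel (\<lambda>v. v + \<mu> * s) = N"
      unfolding dV[symmetric] by (subst distr_distr) (auto simp: comp_def V_def[abs_def])
    finally show ?thesis
      by (simp add: distr_id2)
  qed
  interpret N: prob_space N
    unfolding N_def using s by (intro prob_space_normal_density) simp
  interpret PW: prob_space "distr M ?P W" by (rule prob_space_distr) simp
  interpret pair_sigma_finite "distr M ?P W" N ..
  let ?f = "\<lambda>w v. indicator Q w * reflected \<mu> (w k + \<mu> * r k + c + v)"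
  have [measurable]: "(\<lambda>(w, v). ?f w v) \<in> borel_measurable (?P \<Otimes>\<^sub>M borel)"
    by measurable
  have sN [measurable_cong]: "sets N = sets borel" by (simp add: N_def)
  have refl: "integrable M (\<lambda>\<omega>. reflected \<mu> (B T \<omega> + \<mu> * T + c))"
    using rk T by (intro integrable_reflected) simp
  then have "integrable M (\<lambda>\<omega>. indicator Q (W \<omega>) * reflected \<mu> (B T \<omega> + \<mu> * T + c))"
    by (rule Bochner_Integration.integrable_bound)
       (use borel_measurable_integrable[OF refl] in \<open>auto split: split_indicator\<close>)
  then have "integrable M (\<lambda>\<omega>. case (W \<omega>, V \<omega>) of (w, v) \<Rightarrow> ?f w v)"
    by (rule Bochner_Integration.integrable_cong[THEN iffD1, rotated 2]) (auto simp: WV)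
  \<comment> \<open>Integrability over the product is pulled back to M through the joint law of W
    and V.\<close>
  then have int: "integrable (distr M ?P W \<Otimes>\<^sub>M N) (\<lambda>(w, v). ?f w v)"
    unfolding dWV[symmetric] by (subst integrable_distr_eq) auto
  have inner: "(\<integral>v. ?f w v \<partial>N) = indicator Q w * survival \<mu> (w k + \<mu> * r k + c) s" for w
    unfolding N_def using integral_reflected(2)[OF s, of \<mu> "w k + \<mu> * r k + c"]
    by (subst integral_density) (auto simp: mult_ac)
  have "(\<integral>\<omega>. indicator Q (\<lambda>i\<in>{..k}. B (r i) \<omega>) * reflected \<mu> (B T \<omega> + \<mu> * T + c) \<partial>M)
      = (\<integral>\<omega>. (case (W \<omega>, V \<omega>) of (w, v) \<Rightarrow> ?f w v) \<partial>M)"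
    by (intro Bochner_Integration.integral_cong) (auto simp: WV W0[symmetric])
  also have "\<dots> = (\<integral>z. (case z of (w, v) \<Rightarrow> ?f w v) \<partial>(distr M ?P W \<Otimes>\<^sub>M N))"
    unfolding dWV[symmetric] by (subst integral_distr) auto
  also have "\<dots> = (\<integral>w. (\<integral>v. ?f w v \<partial>N) \<partial>distr M ?P W)"
    by (rule integral_fst[OF int, symmetric])
  also have "\<dots> = (\<integral>\<omega>. indicator Q (W \<omega>) * survival \<mu> (W \<omega> k + \<mu> * r k + c) s \<partial>M)"
    unfolding inner by (subst integral_distr) auto
  also have "\<dots> = (\<integral>\<omega>. indicator Q (\<lambda>i\<in>{..k}. B (r i) \<omega>) * survival \<mu> (B (r k) \<omega> + \<mu> * r k + c) (T - r k) \<partial>M)"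
    by (intro Bochner_Integration.integral_cong) (auto simp: W0 s_def)
  finally show ?thesis .
qed

text \<open>Decompose along the first grid time \<open>r (k + 1)\<close> with a negative value.  If that value is at least
  \<open>-\<epsilon>\<close>, the conditional mean of \<open>reflected\<close> given the past is a small value of \<open>survival\<close>; otherwise a
  single grid step exceeds \<open>\<epsilon>\<close>.\<close>

lemma integral_reflected_grid_bound:
  fixes n :: nat and c \<mu> x y T \<epsilon> :: real
  assumes x: "0 < x" "x < y" "y < T" and n: "0 < n" and \<epsilon>: "0 < \<epsilon>"
  defines "X \<equiv> \<lambda>s \<omega>. B s \<omega> + \<mu> * s + c" and "r \<equiv> \<lambda>i. x + (y - x) * real i / real n"
  shows "\<bar>(\<integral>\<omega>. reflected \<mu> (X T \<omega>) * indicator {\<omega>. 0 \<le> X x \<omega>} \<omega> \<partial>M)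
        - (\<integral>\<omega>. reflected \<mu> (X T \<omega>) * indicator {\<omega>. \<forall>i\<le>n. 0 \<le> X (r i) \<omega>} \<omega> \<partial>M)\<bar>
    \<le> 2 * \<epsilon> / sqrt (T - y) + (exp (2 * \<bar>\<mu>\<bar> * \<epsilon>) - 1)
      + (\<integral>\<omega>. \<bar>reflected \<mu> (X T \<omega>)\<bar> * indicator {\<omega>. \<exists>k<n. \<epsilon> < \<bar>X (r (Suc k)) \<omega> - X (r k) \<omega>\<bar>} \<omega> \<partial>M)"
    (is "\<bar>?L - ?G\<bar> \<le> ?R")
proof -
  let ?\<rho> = "\<lambda>\<omega>. reflected \<mu> (X T \<omega>)"
  \<comment> \<open>The estimate of \<open>survival_bound\<close> for values within \<epsilon> of 0
    and a remaining time of at least T - y.\<close>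
  define m where "m = 2 * \<epsilon> / sqrt (T - y) + (exp (2 * \<bar>\<mu>\<bar> * \<epsilon>) - 1)"
  let ?E = "{\<omega>. \<exists>k<n. \<epsilon> < \<bar>X (r (Suc k)) \<omega> - X (r k) \<omega>\<bar>}"
  have m: "0 \<le> m" using \<epsilon> x by (simp add: m_def)
  have r0: "r 0 = x" and rn: "r n = y" using n by (auto simp: r_def)
  have rpos: "0 < r i" for i
    using x unfolding r_def by (intro add_pos_nonneg) auto
  have rmono: "r i < r j" if "i < j" for i j
    using that x n by (simp add: r_def divide_strict_right_mono)
  have rT: "r i < T" "T - y \<le> T - r i" if "i \<le> n" for i
    using rmono[of i n] that x unfolding rn by (cases "i = n"; simp add: rn)+
  have X_meas [measurable]: "random_variable borel (X s)" if "0 \<le> s" for s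
    unfolding X_def using random_variable_B[OF that] by measurable
  have Xr [measurable]: "random_variable borel (X (r i))" for i
    using rpos[of i] by (intro X_meas) simp
  have XT [measurable]: "random_variable borel (X T)" and Xx [measurable]: "random_variable borel (X x)"
    using x by (auto intro!: X_meas)
  have int: "integrable M ?\<rho>"
    unfolding X_def using x by (intro integrable_reflected) simp
  have intI: "integrable M (\<lambda>\<omega>. ?\<rho> \<omega> * indicator (Collect P) \<omega>)" if [measurable]: "Measurable.pred M P" for P
    by (rule Bochner_Integration.integrable_bound[OF int]) (auto split: split_indicator)
  define A where "A k = {\<omega>. (\<forall>i\<le>k. 0 \<le> X (r i) \<omega>) \<and> X (r (Suc k)) \<omega> < 0}" for k
  define A1 where "A1 k = {\<omega>. (\<forall>i\<le>k. 0 \<le> X (r i) \<omega>) \<and> X (r (Suc k)) \<omega> < 0 \<and> - \<epsilon> \<le> X (r (Suc k)) \<omega>}" for k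
  define A2 where "A2 k = {\<omega>. (\<forall>i\<le>k. 0 \<le> X (r i) \<omega>) \<and> X (r (Suc k)) \<omega> < - \<epsilon>}" for k
  \<comment> \<open>Telescoping over the grid: the A k are disjoint and exhaust the paths that are
    nonnegative at x and negative at some later grid point of index at most j.\<close>
  have dec: "indicator {\<omega>. 0 \<le> X x \<omega>} \<omega> - indicator {\<omega>. \<forall>i\<le>j. 0 \<le> X (r i) \<omega>} \<omega>
      = (\<Sum>k<j. indicator (A k) \<omega> :: real)" for j \<omega>
  proof (induction j)
    case (Suc j)
    have "indicator {\<omega>. \<forall>i\<le>j. 0 \<le> X (r i) \<omega>} \<omega> - indicator {\<omega>. \<forall>i\<le>Suc j. 0 \<le> X (r i) \<omega>} \<omega>
        = (indicator (A j) \<omega> :: real)"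
      by (auto simp: A_def le_Suc_eq split: split_indicator)
    then show ?case using Suc by simp
  qed (simp add: r0)
  have A12: "indicator (A k) \<omega> = (indicator (A1 k) \<omega> + indicator (A2 k) \<omega> :: real)" for k \<omega>
    using \<epsilon> by (auto simp: A_def A1_def A2_def split: split_indicator)
  have Asum: "(\<Sum>k<n. indicator (A k) \<omega> :: real) \<le> 1" for \<omega>
    unfolding dec[symmetric] by (auto split: split_indicator)
  \<comment> \<open>On A2 k the value drops from at least 0 to below -\<epsilon> in one step, and at
    most one k can occur.\<close>
  have A2E: "(\<Sum>k<n. indicator (A2 k) \<omega> :: real) \<le> indicator ?E \<omega>" for \<omega>
  proof (cases "\<omega> \<in> ?E")
    case True
    have "(\<Sum>k<n. indicator (A2 k) \<omega> :: real) \<le> (\<Sum>k<n. indicator (A k) \<omega>)"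
      unfolding A12 by (intro sum_mono) simp
    then show ?thesis using Asum[of \<omega>] True by simp
  next
    case False
    have "\<omega> \<notin> A2 k" if "k < n" for k
      using False that by (force simp: A2_def)
    then have "(\<Sum>k<n. indicator (A2 k) \<omega> :: real) = 0" by (intro sum.neutral) simp
    then show ?thesis by simp
  qed
  have A_meas [measurable]: "(\<lambda>\<omega>. indicator (A k) \<omega> :: real) \<in> borel_measurable M"
    "(\<lambda>\<omega>. indicator (A1 k) \<omega> :: real) \<in> borel_measurable M"
    "(\<lambda>\<omega>. indicator (A2 k) \<omega> :: real) \<in> borel_measurable M" for k
    unfolding A_def A1_def A2_def by measurable
  have intA: "integrable M (\<lambda>\<omega>. indicator (A k) \<omega> :: real)" for k
    by (rule integrable_const_bound[of _ 1]) (auto split: split_indicator)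
  have intA1: "integrable M (\<lambda>\<omega>. ?\<rho> \<omega> * indicator (A1 k) \<omega>)" and intA2: "integrable M (\<lambda>\<omega>. ?\<rho> \<omega> * indicator (A2 k) \<omega>)" for k
    by (rule Bochner_Integration.integrable_bound[OF int]; auto split: split_indicator)+
  have A1_bound: "\<bar>\<integral>\<omega>. ?\<rho> \<omega> * indicator (A1 k) \<omega> \<partial>M\<bar> \<le> (\<integral>\<omega>. m * indicator (A k) \<omega> \<partial>M)" if k: "k < n" for k
  proof -
    let ?P = "PiM {..Suc k} (\<lambda>_. borel :: real measure)"
    \<comment> \<open>The event A1 k read on the vector of values up to index k + 1. The first
      negative value is included, so the conditioning takes place at that time.\<close>
    define Q where "Q = {g \<in> space ?P. (\<forall>i\<in>{..k}. 0 \<le> g i + \<mu> * r i + c)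
      \<and> g (Suc k) + \<mu> * r (Suc k) + c < 0 \<and> - \<epsilon> \<le> g (Suc k) + \<mu> * r (Suc k) + c}"
    have cm: "(\<lambda>g. g i + \<mu> * r i + c) \<in> borel_measurable ?P" if "i \<le> Suc k" for i
      using measurable_component_singleton[of i "{..Suc k}" "\<lambda>_. borel :: real measure"] that
      by (intro borel_measurable_add) auto
    have Q: "Q \<in> sets ?P"
      unfolding Q_def using cm
      by (intro sets.sets_Collect_conj sets.sets_Collect_finite_All' borel_measurable_le borel_measurable_less
            borel_measurable_const) auto
    have W: "indicator Q (\<lambda>i\<in>{..Suc k}. B (r i) \<omega>) = (indicator (A1 k) \<omega> :: real)" for \<omega>
      by (auto simp: Q_def A1_def X_def space_PiM split: split_indicator)
    have "(\<integral>\<omega>. ?\<rho> \<omega> * indicator (A1 k) \<omega> \<partial>M)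
        = (\<integral>\<omega>. indicator Q (\<lambda>i\<in>{..Suc k}. B (r i) \<omega>) * reflected \<mu> (B T \<omega> + \<mu> * T + c) \<partial>M)"
      unfolding W X_def by (simp add: mult.commute)
    also have "\<dots> = (\<integral>\<omega>. indicator Q (\<lambda>i\<in>{..Suc k}. B (r i) \<omega>)
        * survival \<mu> (B (r (Suc k)) \<omega> + \<mu> * r (Suc k) + c) (T - r (Suc k)) \<partial>M)"
      by (rule integral_reflected_past[OF rpos _ _ Q]) (use k rmono rT in \<open>auto intro!: strict_mono_onI\<close>)
    also have "\<dots> = (\<integral>\<omega>. indicator (A1 k) \<omega> * survival \<mu> (X (r (Suc k)) \<omega>) (T - r (Suc k)) \<partial>M)"
      unfolding W X_def ..
    finally have eq: "(\<integral>\<omega>. ?\<rho> \<omega> * indicator (A1 k) \<omega> \<partial>M)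
        = (\<integral>\<omega>. indicator (A1 k) \<omega> * survival \<mu> (X (r (Suc k)) \<omega>) (T - r (Suc k)) \<partial>M)" .
    have le: "\<bar>indicator (A1 k) \<omega> * survival \<mu> (X (r (Suc k)) \<omega>) (T - r (Suc k))\<bar> \<le> m * indicator (A k) \<omega>" for \<omega>
    proof (cases "\<omega> \<in> A1 k")
      case True
      then have "\<bar>X (r (Suc k)) \<omega>\<bar> \<le> \<epsilon>" "\<omega> \<in> A k" by (auto simp: A1_def A_def)
      then show ?thesis
        using True survival_bound[of "T - y" "T - r (Suc k)" "X (r (Suc k)) \<omega>" \<epsilon> \<mu>] x rT[of "Suc k"] k by (simp add: m_def)
    qed (use m in \<open>auto split: split_indicator\<close>)
    show ?thesis
      unfolding eq using le intA by (intro abs_lebesgue_integral_le integrable_mult_right) auto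
  qed
  have "?L - ?G = (\<integral>\<omega>. ?\<rho> \<omega> * (indicator {\<omega>. 0 \<le> X x \<omega>} \<omega> - indicator {\<omega>. \<forall>i\<le>n. 0 \<le> X (r i) \<omega>} \<omega>) \<partial>M)"
    unfolding right_diff_distrib by (intro Bochner_Integration.integral_diff[symmetric] intI) measurable
  also have "\<dots> = (\<integral>\<omega>. (\<Sum>k<n. ?\<rho> \<omega> * indicator (A1 k) \<omega>) + ?\<rho> \<omega> * (\<Sum>k<n. indicator (A2 k) \<omega>) \<partial>M)"
    unfolding dec A12 by (simp add: sum.distrib distrib_left sum_distrib_left)
  also have "\<dots> = (\<Sum>k<n. \<integral>\<omega>. ?\<rho> \<omega> * indicator (A1 k) \<omega> \<partial>M) + (\<integral>\<omega>. ?\<rho> \<omega> * (\<Sum>k<n. indicator (A2 k) \<omega>) \<partial>M)"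
  proof -
    have "integrable M (\<lambda>\<omega>. \<Sum>k<n. ?\<rho> \<omega> * indicator (A1 k) \<omega>)"
      by (intro Bochner_Integration.integrable_sum intA1)
    moreover have "integrable M (\<lambda>\<omega>. ?\<rho> \<omega> * (\<Sum>k<n. indicator (A2 k) \<omega>))"
      unfolding sum_distrib_left by (intro Bochner_Integration.integrable_sum intA2)
    moreover have "(\<integral>\<omega>. (\<Sum>k<n. ?\<rho> \<omega> * indicator (A1 k) \<omega>) \<partial>M) = (\<Sum>k<n. \<integral>\<omega>. ?\<rho> \<omega> * indicator (A1 k) \<omega> \<partial>M)"
      by (intro Bochner_Integration.integral_sum intA1)
    ultimately show ?thesis
      by (subst Bochner_Integration.integral_add) (simp_all only:)
  qed
  finally have eq: "?L - ?G = \<dots>" .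
  have "\<bar>\<Sum>k<n. \<integral>\<omega>. ?\<rho> \<omega> * indicator (A1 k) \<omega> \<partial>M\<bar> \<le> (\<Sum>k<n. \<integral>\<omega>. m * indicator (A k) \<omega> \<partial>M)"
    by (rule order_trans[OF sum_abs sum_mono]) (rule A1_bound, simp)
  also have "\<dots> = (\<integral>\<omega>. m * (\<Sum>k<n. indicator (A k) \<omega>) \<partial>M)"
    unfolding sum_distrib_left
    by (rule Bochner_Integration.integral_sum[symmetric]) (intro integrable_mult_right intA)
  \<comment> \<open>Disjointness of the A k keeps the total error at m instead of n times m.\<close>
  also have "\<dots> \<le> (\<integral>\<omega>. m \<partial>M)"
    using m Asum by (intro integral_mono integrable_mult_right Bochner_Integration.integrable_sum intA)
      (auto intro!: mult_left_le)
  finally have 1: "\<bar>\<Sum>k<n. \<integral>\<omega>. ?\<rho> \<omega> * indicator (A1 k) \<omega> \<partial>M\<bar> \<le> m"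
    by (simp add: prob_space)
  have 2: "\<bar>\<integral>\<omega>. ?\<rho> \<omega> * (\<Sum>k<n. indicator (A2 k) \<omega>) \<partial>M\<bar> \<le> (\<integral>\<omega>. \<bar>?\<rho> \<omega>\<bar> * indicator ?E \<omega> \<partial>M)"
  proof (rule abs_lebesgue_integral_le)
    show "integrable M (\<lambda>\<omega>. \<bar>?\<rho> \<omega>\<bar> * indicator ?E \<omega>)"
      by (rule Bochner_Integration.integrable_bound[OF int]) (auto split: split_indicator)
    fix \<omega>
    have "0 \<le> (\<Sum>k<n. indicator (A2 k) \<omega> :: real)" by (intro sum_nonneg) auto
    then show "\<bar>?\<rho> \<omega> * (\<Sum>k<n. indicator (A2 k) \<omega>)\<bar> \<le> \<bar>?\<rho> \<omega>\<bar> * indicator ?E \<omega>"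
      using A2E[of \<omega>] by (simp add: abs_mult mult_left_mono)
  qed measurable
  show ?thesis
    using 1 2 unfolding eq m_def by linarith
qed

section \<open>From grids to continuous time\<close>

lemma continuous_on_drift:
  "\<omega> \<in> space M \<Longrightarrow> continuous_on {0..} (\<lambda>s. B s \<omega> + \<mu> * s + c)"
  by (intro continuous_intros continuous_paths)

text \<open>Path continuity acts twice: pointwise, it makes the grid events converge to staying
  nonnegative throughout; uniformly, it excludes steps larger than \<epsilon> on fine grids. With
  the grid refined first, the error left over depends on \<epsilon> alone and tends to 0.\<close>

lemma integral_reflected_stay_compact:
  fixes c \<mu> x y T :: real
  assumes x: "0 < x" "x < y" "y < T"
  defines "X \<equiv> \<lambda>s \<omega>. B s \<omega> + \<mu> * s + c"
  shows "(\<lambda>\<omega>. indicator {\<omega>. \<forall>s\<in>{x..y}. 0 \<le> X s \<omega>} \<omega> :: real) \<in> borel_measurable M"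
    and "(\<integral>\<omega>. reflected \<mu> (X T \<omega>) * indicator {\<omega>. 0 \<le> X x \<omega>} \<omega> \<partial>M)
       = (\<integral>\<omega>. reflected \<mu> (X T \<omega>) * indicator {\<omega>. \<forall>s\<in>{x..y}. 0 \<le> X s \<omega>} \<omega> \<partial>M)"
proof -
  \<comment> \<open>\<open>Suc n\<close> subintervals, so that n = 0 already gives a proper
    grid.\<close>
  define r where "r n i = x + (y - x) * real i / real (Suc n)" for n i :: nat
  let ?\<rho> = "\<lambda>\<omega>. reflected \<mu> (X T \<omega>)"
  let ?G = "\<lambda>n. {\<omega>. \<forall>i\<le>Suc n. 0 \<le> X (r n i) \<omega>}"
  let ?C = "{\<omega>. \<forall>s\<in>{x..y}. 0 \<le> X s \<omega>}"
  let ?E = "\<lambda>\<epsilon> n. {\<omega>. \<exists>k<Suc n. \<epsilon> < \<bar>X (r n (Suc k)) \<omega> - X (r n k) \<omega>\<bar>}"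
  have rpos: "0 < r n i" for n i
    using x unfolding r_def by (intro add_pos_nonneg) auto
  have rin: "r n i \<in> {x..y}" if "i \<le> Suc n" for n i
  proof -
    have "(y - x) * (real i / real (Suc n)) \<le> (y - x) * 1"
      using that x by (intro mult_left_mono) auto
    then show ?thesis using x by (auto simp: r_def)
  qed
  have X_meas: "random_variable borel (X s)" if "0 \<le> s" for s
    unfolding X_def using random_variable_B[OF that] by measurable
  have Xr [measurable]: "random_variable borel (X (r n i))" for n i
    using rpos[of n i] by (intro X_meas) simp
  have XT [measurable]: "random_variable borel (X T)"
    using x by (auto intro!: X_meas)
  have cont: "continuous_on {0..} (\<lambda>s. X s \<omega>)" if "\<omega> \<in> space M" for \<omega>
    unfolding X_def by (rule continuous_on_drift[OF that])
  have int: "integrable M ?\<rho>"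
    unfolding X_def using x by (intro integrable_reflected) simp
  have G: "(\<lambda>n. indicator (?G n) \<omega> :: real) \<longlonglongrightarrow> indicator ?C \<omega>" if \<omega>: "\<omega> \<in> space M" for \<omega>
  proof (cases "\<omega> \<in> ?C")
    case True
    then have "\<omega> \<in> ?G n" for n using rin by blast
    then show ?thesis using True by simp
  next
    case False
    then obtain s where s: "s \<in> {x..y}" "X s \<omega> < 0" by auto
    define q where "q = (s - x) / (y - x)"
    have q: "0 \<le> q" "q \<le> 1" using s x by (auto simp: q_def)
    \<comment> \<open>The index of the last grid point at or below s; these grid points converge to
      s and eventually see the negative value.\<close>
    define i where "i n = nat \<lfloor>q * real (Suc n)\<rfloor>" for n
    have ri: "real (i n) = of_int \<lfloor>q * real (Suc n)\<rfloor>" for n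
      using q by (simp add: i_def)
    have i_le: "i n \<le> Suc n" for n
    proof -
      have "q * real (Suc n) \<le> real (Suc n)" using mult_right_mono[OF q(2), of "real (Suc n)"] by simp
      then have "real (i n) \<le> real (Suc n)" unfolding ri using of_int_floor_le order_trans by blast
      then show ?thesis by linarith
    qed
    have "(\<lambda>n. real (i n) / real (Suc n)) \<longlonglongrightarrow> q"
    proof (rule tendsto_sandwich[of "\<lambda>n. q - 1 / real (Suc n)" _ _ "\<lambda>_. q"])
      have "q * real (Suc n) - 1 \<le> real (i n)" "real (i n) \<le> q * real (Suc n)" for n
        unfolding ri by linarith+
      then have "(q * real (Suc n) - 1) / real (Suc n) \<le> real (i n) / real (Suc n)"
        "real (i n) / real (Suc n) \<le> (q * real (Suc n)) / real (Suc n)" for n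
        by (intro divide_right_mono; simp)+
      then show "\<forall>\<^sub>F n in sequentially. q - 1 / real (Suc n) \<le> real (i n) / real (Suc n)"
        "\<forall>\<^sub>F n in sequentially. real (i n) / real (Suc n) \<le> q"
        by (auto simp: diff_divide_distrib simp del: of_nat_Suc intro!: always_eventually)
      show "(\<lambda>n. q - 1 / real (Suc n)) \<longlonglongrightarrow> q"
        using tendsto_diff[OF tendsto_const LIMSEQ_Suc[OF lim_1_over_n], of q] by simp
    qed simp
    then have "(\<lambda>n. x + (y - x) * (real (i n) / real (Suc n))) \<longlonglongrightarrow> x + (y - x) * q"
      by (intro tendsto_intros)
    moreover have "x + (y - x) * q = s" using x by (simp add: q_def)
    ultimately have "(\<lambda>n. r n (i n)) \<longlonglongrightarrow> s" by (simp add: r_def)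
    then have "(\<lambda>n. X (r n (i n)) \<omega>) \<longlonglongrightarrow> X s \<omega>"
      using s x rpos by (intro continuous_on_tendsto_compose[OF cont[OF \<omega>]]) (auto intro!: always_eventually less_imp_le)
    then have "\<forall>\<^sub>F n in sequentially. X (r n (i n)) \<omega> < 0"
      using s(2) by (rule order_tendstoD(2))
    then have "\<forall>\<^sub>F n in sequentially. indicator (?G n) \<omega> = (0 :: real)"
      by eventually_elim (use i_le not_le in \<open>auto simp: indicator_def\<close>)
    then show ?thesis using False by (simp add: tendsto_eventually)
  qed
  \<comment> \<open>The condition ranges over uncountably many times; its measurability comes from
    being a limit of grid events.\<close>
  show C_meas [measurable]: "(\<lambda>\<omega>. indicator ?C \<omega> :: real) \<in> borel_measurable M"
    by (rule borel_measurable_LIMSEQ_real[OF G]) auto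
  have limG: "(\<lambda>n. \<integral>\<omega>. ?\<rho> \<omega> * indicator (?G n) \<omega> \<partial>M) \<longlonglongrightarrow> (\<integral>\<omega>. ?\<rho> \<omega> * indicator ?C \<omega> \<partial>M)"
  proof (rule integral_dominated_convergence[where w = "\<lambda>\<omega>. \<bar>?\<rho> \<omega>\<bar>"])
    show "AE \<omega> in M. (\<lambda>n. ?\<rho> \<omega> * indicator (?G n) \<omega>) \<longlonglongrightarrow> ?\<rho> \<omega> * indicator ?C \<omega>"
      by (intro AE_I2 tendsto_mult tendsto_const G)
  qed (use int in \<open>auto split: split_indicator\<close>)
  have E: "(\<lambda>n. indicator (?E \<epsilon> n) \<omega> :: real) \<longlonglongrightarrow> 0" if \<omega>: "\<omega> \<in> space M" and \<epsilon>: "0 < \<epsilon>" for \<epsilon> \<omega>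
  proof -
    have "uniformly_continuous_on {x..y} (\<lambda>s. X s \<omega>)"
      using x by (intro compact_uniformly_continuous continuous_on_subset[OF cont[OF \<omega>]]) auto
    then obtain d where d: "0 < d" "\<And>s s'. s \<in> {x..y} \<Longrightarrow> s' \<in> {x..y} \<Longrightarrow> dist s' s < d \<Longrightarrow> dist (X s' \<omega>) (X s \<omega>) < \<epsilon>"
      using \<epsilon> unfolding uniformly_continuous_on_def by meson
    have "(\<lambda>n. (y - x) * (1 / real (Suc n))) \<longlonglongrightarrow> (y - x) * 0"
      by (intro tendsto_mult tendsto_const LIMSEQ_Suc[OF lim_1_over_n])
    then have "\<forall>\<^sub>F n in sequentially. (y - x) * (1 / real (Suc n)) < d"
      using d(1) by (intro order_tendstoD(2)) simp_all
    then have "\<forall>\<^sub>F n in sequentially. indicator (?E \<epsilon> n) \<omega> = (0 :: real)"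
    proof eventually_elim
      case (elim n)
      have "\<bar>X (r n (Suc k)) \<omega> - X (r n k) \<omega>\<bar> < \<epsilon>" if "k < Suc n" for k
      proof -
        have "r n (Suc k) - r n k = (y - x) * (1 / real (Suc n))"
          by (simp add: r_def add_divide_distrib distrib_left)
        then have "dist (r n (Suc k)) (r n k) < d"
          using elim x by (simp add: dist_real_def)
        then show ?thesis
          using d(2)[of "r n k" "r n (Suc k)"] rin[of k n] rin[of "Suc k" n] that by (simp add: dist_real_def)
      qed
      then show ?case by (force simp: indicator_def)
    qed
    then show ?thesis by (simp add: tendsto_eventually)
  qed
  have limE: "(\<lambda>n. \<integral>\<omega>. \<bar>?\<rho> \<omega>\<bar> * indicator (?E \<epsilon> n) \<omega> \<partial>M) \<longlonglongrightarrow> (\<integral>\<omega>. 0 \<partial>M)" if "0 < \<epsilon>" for \<epsilon>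
  proof (rule integral_dominated_convergence[where w = "\<lambda>\<omega>. \<bar>?\<rho> \<omega>\<bar>"])
    show "AE \<omega> in M. (\<lambda>n. \<bar>?\<rho> \<omega>\<bar> * indicator (?E \<epsilon> n) \<omega>) \<longlonglongrightarrow> 0"
      by (intro AE_I2 tendsto_mult_right_zero E that)
  qed (use int in \<open>auto split: split_indicator\<close>)
  let ?d = "\<bar>(\<integral>\<omega>. ?\<rho> \<omega> * indicator {\<omega>. 0 \<le> X x \<omega>} \<omega> \<partial>M) - (\<integral>\<omega>. ?\<rho> \<omega> * indicator ?C \<omega> \<partial>M)\<bar>"
  have bound: "?d \<le> 2 * \<epsilon> / sqrt (T - y) + (exp (2 * \<bar>\<mu>\<bar> * \<epsilon>) - 1)" (is "_ \<le> ?m \<epsilon>") if \<epsilon>: "0 < \<epsilon>" for \<epsilon>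
  proof -
    have "(\<lambda>n. ?m \<epsilon> + (\<integral>\<omega>. \<bar>?\<rho> \<omega>\<bar> * indicator (?E \<epsilon> n) \<omega> \<partial>M)) \<longlonglongrightarrow> ?m \<epsilon> + (\<integral>\<omega>. 0 \<partial>M)"
      by (intro tendsto_add tendsto_const limE \<epsilon>)
    moreover have "(\<lambda>n. \<bar>(\<integral>\<omega>. ?\<rho> \<omega> * indicator {\<omega>. 0 \<le> X x \<omega>} \<omega> \<partial>M) - (\<integral>\<omega>. ?\<rho> \<omega> * indicator (?G n) \<omega> \<partial>M)\<bar>) \<longlonglongrightarrow> ?d"
      by (intro tendsto_rabs tendsto_diff tendsto_const limG)
    moreover have "\<bar>(\<integral>\<omega>. ?\<rho> \<omega> * indicator {\<omega>. 0 \<le> X x \<omega>} \<omega> \<partial>M) - (\<integral>\<omega>. ?\<rho> \<omega> * indicator (?G n) \<omega> \<partial>M)\<bar>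
        \<le> ?m \<epsilon> + (\<integral>\<omega>. \<bar>?\<rho> \<omega>\<bar> * indicator (?E \<epsilon> n) \<omega> \<partial>M)" for n
      unfolding X_def r_def using x \<epsilon> by (intro integral_reflected_grid_bound) auto
    ultimately have "?d \<le> ?m \<epsilon> + (\<integral>\<omega>. 0 \<partial>M)"
      by (intro LIMSEQ_le) auto
    then show ?thesis by simp
  qed
  \<comment> \<open>This is where y < T pays off: with T - y > 0 the bound is continuous in
    \<epsilon> and has value 0 at 0.\<close>
  have "isCont (\<lambda>\<epsilon>. 2 * \<epsilon> / sqrt (T - y) + (exp (2 * \<bar>\<mu>\<bar> * \<epsilon>) - 1)) 0"
    using x by (intro continuous_intros) auto
  then have "((\<lambda>\<epsilon>. 2 * \<epsilon> / sqrt (T - y) + (exp (2 * \<bar>\<mu>\<bar> * \<epsilon>) - 1)) \<longlongrightarrow> 0) (at_right 0)"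
    by (simp add: isCont_def filterlim_at_split)
  then have "?d \<le> 0"
    by (rule tendsto_lowerbound) (use bound in \<open>auto simp: eventually_at_filter\<close>)
  then show "(\<integral>\<omega>. ?\<rho> \<omega> * indicator {\<omega>. 0 \<le> X x \<omega>} \<omega> \<partial>M) = (\<integral>\<omega>. ?\<rho> \<omega> * indicator ?C \<omega> \<partial>M)"
    by simp
qed

text \<open>Let y increase to T. A path that stays nonnegative on [x, T) has a nonnegative value at
  T by continuity, so \<open>reflected\<close> is 1 on that event and the integral becomes its
  probability.\<close>

lemma prob_stay_nonneg:
  fixes c \<mu> x T :: real
  assumes x: "0 < x" "x < T"
  defines "X \<equiv> \<lambda>s \<omega>. B s \<omega> + \<mu> * s + c"
  shows "{\<omega>\<in>space M. \<forall>s\<in>{x..<T}. 0 \<le> X s \<omega>} \<in> events"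
    and "prob {\<omega>\<in>space M. \<forall>s\<in>{x..<T}. 0 \<le> X s \<omega>}
      = (\<integral>\<omega>. reflected \<mu> (X T \<omega>) * indicator {\<omega>. 0 \<le> X x \<omega>} \<omega> \<partial>M)"
proof -
  let ?\<rho> = "\<lambda>\<omega>. reflected \<mu> (X T \<omega>)"
  let ?C = "{\<omega>. \<forall>s\<in>{x..<T}. 0 \<le> X s \<omega>}"
  \<comment> \<open>Division by n + 2 keeps every y n strictly above x.\<close>
  define y where "y n = T - (T - x) / real (Suc (Suc n))" for n :: nat
  have y: "x < y n" "y n < T" for n
  proof -
    have "(T - x) * 1 < (T - x) * real (Suc (Suc n))"
      using x by (intro mult_strict_left_mono) auto
    then have "(T - x) / real (Suc (Suc n)) < T - x"
      by (simp add: pos_divide_less_eq)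
    then show "x < y n" "y n < T"
      using x by (auto simp: y_def)
  qed
  have "(\<lambda>n. T - (T - x) * (1 / real (Suc (Suc n)))) \<longlonglongrightarrow> T - (T - x) * 0"
    by (intro tendsto_intros LIMSEQ_Suc[OF LIMSEQ_Suc[OF lim_1_over_n]])
  then have yT: "y \<longlonglongrightarrow> T"
    by (simp add: y_def[abs_def])
  let ?D = "\<lambda>n. {\<omega>. \<forall>s\<in>{x..y n}. 0 \<le> X s \<omega>}"
  have [measurable]: "(\<lambda>\<omega>. indicator (?D n) \<omega> :: real) \<in> borel_measurable M" for n
    unfolding X_def by (rule integral_reflected_stay_compact(1)[OF x(1) y])
  have lim: "(\<lambda>n. indicator (?D n) \<omega> :: real) \<longlonglongrightarrow> indicator ?C \<omega>" for \<omega>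
  proof (cases "\<omega> \<in> ?C")
    case True
    have "indicator (?D n) \<omega> = (indicator ?C \<omega> :: real)" for n
      using True y(2)[of n] by (force simp: indicator_def)
    then show ?thesis by simp
  next
    case False
    then obtain s where s: "x \<le> s" "s < T" "X s \<omega> < 0" by auto
    have "\<forall>\<^sub>F n in sequentially. s < y n"
      using yT s(2) by (rule order_tendstoD(1))
    then have "\<forall>\<^sub>F n in sequentially. indicator (?D n) \<omega> = (0 :: real)"
      by eventually_elim (use s in \<open>force simp: indicator_def\<close>)
    then show ?thesis using False by (simp add: tendsto_eventually)
  qed
  have C_meas [measurable]: "(\<lambda>\<omega>. indicator ?C \<omega> :: real) \<in> borel_measurable M"
    by (rule borel_measurable_LIMSEQ_real[OF lim]) auto
  have "{\<omega>\<in>space M. indicator ?C \<omega> = (1 :: real)} \<in> events"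
    by measurable
  also have "{\<omega>\<in>space M. indicator ?C \<omega> = (1 :: real)} = {\<omega>\<in>space M. \<forall>s\<in>{x..<T}. 0 \<le> X s \<omega>}"
    by (auto simp: indicator_def)
  finally show ev: "{\<omega>\<in>space M. \<forall>s\<in>{x..<T}. 0 \<le> X s \<omega>} \<in> events" .
  have [measurable]: "random_variable borel (X T)"
    unfolding X_def using random_variable_B[of T] x by (intro borel_measurable_add) auto
  have int: "integrable M ?\<rho>"
    unfolding X_def using x by (intro integrable_reflected) simp
  have "(\<lambda>n. \<integral>\<omega>. ?\<rho> \<omega> * indicator (?D n) \<omega> \<partial>M) \<longlonglongrightarrow> (\<integral>\<omega>. ?\<rho> \<omega> * indicator ?C \<omega> \<partial>M)"
  proof (rule integral_dominated_convergence[where w = "\<lambda>\<omega>. \<bar>?\<rho> \<omega>\<bar>"])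
    show "AE \<omega> in M. (\<lambda>n. ?\<rho> \<omega> * indicator (?D n) \<omega>) \<longlonglongrightarrow> ?\<rho> \<omega> * indicator ?C \<omega>"
      by (intro AE_I2 tendsto_mult tendsto_const lim)
  qed (use int in \<open>auto split: split_indicator\<close>)
  moreover have "(\<integral>\<omega>. ?\<rho> \<omega> * indicator (?D n) \<omega> \<partial>M) = (\<integral>\<omega>. ?\<rho> \<omega> * indicator {\<omega>. 0 \<le> X x \<omega>} \<omega> \<partial>M)" for n
    unfolding X_def by (rule integral_reflected_stay_compact(2)[OF x(1) y, symmetric])
  ultimately have "(\<integral>\<omega>. ?\<rho> \<omega> * indicator {\<omega>. 0 \<le> X x \<omega>} \<omega> \<partial>M) = (\<integral>\<omega>. ?\<rho> \<omega> * indicator ?C \<omega> \<partial>M)"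
    by (simp add: LIMSEQ_const_iff)
  also have "\<dots> = (\<integral>\<omega>. indicator {\<omega>\<in>space M. \<forall>s\<in>{x..<T}. 0 \<le> X s \<omega>} \<omega> \<partial>M)"
  proof (intro Bochner_Integration.integral_cong refl)
    fix \<omega> assume \<omega>: "\<omega> \<in> space M"
    have "0 \<le> X T \<omega>" if "\<omega> \<in> ?C"
    proof (rule LIMSEQ_le_const)
      show "(\<lambda>n. X (y n) \<omega>) \<longlonglongrightarrow> X T \<omega>"
        unfolding X_def using x y(1)
        by (intro continuous_on_tendsto_compose[OF continuous_on_drift[OF \<omega>] yT])
           (auto intro!: always_eventually intro: less_imp_le less_trans)
      show "\<exists>N. \<forall>n\<ge>N. 0 \<le> X (y n) \<omega>"
        using that y by (force intro: less_imp_le)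
    qed
    then show "?\<rho> \<omega> * indicator ?C \<omega> = indicator {\<omega>\<in>space M. \<forall>s\<in>{x..<T}. 0 \<le> X s \<omega>} \<omega>"
      using \<omega> by (auto simp: reflected_def split: split_indicator)
  qed
  also have "\<dots> = prob {\<omega>\<in>space M. \<forall>s\<in>{x..<T}. 0 \<le> X s \<omega>}"
    using ev by simp
  finally show "prob {\<omega>\<in>space M. \<forall>s\<in>{x..<T}. 0 \<le> X s \<omega>}
      = (\<integral>\<omega>. ?\<rho> \<omega> * indicator {\<omega>. 0 \<le> X x \<omega>} \<omega> \<partial>M)" ..
qed

section \<open>Level shifts and the value of the staying probability\<close>

lemma AE_drift_neq_0:
  assumes "0 < s"
  shows "AE \<omega> in M. B s \<omega> + \<mu> * s \<noteq> 0"
  using AE_lborel_singleton[of 0]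
  by (subst distributed_AE2[OF distributed_drift[OF assms]]) auto

text \<open>Continuity in the level. Both \<open>reflected\<close> and the indicator jump at 0, so
  convergence holds off the null events that the drifted motion vanishes at x or at T.\<close>

lemma integral_reflected_shift_tendsto:
  assumes x: "0 < x" "x < T"
  shows "(\<lambda>n. \<integral>\<omega>. reflected \<mu> (B T \<omega> + \<mu> * T + - (1 / real (Suc n)))
        * indicator {\<omega>. 0 \<le> B x \<omega> + \<mu> * x + - (1 / real (Suc n))} \<omega> \<partial>M)
    \<longlonglongrightarrow> (\<integral>\<omega>. reflected \<mu> (B T \<omega> + \<mu> * T) * indicator {\<omega>. 0 \<le> B x \<omega> + \<mu> * x} \<omega> \<partial>M)"
proof -
  have [measurable]: "random_variable borel (B T)" "random_variable borel (B x)"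
    using x by (auto intro!: random_variable_B)
  let ?\<eta> = "\<lambda>n. 1 / real (Suc n)"
  have \<eta>: "?\<eta> \<longlonglongrightarrow> 0" by (rule LIMSEQ_Suc[OF lim_1_over_n])
  let ?w = "\<lambda>\<omega>. 1 + exp (2 * \<bar>\<mu>\<bar>) * (1 + \<bar>reflected \<mu> (B T \<omega> + \<mu> * T)\<bar>)"
  \<comment> \<open>A downward shift by h <= 1 multiplies the exponential part by at most exp (2
    |\<mu>|), or takes a value from [0, h) to the negative side, where its modulus is at most this
    factor.\<close>
  have bound: "\<bar>reflected \<mu> (v - h)\<bar> \<le> 1 + exp (2 * \<bar>\<mu>\<bar>) * (1 + \<bar>reflected \<mu> v\<bar>)" if "0 \<le> h" "h \<le> 1" for v h
  proof (cases "v < h")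
    case True
    have e: "2 * \<mu> * z \<le> 2 * \<bar>\<mu>\<bar>" if "\<bar>z\<bar> \<le> 1" for z
    proof -
      have "\<mu> * z \<le> \<bar>\<mu>\<bar> * \<bar>z\<bar>" by (metis abs_ge_self abs_mult)
      also have "\<dots> \<le> \<bar>\<mu>\<bar>" using that by (simp add: mult_left_le)
      finally show ?thesis by simp
    qed
    have "exp (- (2 * \<mu> * (v - h))) \<le> exp (2 * \<bar>\<mu>\<bar>) * (1 + \<bar>reflected \<mu> v\<bar>)"
    proof (cases "v < 0")
      case True
      have "exp (- (2 * \<mu> * (v - h))) = exp (2 * \<mu> * h) * \<bar>reflected \<mu> v\<bar>"
        using True by (simp add: reflected_def exp_add[symmetric] algebra_simps)
      also have "\<dots> \<le> exp (2 * \<bar>\<mu>\<bar>) * (1 + \<bar>reflected \<mu> v\<bar>)"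
        using e[of h] that by (intro mult_mono) auto
      finally show ?thesis .
    next
      case False
      have "exp (- (2 * \<mu> * (v - h))) \<le> exp (2 * \<bar>\<mu>\<bar>) * 1"
        using e[of "h - v"] \<open>v < h\<close> False that by (simp add: algebra_simps)
      also have "\<dots> \<le> exp (2 * \<bar>\<mu>\<bar>) * (1 + \<bar>reflected \<mu> v\<bar>)"
        by (intro mult_left_mono) auto
      finally show ?thesis .
    qed
    then show ?thesis using True by (simp add: reflected_def)
  qed (simp add: reflected_def)
  show ?thesis
  proof (rule integral_dominated_convergence[where w = ?w])
    have "integrable M (\<lambda>\<omega>. reflected \<mu> (B T \<omega> + \<mu> * T + 0))"
      using x by (intro integrable_reflected) simp
    then show "integrable M ?w" by simp
    have "0 < T" using x by simp
    show "AE \<omega> in M. (\<lambda>n. reflected \<mu> (B T \<omega> + \<mu> * T + - ?\<eta> n) * indicator {\<omega>. 0 \<le> B x \<omega> + \<mu> * x + - ?\<eta> n} \<omega>)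
        \<longlonglongrightarrow> reflected \<mu> (B T \<omega> + \<mu> * T) * indicator {\<omega>. 0 \<le> B x \<omega> + \<mu> * x} \<omega>"
      using AE_drift_neq_0[OF x(1), of \<mu>] AE_drift_neq_0[OF \<open>0 < T\<close>, of \<mu>]
    proof eventually_elim
      fix \<omega>
      assume nz: "B x \<omega> + \<mu> * x \<noteq> 0" "B T \<omega> + \<mu> * T \<noteq> 0"
      define u v where "u = B x \<omega> + \<mu> * x" and "v = B T \<omega> + \<mu> * T"
      have lim: "(\<lambda>n. z + - ?\<eta> n) \<longlonglongrightarrow> z" for z :: real
        using tendsto_diff[OF tendsto_const \<eta>, of z] by simp
      have ev: "(\<forall>\<^sub>F n in sequentially. 0 < z + - ?\<eta> n) \<and> 0 < z \<or> (\<forall>\<^sub>F n in sequentially. z + - ?\<eta> n < 0) \<and> z < 0"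
        if "z \<noteq> 0" for z :: real
        using that order_tendstoD[OF lim[of z], of 0] by linarith
      have 1: "(\<lambda>n. indicator {0..} (u + - ?\<eta> n) :: real) \<longlonglongrightarrow> indicator {0..} u"
        using ev[of u] nz(1)
        by (auto simp: u_def[symmetric] intro!: tendsto_eventually elim!: eventually_mono split: split_indicator)
      have 2: "(\<lambda>n. reflected \<mu> (v + - ?\<eta> n)) \<longlonglongrightarrow> reflected \<mu> v"
        using ev[of v]
      proof
        assume "(\<forall>\<^sub>F n in sequentially. 0 < v + - ?\<eta> n) \<and> 0 < v"
        then show ?thesis
          by (auto simp: reflected_def intro!: tendsto_eventually elim!: eventually_mono)
      next
        assume v: "(\<forall>\<^sub>F n in sequentially. v + - ?\<eta> n < 0) \<and> v < 0"
        have "(\<lambda>n. - exp (- (2 * \<mu> * (v + - ?\<eta> n)))) \<longlonglongrightarrow> - exp (- (2 * \<mu> * v))"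
          by (intro tendsto_minus tendsto_exp tendsto_mult tendsto_const lim)
        then have "(\<lambda>n. reflected \<mu> (v + - ?\<eta> n)) \<longlonglongrightarrow> - exp (- (2 * \<mu> * v))"
          by (rule Lim_transform_eventually) (use v in \<open>auto simp: reflected_def elim!: eventually_mono\<close>)
        then show ?thesis using v by (simp add: reflected_def)
      qed (use nz in \<open>simp add: v_def\<close>)
      from tendsto_mult[OF 2 1]
      show "(\<lambda>n. reflected \<mu> (B T \<omega> + \<mu> * T + - ?\<eta> n) * indicator {\<omega>. 0 \<le> B x \<omega> + \<mu> * x + - ?\<eta> n} \<omega>)
        \<longlonglongrightarrow> reflected \<mu> (B T \<omega> + \<mu> * T) * indicator {\<omega>. 0 \<le> B x \<omega> + \<mu> * x} \<omega>"
        by (simp add: u_def v_def indicator_def)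
    qed
    show "AE \<omega> in M. norm (reflected \<mu> (B T \<omega> + \<mu> * T + - ?\<eta> n) * indicator {\<omega>. 0 \<le> B x \<omega> + \<mu> * x + - ?\<eta> n} \<omega>) \<le> ?w \<omega>" for n
    proof (rule AE_I2)
      fix \<omega>
      have "0 \<le> ?w \<omega>" by (intro add_nonneg_nonneg mult_nonneg_nonneg) auto
      then show "norm (reflected \<mu> (B T \<omega> + \<mu> * T + - ?\<eta> n) * indicator {\<omega>. 0 \<le> B x \<omega> + \<mu> * x + - ?\<eta> n} \<omega>) \<le> ?w \<omega>"
        using bound[of "?\<eta> n" "B T \<omega> + \<mu> * T"] by (simp split: split_indicator)
    qed
  qed measurable
qed

text \<open>A past consisting of the single time x suffices: \<open>reflected\<close> is replaced by
  \<open>survival\<close>, which is then integrated against the Gaussian law of the value at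
  x.\<close>

lemma integral_reflected_eq:
  assumes x: "0 < x" "x < T"
  shows "ennreal (\<integral>\<omega>. reflected \<mu> (B T \<omega> + \<mu> * T) * indicator {\<omega>. 0 \<le> B x \<omega> + \<mu> * x} \<omega> \<partial>M)
    = (if 0 < \<mu> then ennreal (2 * Phi (\<mu> * sqrt x) - 1) else 0)
      + (\<integral>\<^sup>+b\<in>{T<..}. ennreal (next_zero_density \<mu> x b / 2) \<partial>lborel)"
proof -
  let ?P = "PiM {..0::nat} (\<lambda>_. borel :: real measure)"
  let ?g = "\<lambda>w. indicator {0..} w * survival \<mu> w (T - x)"
  define Q where "Q = {g \<in> space ?P. 0 \<le> g 0 + \<mu> * x}"
  have [measurable]: "(\<lambda>g. g 0) \<in> borel_measurable ?P"
    by (rule measurable_component_singleton) simp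
  have Q: "Q \<in> sets ?P" unfolding Q_def by measurable
  have W: "indicator Q (\<lambda>i\<in>{..0}. B x \<omega>) = (indicator {\<omega>. 0 \<le> B x \<omega> + \<mu> * x} \<omega> :: real)" for \<omega>
    by (auto simp: Q_def space_PiM split: split_indicator)
  have "(\<integral>\<omega>. reflected \<mu> (B T \<omega> + \<mu> * T) * indicator {\<omega>. 0 \<le> B x \<omega> + \<mu> * x} \<omega> \<partial>M)
      = (\<integral>\<omega>. indicator {\<omega>. 0 \<le> B x \<omega> + \<mu> * x} \<omega> * survival \<mu> (B x \<omega> + \<mu> * x) (T - x) \<partial>M)"
  proof -
    have "strict_mono_on {..0::nat} (\<lambda>_. x)" by (auto simp: strict_mono_on_def)
    from integral_reflected_past[OF _ this _ Q, of T \<mu> 0] x show ?thesis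
      unfolding W by (simp add: mult.commute)
  qed
  also have "\<dots> = (\<integral>\<omega>. ?g (B x \<omega> + \<mu> * x) \<partial>M)"
    by (simp add: indicator_def)
  also have "\<dots> = (\<integral>w. normal_density (\<mu> * x) (sqrt x) w * ?g w \<partial>lborel)"
    by (rule distributed_integral[OF distributed_drift[OF x(1)], symmetric]) auto
  finally have eq: "(\<integral>\<omega>. reflected \<mu> (B T \<omega> + \<mu> * T) * indicator {\<omega>. 0 \<le> B x \<omega> + \<mu> * x} \<omega> \<partial>M) = \<dots>" .
  \<comment> \<open>At w = 0, where the tail formula does not apply, \<open>survival\<close>
    vanishes.\<close>
  have nn: "0 \<le> ?g w" for w
    using survival_eq_nn_integral(2)[of w "T - x" \<mu>] x
    by (cases "w = 0") (auto simp: survival_def split: split_indicator)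
  have "0 \<le> exp (- (2 * \<mu> * w)) * Phi ((\<mu> * (T - x) - w) / sqrt (T - x))" for w
    by (intro mult_nonneg_nonneg Phi_bounds) simp
  then have "survival \<mu> w (T - x) \<le> 1" for w
    unfolding survival_def using Phi_bounds(2)[of "(w + \<mu> * (T - x)) / sqrt (T - x)"] by (smt (verit))
  then have le: "?g w \<le> 1" for w
    by (auto split: split_indicator)
  have "norm (normal_density (\<mu> * x) (sqrt x) w * ?g w) \<le> norm (normal_density (\<mu> * x) (sqrt x) w)" for w
  proof -
    have "norm (normal_density (\<mu> * x) (sqrt x) w * ?g w) = normal_density (\<mu> * x) (sqrt x) w * ?g w"
      using nn[of w] by (simp only: real_norm_def abs_of_nonneg mult_nonneg_nonneg normal_density_nonneg)
    also have "\<dots> \<le> normal_density (\<mu> * x) (sqrt x) w"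
      by (intro mult_left_le le normal_density_nonneg)
    finally show ?thesis by simp
  qed
  then have "integrable lborel (\<lambda>w. normal_density (\<mu> * x) (sqrt x) w * ?g w)"
    using x
    by (intro Bochner_Integration.integrable_bound[OF integrable_normal_density[of "sqrt x" "\<mu> * x"]] AE_I2) auto
  then have "ennreal (\<integral>w. normal_density (\<mu> * x) (sqrt x) w * ?g w \<partial>lborel)
      = (\<integral>\<^sup>+w. ennreal (normal_density (\<mu> * x) (sqrt x) w * ?g w) \<partial>lborel)"
    using nn by (intro nn_integral_eq_integral[symmetric]) auto
  also have "\<dots> = (\<integral>\<^sup>+w\<in>{0<..}. ennreal (normal_density (\<mu> * x) (sqrt x) w) * ennreal (survival \<mu> w (T - x)) \<partial>lborel)"
    by (intro nn_integral_cong_AE AE_I'[of "{0}"]) (auto simp: ennreal_mult' split: split_indicator)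
  also have "\<dots> = (if 0 < \<mu> then ennreal (2 * Phi (\<mu> * sqrt x) - 1) else 0)
      + (\<integral>\<^sup>+b\<in>{T<..}. ennreal (next_zero_density \<mu> x b / 2) \<partial>lborel)"
    by (rule nn_integral_normal_survival[OF x])
  finally show ?thesis unfolding eq .
qed

end

section \<open>The joint law of the adjacent zeros\<close>

context brownian_motion
begin

section \<open>The probability of a zero-free interval\<close>

lemma continuous_on_with_drift:
  "\<omega> \<in> space M \<Longrightarrow> continuous_on {0..} (\<lambda>s. with_drift \<mu> B s \<omega>)"
  unfolding with_drift_def by (intro continuous_intros continuous_paths)

text \<open>The intermediate value theorem fixes the sign on the open interval; the left end x may
  itself be a zero and inherits the weak inequality as a limit.\<close>

lemma no_zero_same_sign:
  assumes \<omega>: "\<omega> \<in> space M" and x: "0 \<le> x" "x < y"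
    and nz: "\<forall>s\<in>{x<..<y}. with_drift \<mu> B s \<omega> \<noteq> 0"
  shows "(\<forall>s\<in>{x..<y}. 0 \<le> with_drift \<mu> B s \<omega>) \<or> (\<forall>s\<in>{x..<y}. 0 \<le> - with_drift \<mu> B s \<omega>)"
proof -
  let ?X = "\<lambda>s. with_drift \<mu> B s \<omega>"
  have cont: "continuous_on {x..<y} ?X"
    by (rule continuous_on_subset[OF continuous_on_with_drift[OF \<omega>]]) (use x in auto)
  have "connected (?X ` {x<..<y})"
    by (intro connected_continuous_image continuous_on_subset[OF cont]) auto
  then have ivt: "False" if "s \<in> {x<..<y}" "s' \<in> {x<..<y}" "?X s < 0" "0 < ?X s'" for s s'
    using connectedD_interval[of "?X ` {x<..<y}" "?X s" "?X s'" 0] that nz by auto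
  define z where "z n = x + (y - x) / real (Suc (Suc n))" for n :: nat
  have z: "z n \<in> {x<..<y}" for n
  proof -
    have "(y - x) * 1 < (y - x) * real (Suc (Suc n))"
      using x by (intro mult_strict_left_mono) auto
    then have "(y - x) / real (Suc (Suc n)) < y - x"
      by (simp add: pos_divide_less_eq)
    then show ?thesis using x by (auto simp: z_def)
  qed
  have "(\<lambda>n. x + (y - x) * (1 / real (Suc (Suc n)))) \<longlonglongrightarrow> x + (y - x) * 0"
    by (intro tendsto_intros LIMSEQ_Suc[OF LIMSEQ_Suc[OF lim_1_over_n]])
  then have "z \<longlonglongrightarrow> x" by (simp add: z_def[abs_def])
  then have lim: "(\<lambda>n. ?X (z n)) \<longlonglongrightarrow> ?X x"
    using x z by (intro continuous_on_tendsto_compose[OF cont]) (auto intro!: always_eventually less_imp_le)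
  show ?thesis
  proof (cases "0 < ?X (z 0)")
    case True
    then have pos: "0 < ?X s" if "s \<in> {x<..<y}" for s
      using ivt[OF that z[of 0]] nz that by force
    then have "0 \<le> ?X x"
      using z by (intro LIMSEQ_le_const[OF lim]) (auto intro: less_imp_le)
    then have "0 \<le> ?X s" if "s \<in> {x..<y}" for s
      using pos[of s] that by (cases "s = x") auto
    then show ?thesis by blast
  next
    case False
    then have "?X (z 0) < 0" using nz z[of 0] by force
    then have neg: "?X s < 0" if "s \<in> {x<..<y}" for s
      using ivt[OF z[of 0] that] nz that by force
    then have "?X x \<le> 0"
      using z by (intro LIMSEQ_le_const2[OF lim]) (auto intro: less_imp_le)
    then have "0 \<le> - ?X s" if "s \<in> {x..<y}" for s
      using neg[of s] that by (cases "s = x") auto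
    then show ?thesis by blast
  qed
qed

lemma stay_above_events:
  assumes "0 < x" "x < y"
  shows "{\<omega>\<in>space M. \<forall>s\<in>{x..<y}. c \<le> with_drift \<mu> B s \<omega>} \<in> events"
    and "{\<omega>\<in>space M. \<forall>s\<in>{x..<y}. c \<le> - with_drift \<mu> B s \<omega>} \<in> events"
proof -
  interpret neg: brownian_motion M "\<lambda>s \<omega>. - B s \<omega>" by (rule brownian_motion_uminus)
  show "{\<omega>\<in>space M. \<forall>s\<in>{x..<y}. c \<le> with_drift \<mu> B s \<omega>} \<in> events"
    using prob_stay_nonneg(1)[OF assms, of \<mu> "- c"] by (simp add: with_drift_def)
  show "{\<omega>\<in>space M. \<forall>s\<in>{x..<y}. c \<le> - with_drift \<mu> B s \<omega>} \<in> events"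
    using neg.prob_stay_nonneg(1)[OF assms, of "- \<mu>" "- c"] by (simp add: with_drift_def)
qed

text \<open>A continuous path without zeros in (x, y) has constant sign and is bounded away from 0
  on compact subintervals. This turns the uncountable condition into countably many events of
  staying beyond a level 1 / (m + 1).\<close>

lemma no_zero_events:
  assumes x: "0 \<le> x"
  shows "{\<omega>\<in>space M. \<forall>s\<in>{x<..<y}. with_drift \<mu> B s \<omega> \<noteq> 0} \<in> events"
proof (cases "x < y")
  case True
  let ?X = "with_drift \<mu> B"
  \<comment> \<open>Division by k + 3 leaves at least a third of the interval between x + h k and y
    - h k; the shift also makes the left end positive when x = 0.\<close>
  define h where "h k = (y - x) / real (k + 3)" for k :: nat
  have h: "0 < h k" "3 * h k \<le> y - x" for k
  proof -
    have "(y - x) * 3 \<le> (y - x) * real (k + 3)"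
      using True by (intro mult_left_mono) auto
    then have "(y - x) * 3 / real (k + 3) \<le> y - x"
      by (simp add: pos_divide_le_eq)
    then show "0 < h k" "3 * h k \<le> y - x"
      using True by (simp_all add: h_def mult.commute)
  qed
  have "(\<lambda>k. (y - x) * (1 / real (k + 3))) \<longlonglongrightarrow> (y - x) * 0"
    by (intro tendsto_mult tendsto_const LIMSEQ_ignore_initial_segment lim_1_over_n)
  then have h0: "h \<longlonglongrightarrow> 0" by (simp add: h_def[abs_def])
  have "{\<omega>\<in>space M. \<forall>s\<in>{x<..<y}. ?X s \<omega> \<noteq> 0} = {\<omega>\<in>space M. \<forall>k. \<exists>m.
      (\<forall>s\<in>{x + h k..<y - h k}. 1 / real (Suc m) \<le> ?X s \<omega>) \<or> (\<forall>s\<in>{x + h k..<y - h k}. 1 / real (Suc m) \<le> - ?X s \<omega>)}"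
    (is "?L = ?R")
  proof (intro set_eqI iffI)
    fix \<omega> assume L: "\<omega> \<in> ?L"
    then have \<omega>: "\<omega> \<in> space M" and nz: "\<forall>s\<in>{x<..<y}. ?X s \<omega> \<noteq> 0" by auto
    have "\<exists>m. (\<forall>s\<in>{x + h k..<y - h k}. 1 / real (Suc m) \<le> ?X s \<omega>) \<or> (\<forall>s\<in>{x + h k..<y - h k}. 1 / real (Suc m) \<le> - ?X s \<omega>)" for k
    proof -
      have "continuous_on {x + h k..y - h k} (\<lambda>s. \<bar>?X s \<omega>\<bar>)"
        using x h[of k] by (intro continuous_intros continuous_on_subset[OF continuous_on_with_drift[OF \<omega>]]) auto
      moreover have "{x + h k..y - h k} \<noteq> {}" using h[of k] by auto
      ultimately obtain u where u: "u \<in> {x + h k..y - h k}" "\<And>s. s \<in> {x + h k..y - h k} \<Longrightarrow> \<bar>?X u \<omega>\<bar> \<le> \<bar>?X s \<omega>\<bar>"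
        using continuous_attains_inf[of "{x + h k..y - h k}"] by blast
      have "0 < \<bar>?X u \<omega>\<bar>" using u(1) nz h[of k] by auto
      then obtain m where m: "1 / real (Suc m) < \<bar>?X u \<omega>\<bar>"
        using nat_approx_posE by blast
      have abs: "1 / real (Suc m) \<le> \<bar>?X s \<omega>\<bar>" if "s \<in> {x + h k..<y - h k}" for s
        using u(2)[of s] m that by auto
      have sub: "s \<in> {x..<y}" if "s \<in> {x + h k..<y - h k}" for s
        using that h[of k] by auto
      from no_zero_same_sign[OF \<omega> x True nz] show ?thesis
      proof
        assume "\<forall>s\<in>{x..<y}. 0 \<le> ?X s \<omega>"
        then have "\<forall>s\<in>{x + h k..<y - h k}. 1 / real (Suc m) \<le> ?X s \<omega>"
          using abs sub by (metis abs_of_nonneg)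
        then show ?thesis by blast
      next
        assume *: "\<forall>s\<in>{x..<y}. 0 \<le> - ?X s \<omega>"
        have "1 / real (Suc m) \<le> - ?X s \<omega>" if "s \<in> {x + h k..<y - h k}" for s
          using abs[OF that] *[rule_format, OF sub[OF that]] by linarith
        then show ?thesis by blast
      qed
    qed
    then show "\<omega> \<in> ?R" using \<omega> by blast
  next
    fix \<omega> assume R: "\<omega> \<in> ?R"
    have "?X s \<omega> \<noteq> 0" if s: "s \<in> {x<..<y}" for s
    proof -
      have "\<forall>\<^sub>F k in sequentially. h k < min (s - x) (y - s)"
        using h0 s by (intro order_tendstoD(2)) auto
      then obtain k where k: "h k < min (s - x) (y - s)"
        by (auto simp: eventually_sequentially)
      then have sk: "s \<in> {x + h k..<y - h k}" by auto
      from R obtain m where "(\<forall>s\<in>{x + h k..<y - h k}. 1 / real (Suc m) \<le> ?X s \<omega>) \<or> (\<forall>s\<in>{x + h k..<y - h k}. 1 / real (Suc m) \<le> - ?X s \<omega>)"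
        by blast
      then have "1 / real (Suc m) \<le> \<bar>?X s \<omega>\<bar>" using sk by force
      moreover have "0 < 1 / real (Suc m)" by simp
      ultimately show ?thesis by linarith
    qed
    then show "\<omega> \<in> ?L" using R by blast
  qed
  also have "\<dots> \<in> events"
  proof -
    have "0 < x + h k" "x + h k < y - h k" for k using x h[of k] by auto
    note stay_above_events[OF this, measurable]
    show ?thesis by measurable
  qed
  finally show ?thesis .
qed simp

text \<open>The upper bound by weak signs and the lower bound by positive levels are both evaluated
  with \<open>prob_stay_nonneg\<close>; \<open>integral_reflected_shift_tendsto\<close> shows that
  they meet.\<close>

lemma prob_no_zero:
  assumes x: "0 < x" "x < y"
  shows "emeasure M {\<omega>\<in>space M. \<forall>s\<in>{x<..<y}. with_drift \<mu> B s \<omega> \<noteq> 0}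
    = (\<integral>\<^sup>+b\<in>{y<..}. ennreal (next_zero_density \<mu> x b) \<partial>lborel)
      + (\<integral>\<^sup>+a\<in>{0<..<x}. ennreal (last_zero_density \<mu> a) \<partial>lborel)"
proof -
  interpret neg: brownian_motion M "\<lambda>s \<omega>. - B s \<omega>" by (rule brownian_motion_uminus)
  let ?X = "with_drift \<mu> B"
  let ?N = "{\<omega>\<in>space M. \<forall>s\<in>{x<..<y}. ?X s \<omega> \<noteq> 0}"
  let ?P = "\<lambda>c. {\<omega>\<in>space M. \<forall>s\<in>{x..<y}. c \<le> ?X s \<omega>}"
  let ?M = "\<lambda>c. {\<omega>\<in>space M. \<forall>s\<in>{x..<y}. c \<le> - ?X s \<omega>}"
  let ?p = "\<integral>\<omega>. reflected \<mu> (B y \<omega> + \<mu> * y) * indicator {\<omega>. 0 \<le> B x \<omega> + \<mu> * x} \<omega> \<partial>M"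
  let ?m = "\<integral>\<omega>. reflected (- \<mu>) (- B y \<omega> + (- \<mu>) * y) * indicator {\<omega>. 0 \<le> - B x \<omega> + (- \<mu>) * x} \<omega> \<partial>M"
  note ev = no_zero_events[OF less_imp_le[OF x(1)], of y \<mu>] stay_above_events[OF x, of _ \<mu>]
  have p: "prob (?P c) = (\<integral>\<omega>. reflected \<mu> (B y \<omega> + \<mu> * y + - c) * indicator {\<omega>. 0 \<le> B x \<omega> + \<mu> * x + - c} \<omega> \<partial>M)" for c
    using prob_stay_nonneg(2)[OF x, of \<mu> "- c"] by (simp add: with_drift_def)
  have m: "prob (?M c) = (\<integral>\<omega>. reflected (- \<mu>) (- B y \<omega> + (- \<mu>) * y + - c) * indicator {\<omega>. 0 \<le> - B x \<omega> + (- \<mu>) * x + - c} \<omega> \<partial>M)" for c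
    using neg.prob_stay_nonneg(2)[OF x, of "- \<mu>" "- c"] by (simp add: with_drift_def)
  have "prob ?N \<le> prob (?P 0 \<union> ?M 0)"
  proof (rule finite_measure_mono)
    show "?N \<subseteq> ?P 0 \<union> ?M 0"
      using no_zero_same_sign[OF _ less_imp_le[OF x(1)] x(2), of _ \<mu>] by blast
  qed (intro sets.Un ev)
  also have "\<dots> \<le> prob (?P 0) + prob (?M 0)"
    by (intro measure_Un_le ev)
  also have "\<dots> = ?p + ?m"
    unfolding p m by simp
  finally have upper: "prob ?N \<le> ?p + ?m" .
  have lower: "?p + ?m \<le> prob ?N"
  proof (rule LIMSEQ_le_const2)
    show "(\<lambda>n. prob (?P (1 / real (Suc n))) + prob (?M (1 / real (Suc n)))) \<longlonglongrightarrow> ?p + ?m"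
      unfolding p m
      by (intro tendsto_add integral_reflected_shift_tendsto[OF x] neg.integral_reflected_shift_tendsto[OF x])
    have "prob (?P (1 / real (Suc n))) + prob (?M (1 / real (Suc n))) \<le> prob ?N" for n
    proof -
      let ?\<eta> = "1 / real (Suc n)"
      have \<eta>: "0 < ?\<eta>" by simp
      have "prob (?P ?\<eta>) + prob (?M ?\<eta>) = prob (?P ?\<eta> \<union> ?M ?\<eta>)"
      proof (rule finite_measure_Union[symmetric])
        have False if "?\<eta> \<le> ?X x \<omega>" "?\<eta> \<le> - ?X x \<omega>" for \<omega>
          using that \<eta> by linarith
        then show "?P ?\<eta> \<inter> ?M ?\<eta> = {}" using x by fastforce
      qed (intro ev)+
      also have "\<dots> \<le> prob ?N"
      proof (intro finite_measure_mono ev subsetI)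
        fix \<omega> assume *: "\<omega> \<in> ?P ?\<eta> \<union> ?M ?\<eta>"
        have "?X s \<omega> \<noteq> 0" if s: "s \<in> {x<..<y}" for s
        proof -
          have "?\<eta> \<le> ?X s \<omega> \<or> ?\<eta> \<le> - ?X s \<omega>" using * s by auto
          then show ?thesis using \<eta> by linarith
        qed
        then show "\<omega> \<in> ?N" using * by auto
      qed
      finally show ?thesis .
    qed
    then show "\<exists>N. \<forall>n\<ge>N. prob (?P (1 / real (Suc n))) + prob (?M (1 / real (Suc n))) \<le> prob ?N" by blast
  qed
  have "prob (?P 0) = ?p" unfolding p by simp
  then have nn_p: "0 \<le> ?p" by (rule subst) (rule measure_nonneg)
  have "prob (?M 0) = ?m" unfolding m by simp
  then have nn_m: "0 \<le> ?m" by (rule subst) (rule measure_nonneg)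
  have "emeasure M ?N = ennreal (?p + ?m)"
    using upper lower by (simp add: emeasure_eq_measure)
  also have "\<dots> = ennreal ?p + ennreal ?m"
    using nn_p nn_m by (rule ennreal_plus)
  also have "ennreal ?p + ennreal ?m
      = ((if 0 < \<mu> then ennreal (2 * Phi (\<mu> * sqrt x) - 1) else 0) + (if 0 < - \<mu> then ennreal (2 * Phi (- \<mu> * sqrt x) - 1) else 0))
        + ((\<integral>\<^sup>+b\<in>{y<..}. ennreal (next_zero_density \<mu> x b / 2) \<partial>lborel)
          + (\<integral>\<^sup>+b\<in>{y<..}. ennreal (next_zero_density (- \<mu>) x b / 2) \<partial>lborel))"
    unfolding integral_reflected_eq[OF x] neg.integral_reflected_eq[OF x] by (simp add: ac_simps)
  \<comment> \<open>At most one side can escape, the one towards which the drift points; for \<mu> =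
    0 neither does, and both expressions are 0.\<close>
  also have "(if 0 < \<mu> then ennreal (2 * Phi (\<mu> * sqrt x) - 1) else 0) + (if 0 < - \<mu> then ennreal (2 * Phi (- \<mu> * sqrt x) - 1) else 0)
      = (\<integral>\<^sup>+a\<in>{0<..<x}. ennreal (last_zero_density \<mu> a) \<partial>lborel)"
    unfolding nn_integral_last_zero_density[OF x(1)] by (cases "\<mu> = 0") (auto simp: Phi_0)
  \<comment> \<open>The drift enters \<open>next_zero_density\<close> only through its square, so
    the two sides contribute equal halves.\<close>
  also have "(\<integral>\<^sup>+b\<in>{y<..}. ennreal (next_zero_density \<mu> x b / 2) \<partial>lborel)
      + (\<integral>\<^sup>+b\<in>{y<..}. ennreal (next_zero_density (- \<mu>) x b / 2) \<partial>lborel)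
      = (\<integral>\<^sup>+b\<in>{y<..}. ennreal (next_zero_density \<mu> x b) \<partial>lborel)"
  proof -
    have "0 \<le> next_zero_density \<mu> x b" if "y < b" for b
      using x that by (simp add: next_zero_density_def)
    then show ?thesis
      by (subst nn_integral_add[symmetric])
         (auto simp: next_zero_density_def[of "- \<mu>"] next_zero_density_def[of \<mu>, symmetric] ennreal_plus[symmetric]
           simp del: ennreal_plus intro!: nn_integral_cong split: split_indicator)
  qed
  finally show ?thesis by (simp only: add.commute)
qed

end

section \<open>The extended half-line and the candidate joint density\<close>

text \<open>Rays with a real left end are the events that \<open>le_first_zero_after_iff\<close>
  describes. \<open>UNIV\<close> is in the generator so that products of generators cover the whole
  space.\<close>

lemma sets_borel_ereal_eq:
  "sets borel = sigma_sets UNIV (insert UNIV (range (\<lambda>y::real. {ereal y..})))" (is "_ = sigma_sets UNIV ?E")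
proof
  interpret E: sigma_algebra UNIV "sigma_sets UNIV ?E"
    by (rule sigma_algebra_sigma_sets) simp
  have ge: "{ereal y..} \<in> sigma_sets UNIV ?E" for y :: real
    by (rule sigma_sets.Basic) simp
  have "{y<..} \<in> sigma_sets UNIV ?E" for y :: ereal
  proof (cases y)
    case (real r)
    have "{ereal r<..} = (\<Union>n. {ereal (r + 1 / real (Suc n))..})"
    proof (intro set_eqI iffI)
      fix z assume z: "z \<in> {ereal r<..}"
      show "z \<in> (\<Union>n. {ereal (r + 1 / real (Suc n))..})"
      proof (cases z)
        case (real s)
        then obtain n where "1 / real (Suc n) < s - r" using z nat_approx_posE[of "s - r"] by auto
        then show ?thesis using real by (auto intro!: exI[of _ n])
      qed (use z in auto)
    next
      fix z assume "z \<in> (\<Union>n. {ereal (r + 1 / real (Suc n))..})"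
      then obtain n where "ereal (r + 1 / real (Suc n)) \<le> z" by auto
      moreover have "ereal r < ereal (r + 1 / real (Suc n))" by simp
      ultimately show "z \<in> {ereal r<..}" using less_le_trans by blast
    qed
    then show ?thesis using real ge by (auto intro!: E.countable_UN)
  next
    case PInf
    then have "{y<..} = {}" by auto
    then show ?thesis by (simp add: sigma_sets.Empty)
  next
    case MInf
    have "{- \<infinity><..} = (\<Union>n. {ereal (- real n)..})"
    proof (intro set_eqI iffI)
      fix z :: ereal assume "z \<in> {- \<infinity><..}"
      then show "z \<in> (\<Union>n. {ereal (- real n)..})"
      proof (cases z)
        case (real s)
        obtain n :: nat where "- s \<le> real n" using real_arch_simple by blast
        then show ?thesis using real by (auto intro!: exI[of _ n])
      qed auto
    next
      fix z assume "z \<in> (\<Union>n. {ereal (- real n)..})"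
      then obtain n where "ereal (- real n) \<le> z" by auto
      then show "z \<in> {- \<infinity><..}" by (cases z) auto
    qed
    then show ?thesis using MInf ge by (auto intro!: E.countable_UN)
  qed
  then have "sigma_sets UNIV (range greaterThan) \<subseteq> sigma_sets UNIV ?E"
    by (intro sigma_sets_mono) auto
  then show "sets (borel :: ereal measure) \<subseteq> sigma_sets UNIV ?E"
    unfolding borel_Ioi by simp
  show "sigma_sets UNIV ?E \<subseteq> sets borel"
  proof -
    have "?E \<subseteq> sets borel" by auto
    from sets.sigma_sets_subset[OF this] show ?thesis by simp
  qed
qed

text \<open>Lebesgue measure on \<open>(t, \<infinity>)\<close> plus a unit mass at \<open>\<infinity>\<close>: the interval \<open>(-1, 0)\<close> serves only to
  be collapsed to the atom.\<close>

definition half_line_with_infinity :: "real \<Rightarrow> ereal measure" where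
  "half_line_with_infinity t =
    distr (density lborel (indicator ({-1<..<0} \<union> {t<..}))) borel (\<lambda>b. if b < 0 then \<infinity> else ereal b)"

lemma sets_half_line_with_infinity [simp, measurable_cong]: "sets (half_line_with_infinity t) = sets borel"
  by (simp add: half_line_with_infinity_def)

lemma nn_integral_half_line_with_infinity:
  assumes t: "0 < t" and [measurable]: "h \<in> borel_measurable borel"
  shows "(\<integral>\<^sup>+b. h b \<partial>half_line_with_infinity t) = (\<integral>\<^sup>+b\<in>{t<..}. h (ereal b) \<partial>lborel) + h \<infinity>"
proof -
  have [measurable]: "(\<lambda>b. if b < 0 then \<infinity> else ereal b) \<in> borel_measurable borel"
    by measurable
  have "(\<integral>\<^sup>+b. h b \<partial>half_line_with_infinity t)
      = (\<integral>\<^sup>+b. indicator ({-1<..<0} \<union> {t<..}) b * h (if b < 0 then \<infinity> else ereal b) \<partial>lborel)"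
    unfolding half_line_with_infinity_def by (simp add: nn_integral_distr nn_integral_density)
  \<comment> \<open>Since t > 0, the collapsed interval is disjoint from (t, \<infinity>); its
    length 1 is the weight of the atom.\<close>
  also have "\<dots> = (\<integral>\<^sup>+b. h (ereal b) * indicator {t<..} b + h \<infinity> * indicator {-1<..<0} b \<partial>lborel)"
    using t by (intro nn_integral_cong) (auto split: split_indicator)
  also have "\<dots> = (\<integral>\<^sup>+b\<in>{t<..}. h (ereal b) \<partial>lborel) + (\<integral>\<^sup>+b. h \<infinity> * indicator {-1<..<0::real} b \<partial>lborel)"
    by (intro nn_integral_add) measurable
  also have "(\<integral>\<^sup>+b. h \<infinity> * indicator {-1<..<0::real} b \<partial>lborel) = h \<infinity>"
    by (simp add: nn_integral_cmult_indicator)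
  finally show ?thesis .
qed

lemma sigma_finite_half_line_with_infinity:
  assumes t: "0 < t"
  shows "sigma_finite_measure (half_line_with_infinity t)"
proof
  let ?R = "half_line_with_infinity t"
  let ?A = "insert {\<infinity>} (range (\<lambda>n::nat. {..ereal (real n)}))"
  have em: "emeasure ?R A = (\<integral>\<^sup>+b\<in>{t<..}. indicator A (ereal b) \<partial>lborel) + indicator A \<infinity>" if A: "A \<in> sets borel" for A
    using nn_integral_half_line_with_infinity[OF t, of "indicator A"] A by simp
  have "emeasure ?R {..ereal (real n)} \<noteq> \<infinity>" for n
  proof -
    have "(\<integral>\<^sup>+b\<in>{t<..}. indicator {..ereal (real n)} (ereal b) \<partial>lborel) \<le> (\<integral>\<^sup>+b. indicator {t..real n} b \<partial>lborel)"
      by (intro nn_integral_mono) (auto split: split_indicator)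
    also have "\<dots> < \<infinity>" by (simp add: emeasure_lborel_Icc_eq)
    finally show ?thesis by (simp add: em less_top)
  qed
  moreover have "emeasure ?R {\<infinity>} \<noteq> \<infinity>"
    by (simp add: em)
  moreover have UN: "x \<in> \<Union>?A" for x :: ereal
  proof (cases x)
    case (real r)
    obtain n :: nat where "r \<le> real n" using real_arch_simple by blast
    then show ?thesis using real by auto
  qed auto
  ultimately show "\<exists>A. countable A \<and> A \<subseteq> sets ?R \<and> \<Union>A = space ?R \<and> (\<forall>a\<in>A. emeasure ?R a \<noteq> \<infinity>)"
  proof (intro exI[of _ ?A] conjI)
    have "space ?R = UNIV" by (simp add: half_line_with_infinity_def)
    then show "\<Union>?A = space ?R" using UN by blast
  qed auto
qed

text \<open>The value at \<open>\<infinity>\<close> is a density against the unit atom, so finite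
  and infinite next zeros are treated by one function.\<close>

definition zeros_density :: "real \<Rightarrow> real \<Rightarrow> real \<Rightarrow> ereal \<Rightarrow> ennreal" where
  "zeros_density \<mu> t a b =
    (if 0 < a \<and> a < t then
       if b = \<infinity> then ennreal (last_zero_density \<mu> a)
       else if ereal t < b then ennreal (joint_density \<mu> a (real_of_ereal b)) else 0
     else 0)"

lemma borel_measurable_zeros_density [measurable]:
  assumes [measurable]: "f \<in> borel_measurable M" "g \<in> borel_measurable M"
  shows "(\<lambda>x. zeros_density \<mu> t (f x) (g x)) \<in> borel_measurable M"
  unfolding zeros_density_def by measurable

text \<open>Single points are null, which absorbs the difference between closed rays and open
  intervals; the clipping at t comes from the support of the density.\<close>

lemma nn_integral_zeros_density_rectangle:
  assumes t: "0 < t"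
  shows "(\<integral>\<^sup>+b\<in>{ereal y..}. (\<integral>\<^sup>+a\<in>{..x}. zeros_density \<mu> t a b \<partial>lborel) \<partial>half_line_with_infinity t)
    = (if 0 < x then (\<integral>\<^sup>+b\<in>{max y t<..}. ennreal (next_zero_density \<mu> (min x t) b) \<partial>lborel)
      + (\<integral>\<^sup>+a\<in>{0<..<min x t}. ennreal (last_zero_density \<mu> a) \<partial>lborel) else 0)"
proof (cases "0 < x")
  case True
  have inner: "(\<integral>\<^sup>+a\<in>{..x}. zeros_density \<mu> t a b \<partial>lborel)
      = (\<integral>\<^sup>+a\<in>{0<..<min x t}. zeros_density \<mu> t a b \<partial>lborel)" for b
    by (intro nn_integral_cong_AE AE_I'[of "{x}"]) (auto simp: zeros_density_def split: split_indicator)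
  have fin: "(\<integral>\<^sup>+a\<in>{0<..<min x t}. zeros_density \<mu> t a (ereal b) \<partial>lborel) = ennreal (next_zero_density \<mu> (min x t) b)"
    if "t < b" for b
    using nn_integral_joint_density[of "min x t" b \<mu>] True t that
    by (subst nn_integral_cong[where v = "\<lambda>a. ennreal (joint_density \<mu> a b) * indicator {0<..<min x t} a"])
       (auto simp: zeros_density_def split: split_indicator)
  have inf: "(\<integral>\<^sup>+a\<in>{0<..<min x t}. zeros_density \<mu> t a \<infinity> \<partial>lborel) = (\<integral>\<^sup>+a\<in>{0<..<min x t}. ennreal (last_zero_density \<mu> a) \<partial>lborel)"
    by (intro nn_integral_cong) (auto simp: zeros_density_def split: split_indicator)
  have "(\<integral>\<^sup>+b\<in>{ereal y..}. (\<integral>\<^sup>+a\<in>{..x}. zeros_density \<mu> t a b \<partial>lborel) \<partial>half_line_with_infinity t)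
      = (\<integral>\<^sup>+b\<in>{t<..}. (\<integral>\<^sup>+a\<in>{0<..<min x t}. zeros_density \<mu> t a (ereal b) \<partial>lborel) * indicator {ereal y..} (ereal b) \<partial>lborel)
        + (\<integral>\<^sup>+a\<in>{0<..<min x t}. ennreal (last_zero_density \<mu> a) \<partial>lborel)"
    unfolding inner using t by (subst nn_integral_half_line_with_infinity) (auto simp: inf)
  also have "(\<integral>\<^sup>+b\<in>{t<..}. (\<integral>\<^sup>+a\<in>{0<..<min x t}. zeros_density \<mu> t a (ereal b) \<partial>lborel) * indicator {ereal y..} (ereal b) \<partial>lborel)
      = (\<integral>\<^sup>+b\<in>{max y t<..}. ennreal (next_zero_density \<mu> (min x t) b) \<partial>lborel)"
    by (intro nn_integral_cong_AE AE_I'[of "{y}"]) (auto simp: fin split: split_indicator)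
  finally show ?thesis using True by simp
next
  case False
  then have "(\<integral>\<^sup>+a\<in>{..x}. zeros_density \<mu> t a b \<partial>lborel) = 0" for b
    by (subst nn_integral_cong[where v = "\<lambda>_. 0"]) (auto simp: zeros_density_def split: split_indicator)
  then show ?thesis using False by simp
qed

context brownian_motion
begin

section \<open>Identification of the joint law\<close>

text \<open>The starting time 0 is a zero: it makes the set in the supremum nonempty and accounts
  for the condition 0 <= x.\<close>

lemma last_zero_before_le_iff:
  assumes \<omega>: "\<omega> \<in> space M" and t: "0 < t"
  shows "last_zero_before (with_drift \<mu> B) t \<omega> \<le> x \<longleftrightarrow>
    0 \<le> x \<and> (\<forall>s\<in>{x<..<t}. with_drift \<mu> B s \<omega> \<noteq> 0)"
proof -
  let ?S = "{s. 0 \<le> s \<and> s < t \<and> with_drift \<mu> B s \<omega> = 0}"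
  have 0: "0 \<in> ?S" using t start_at_0[OF \<omega>] by (simp add: with_drift_def)
  have "Sup ?S \<le> x \<longleftrightarrow> (\<forall>s\<in>?S. s \<le> x)"
    using 0 by (intro cSup_le_iff bdd_aboveI[of _ t]) auto
  also have "\<dots> \<longleftrightarrow> 0 \<le> x \<and> (\<forall>s\<in>{x<..<t}. with_drift \<mu> B s \<omega> \<noteq> 0)"
    using 0 by (auto simp: not_le[symmetric]) (metis order_trans less_imp_le not_le)+
  finally show ?thesis by (simp add: last_zero_before_def)
qed

text \<open>Both bounds are instances of the equivalence: taken at t, and at the last zero
  itself.\<close>

lemma last_zero_before_bounds:
  assumes \<omega>: "\<omega> \<in> space M" and t: "0 < t"
  shows "0 \<le> last_zero_before (with_drift \<mu> B) t \<omega>" "last_zero_before (with_drift \<mu> B) t \<omega> \<le> t"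
  using last_zero_before_le_iff[OF \<omega> t, of \<mu> t] t
    last_zero_before_le_iff[OF \<omega> t, of \<mu> "last_zero_before (with_drift \<mu> B) t \<omega>"] by auto

lemma le_first_zero_after_iff:
  "ereal y \<le> first_zero_after (with_drift \<mu> B) t \<omega> \<longleftrightarrow> (\<forall>s\<in>{t<..<y}. with_drift \<mu> B s \<omega> \<noteq> 0)"
  unfolding first_zero_after_def le_Inf_iff by (auto simp: not_le[symmetric])

lemma measurable_last_zero_before:
  assumes t: "0 < t"
  shows "random_variable borel (last_zero_before (with_drift \<mu> B) t)"
proof (rule borel_measurableI_le)
  fix x
  show "{\<omega> \<in> space M. last_zero_before (with_drift \<mu> B) t \<omega> \<le> x} \<in> events"
  proof (cases "0 \<le> x")
    case True
    then show ?thesis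
      using no_zero_events[OF True, of t \<mu>]
      by (simp add: last_zero_before_le_iff[OF _ t] cong: conj_cong)
  next
    case False
    then show ?thesis
      by (simp add: last_zero_before_le_iff[OF _ t] cong: conj_cong)
  qed
qed

lemma measurable_first_zero_after:
  assumes t: "0 < t"
  shows "random_variable borel (first_zero_after (with_drift \<mu> B) t)"
proof (rule measurable_sigma_sets[OF sets_borel_ereal_eq])
  fix A assume "A \<in> insert UNIV (range (\<lambda>y::real. {ereal y..}))"
  then show "first_zero_after (with_drift \<mu> B) t -` A \<inter> space M \<in> events"
  proof
    assume "A \<in> range (\<lambda>y::real. {ereal y..})"
    then obtain y where "A = {ereal y..}" by auto
    then have "first_zero_after (with_drift \<mu> B) t -` A \<inter> space M
        = {\<omega>\<in>space M. \<forall>s\<in>{t<..<y}. with_drift \<mu> B s \<omega> \<noteq> 0}"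
      by (auto simp: le_first_zero_after_iff)
    then show ?thesis using no_zero_events[of t y \<mu>] t by simp
  qed simp
qed auto

text \<open>Almost surely the path is nonzero at t, hence on a neighbourhood of t, which keeps the
  earlier zeros from accumulating at t.\<close>

lemma AE_last_zero_before_less:
  assumes t: "0 < t"
  shows "AE \<omega> in M. last_zero_before (with_drift \<mu> B) t \<omega> < t"
  using AE_drift_neq_0[OF t, of \<mu>] AE_space
proof eventually_elim
  fix \<omega> assume nz: "B t \<omega> + \<mu> * t \<noteq> 0" and \<omega>: "\<omega> \<in> space M"
  then obtain e where e: "0 < e" "\<forall>s\<in>{0..}. dist t s < e \<longrightarrow> with_drift \<mu> B s \<omega> \<noteq> 0"
    using continuous_on_avoid[OF continuous_on_with_drift[OF \<omega>, of \<mu>], of t 0] t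
    by (auto simp: with_drift_def)
  have "last_zero_before (with_drift \<mu> B) t \<omega> \<le> max 0 (t - e)"
    using e by (auto simp: last_zero_before_le_iff[OF \<omega> t] dist_real_def)
  also have "\<dots> < t" using t e by simp
  finally show "last_zero_before (with_drift \<mu> B) t \<omega> < t" .
qed

text \<open>Zero-free intervals on either side of t join to a single one, since t itself is almost
  surely not a zero.\<close>

lemma emeasure_zeros_rectangle:
  assumes t: "0 < t" and x: "0 < x" "x \<le> t" and y: "t \<le> y" "x < y"
  shows "emeasure M {\<omega> \<in> space M. last_zero_before (with_drift \<mu> B) t \<omega> \<le> x \<and> ereal y \<le> first_zero_after (with_drift \<mu> B) t \<omega>}
    = (\<integral>\<^sup>+b\<in>{y<..}. ennreal (next_zero_density \<mu> x b) \<partial>lborel)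
      + (\<integral>\<^sup>+a\<in>{0<..<x}. ennreal (last_zero_density \<mu> a) \<partial>lborel)"
    (is "emeasure M ?Z = _")
proof -
  let ?N = "{\<omega> \<in> space M. \<forall>s\<in>{x<..<y}. with_drift \<mu> B s \<omega> \<noteq> 0}"
  note [measurable] = measurable_last_zero_before[OF t, of \<mu>] measurable_first_zero_after[OF t, of \<mu>]
  have "emeasure M ?Z = emeasure M ?N"
  proof (rule emeasure_eq_AE)
    show "AE \<omega> in M. \<omega> \<in> ?Z \<longleftrightarrow> \<omega> \<in> ?N"
      using AE_drift_neq_0[OF t, of \<mu>] AE_space
    proof eventually_elim
      fix \<omega> assume nz: "B t \<omega> + \<mu> * t \<noteq> 0" and \<omega>: "\<omega> \<in> space M"
      have "(\<forall>s\<in>{x<..<t}. with_drift \<mu> B s \<omega> \<noteq> 0) \<and> (\<forall>s\<in>{t<..<y}. with_drift \<mu> B s \<omega> \<noteq> 0)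
          \<longleftrightarrow> (\<forall>s\<in>{x<..<y}. with_drift \<mu> B s \<omega> \<noteq> 0)"
      proof (intro iffI conjI ballI)
        fix s assume *: "(\<forall>s\<in>{x<..<t}. with_drift \<mu> B s \<omega> \<noteq> 0) \<and> (\<forall>s\<in>{t<..<y}. with_drift \<mu> B s \<omega> \<noteq> 0)"
          and s: "s \<in> {x<..<y}"
        show "with_drift \<mu> B s \<omega> \<noteq> 0"
          using * s nz by (cases s t rule: linorder_cases) (auto simp: with_drift_def)
      qed (use x y in auto)
      then show "\<omega> \<in> ?Z \<longleftrightarrow> \<omega> \<in> ?N"
        using \<omega> x by (simp add: last_zero_before_le_iff[OF \<omega> t] le_first_zero_after_iff)
    qed
    show "?Z \<in> events" by measurable
    show "?N \<in> events" using x by (intro no_zero_events) simp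
  qed
  also have "\<dots> = (\<integral>\<^sup>+b\<in>{y<..}. ennreal (next_zero_density \<mu> x b) \<partial>lborel)
      + (\<integral>\<^sup>+a\<in>{0<..<x}. ennreal (last_zero_density \<mu> a) \<partial>lborel)"
    by (rule prob_no_zero) (use x y in auto)
  finally show ?thesis .
qed

text \<open>Two measures that agree on an intersection-stable family of rectangles. The whole space
  belongs to the family, so the normalization of the candidate density comes out of the comparison
  instead of a separate computation.\<close>

lemma distr_zeros:
  assumes t: "0 < t"
  shows "distr M (borel \<Otimes>\<^sub>M borel)
      (\<lambda>\<omega>. (last_zero_before (with_drift \<mu> B) t \<omega>, first_zero_after (with_drift \<mu> B) t \<omega>))
    = density (lborel \<Otimes>\<^sub>M half_line_with_infinity t) (\<lambda>(a, b). zeros_density \<mu> t a b)"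
    (is "?P = ?J")
proof -
  let ?g = "last_zero_before (with_drift \<mu> B) t" and ?d = "first_zero_after (with_drift \<mu> B) t"
  let ?R = "half_line_with_infinity t"
  note [measurable] = measurable_last_zero_before[OF t, of \<mu>] measurable_first_zero_after[OF t, of \<mu>]
  interpret R: sigma_finite_measure ?R by (rule sigma_finite_half_line_with_infinity[OF t])
  interpret pair_sigma_finite lborel ?R ..
  have sJ: "sets ?J = sets (borel \<Otimes>\<^sub>M borel)"
    by (simp cong: sets_pair_measure_cong)
  have emJ: "emeasure ?J (A \<times> C) = (\<integral>\<^sup>+b\<in>C. (\<integral>\<^sup>+a\<in>A. zeros_density \<mu> t a b \<partial>lborel) \<partial>?R)"
    if [measurable]: "A \<in> sets borel" "C \<in> sets borel" for A C
  proof -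
    have "emeasure ?J (A \<times> C) = (\<integral>\<^sup>+z. (case z of (a, b) \<Rightarrow> zeros_density \<mu> t a b) * indicator (A \<times> C) z \<partial>(lborel \<Otimes>\<^sub>M ?R))"
      by (rule emeasure_density) measurable
    also have "\<dots> = (\<integral>\<^sup>+b. (\<integral>\<^sup>+a. zeros_density \<mu> t a b * indicator (A \<times> C) (a, b) \<partial>lborel) \<partial>?R)"
      by (subst nn_integral_snd[symmetric]) (auto simp: case_prod_beta)
    also have "\<dots> = (\<integral>\<^sup>+b\<in>C. (\<integral>\<^sup>+a\<in>A. zeros_density \<mu> t a b \<partial>lborel) \<partial>?R)"
      by (intro nn_integral_cong) (auto simp: indicator_times split: split_indicator)
    finally show ?thesis .
  qed
  have emP: "emeasure ?P (A \<times> C) = emeasure M {\<omega> \<in> space M. ?g \<omega> \<in> A \<and> ?d \<omega> \<in> C}"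
    if [measurable]: "A \<in> sets borel" "C \<in> sets borel" for A C
    by (subst emeasure_distr) (auto intro!: arg_cong[of _ _ "emeasure M"])
  have dt: "ereal t \<le> ?d \<omega>" for \<omega>
    by (simp add: le_first_zero_after_iff)
  \<comment> \<open>Neither measure charges points with first coordinate above t or second
    coordinate below t, so every rectangle can be clipped to a corner with x <= t <= y.\<close>
  have redP: "emeasure ?P (A \<times> C) = emeasure ?P ((A \<inter> {..t}) \<times> (C \<inter> {ereal t..}))"
    if [measurable]: "A \<in> sets borel" "C \<in> sets borel" for A C
    using last_zero_before_bounds(2)[OF _ t, of _ \<mu>] dt
    by (simp add: emP) (intro arg_cong[of _ _ "emeasure M"], auto)
  have redJ: "emeasure ?J (A \<times> C) = emeasure ?J ((A \<inter> {..t}) \<times> (C \<inter> {ereal t..}))"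
    if [measurable]: "A \<in> sets borel" "C \<in> sets borel" for A C
  proof -
    have "(\<integral>\<^sup>+b\<in>C. (\<integral>\<^sup>+a\<in>A. zeros_density \<mu> t a b \<partial>lborel) \<partial>?R)
        = (\<integral>\<^sup>+b. (\<integral>\<^sup>+a. zeros_density \<mu> t a b * indicator A a * indicator C b \<partial>lborel) \<partial>?R)"
      by (intro nn_integral_cong nn_integral_multc[symmetric]) measurable
    also have "\<dots> = (\<integral>\<^sup>+b. (\<integral>\<^sup>+a. zeros_density \<mu> t a b * indicator (A \<inter> {..t}) a * indicator (C \<inter> {ereal t..}) b \<partial>lborel) \<partial>?R)"
      by (intro nn_integral_cong) (auto simp: zeros_density_def split: split_indicator)
    also have "\<dots> = (\<integral>\<^sup>+b\<in>C \<inter> {ereal t..}. (\<integral>\<^sup>+a\<in>A \<inter> {..t}. zeros_density \<mu> t a b \<partial>lborel) \<partial>?R)"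
      by (intro nn_integral_cong nn_integral_multc) measurable
    finally show ?thesis by (simp add: emJ)
  qed
  have eq_pos: "emeasure ?P ({..x} \<times> {ereal y..}) = emeasure ?J ({..x} \<times> {ereal y..})"
    if "0 < x" "x \<le> t" "t \<le> y" "x < y" for x y
    using that emeasure_zeros_rectangle[OF t that, of \<mu>] t
    by (simp add: emP emJ nn_integral_zeros_density_rectangle min_absorb1 max_absorb1)
  have finP: "emeasure ?P X \<noteq> \<infinity>" for X
  proof -
    interpret P: prob_space ?P by (rule prob_space_distr) measurable
    show ?thesis by simp
  qed
  \<comment> \<open>The corner x = 0 as a decreasing limit from x > 0; finiteness of the second
    measure along the sequence comes from its agreement with the first.\<close>
  have eq0: "emeasure ?P ({..0} \<times> {ereal t..}) = emeasure ?J ({..0} \<times> {ereal t..})"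
  proof -
    define x where "x n = t / real (Suc (Suc n))" for n :: nat
    have x: "0 < x n" "x n \<le> t" "x n < t" for n using t by (auto simp: x_def field_simps add_pos_nonneg)
    have xl: "x \<longlonglongrightarrow> 0"
      unfolding x_def using tendsto_mult[OF tendsto_const LIMSEQ_Suc[OF LIMSEQ_Suc[OF lim_1_over_n]], of t] by simp
    let ?D = "\<lambda>n. {..x n} \<times> {ereal t..}"
    have "x (Suc n) \<le> x n" for n
      unfolding x_def using t by (intro divide_left_mono) auto
    then have dec: "decseq ?D"
      by (intro decseq_SucI Sigma_mono) auto
    have eqD: "emeasure ?P (?D n) = emeasure ?J (?D n)" for n
      using x by (intro eq_pos order_refl)
    have D: "range ?D \<subseteq> sets (borel \<Otimes>\<^sub>M borel)" by (intro image_subsetI pair_measureI) auto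
    have INT: "(\<Inter>n. ?D n) = {..0} \<times> {ereal t..}"
    proof -
      have "a \<le> 0" if "\<And>n. a \<le> x n" for a
        using that by (intro LIMSEQ_le_const[OF xl]) auto
      then have "(\<Inter>n. {..x n}) = {..0}"
        by (auto intro: order_trans[OF _ less_imp_le[OF x(1)]])
      moreover have "(\<Inter>n. ?D n) = (\<Inter>n. {..x n}) \<times> {ereal t..}" by auto
      ultimately show ?thesis by simp
    qed
    have "(\<lambda>n. emeasure ?P (?D n)) \<longlonglongrightarrow> emeasure ?P ({..0} \<times> {ereal t..})"
      using Lim_emeasure_decseq[OF _ dec, of ?P] D finP unfolding INT by simp
    moreover have "(\<lambda>n. emeasure ?J (?D n)) \<longlonglongrightarrow> emeasure ?J ({..0} \<times> {ereal t..})"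
    proof -
      have "emeasure ?J (?D n) \<noteq> \<infinity>" for n
        unfolding eqD[symmetric] by (rule finP)
      then show ?thesis
        using D by (intro Lim_emeasure_decseq[OF _ dec, of ?J, unfolded INT sJ])
    qed
    ultimately show ?thesis
      unfolding eqD by (rule LIMSEQ_unique)
  qed
  \<comment> \<open>The corner x = y = t as an increasing limit from x < t. The limit misses the
    line where the first coordinate is t, which is null for both measures.\<close>
  have eqt: "emeasure ?P ({..t} \<times> {ereal t..}) = emeasure ?J ({..t} \<times> {ereal t..})"
  proof -
    define x where "x n = t - t / real (Suc (Suc n))" for n :: nat
    have x: "0 < x n" "x n \<le> t" "x n < t" for n using t by (auto simp: x_def field_simps add_pos_nonneg)
    have xl: "x \<longlonglongrightarrow> t"
      unfolding x_def using tendsto_diff[OF tendsto_const tendsto_mult[OF tendsto_const LIMSEQ_Suc[OF LIMSEQ_Suc[OF lim_1_over_n]], of t], of t] by simp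
    let ?D = "\<lambda>n. {..x n} \<times> {ereal t..}"
    have "x n \<le> x (Suc n)" for n
      unfolding x_def using t by (intro diff_left_mono divide_left_mono) auto
    then have inc: "incseq ?D"
      by (intro incseq_SucI Sigma_mono) auto
    have eqD: "emeasure ?P (?D n) = emeasure ?J (?D n)" for n
      using x by (intro eq_pos order_refl)
    have D: "range ?D \<subseteq> sets (borel \<Otimes>\<^sub>M borel)" by (intro image_subsetI pair_measureI) auto
    have UN: "(\<Union>n. ?D n) = {..<t} \<times> {ereal t..}"
    proof -
      have "\<exists>n. a \<le> x n" if "a < t" for a
        using order_tendstoD(1)[OF xl that] by (auto simp: eventually_sequentially intro: less_imp_le)
      then have "(\<Union>n. {..x n}) = {..<t}"
        by (auto intro: le_less_trans[OF _ x(3)])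
      moreover have "(\<Union>n. ?D n) = (\<Union>n. {..x n}) \<times> {ereal t..}" by auto
      ultimately show ?thesis by simp
    qed
    have "(\<lambda>n. emeasure ?P (?D n)) \<longlonglongrightarrow> emeasure ?P ({..<t} \<times> {ereal t..})"
      using Lim_emeasure_incseq[OF _ inc, of ?P] D unfolding UN by simp
    moreover have "(\<lambda>n. emeasure ?J (?D n)) \<longlonglongrightarrow> emeasure ?J ({..<t} \<times> {ereal t..})"
      using D by (intro Lim_emeasure_incseq[OF _ inc, of ?J, unfolded UN sJ])
    ultimately have "emeasure ?P ({..<t} \<times> {ereal t..}) = emeasure ?J ({..<t} \<times> {ereal t..})"
      unfolding eqD by (rule LIMSEQ_unique)
    moreover have "emeasure ?P ({..t} \<times> {ereal t..}) = emeasure ?P ({..<t} \<times> {ereal t..})"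
      using AE_last_zero_before_less[OF t, of \<mu>] by (simp add: emP) (intro emeasure_eq_AE; auto)
    moreover have "emeasure ?J ({..t} \<times> {ereal t..}) = emeasure ?J ({..<t} \<times> {ereal t..})"
    proof -
      have "(\<integral>\<^sup>+a\<in>{..t}. zeros_density \<mu> t a b \<partial>lborel) = (\<integral>\<^sup>+a\<in>{..<t}. zeros_density \<mu> t a b \<partial>lborel)" for b
        by (intro nn_integral_cong) (auto simp: zeros_density_def split: split_indicator)
      then show ?thesis by (simp add: emJ)
    qed
    ultimately show ?thesis by simp
  qed
  have eq: "emeasure ?P ({..x} \<times> {ereal y..}) = emeasure ?J ({..x} \<times> {ereal y..})"
    if xy: "x \<le> t" "t \<le> y" for x y
  proof -
    consider "x \<le> 0" | "0 < x" "x < y" | "x = t" "y = t" using xy t by force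
    then show ?thesis
    proof cases
      case 1
      have J0: "emeasure ?J ({..z} \<times> {ereal y..}) = 0" if "z \<le> 0" for z y
        using that t by (simp add: emJ nn_integral_zeros_density_rectangle)
      \<comment> \<open>The candidate has no mass at first coordinates up to 0, so monotonicity
        carries the value 0 from the corner to all smaller rectangles.\<close>
      have "emeasure ?P ({..x} \<times> {ereal y..}) \<le> emeasure ?P ({..0} \<times> {ereal t..})"
        using 1 xy by (intro emeasure_mono Sigma_mono) simp_all
      then show ?thesis using eq0 J0 1 by simp
    qed (use eq_pos eqt xy in auto)
  qed
  let ?Ea = "insert UNIV (range atMost) :: real set set"
  let ?Eb = "insert UNIV (range (\<lambda>y::real. {ereal y..}))"
  have Ea: "sets (borel :: real measure) = sigma_sets UNIV ?Ea"
  proof -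
    have "sigma_sets UNIV ?Ea = sigma_sets UNIV (range atMost :: real set set)"
      by (intro sigma_sets_eqI) (auto intro: sigma_sets_top)
    then show ?thesis by (simp add: borel_eq_atMost)
  qed
  have S: "sets (borel \<Otimes>\<^sub>M borel) = sigma_sets UNIV {A \<times> C |A C. A \<in> ?Ea \<and> C \<in> ?Eb}"
    using sets_pair_eq[of ?Ea "borel :: real measure" "{UNIV}" ?Eb "borel :: ereal measure" "{UNIV}"] Ea sets_borel_ereal_eq
    by simp
  show ?thesis
  proof (rule measure_eqI_generator_eq[where A = "\<lambda>_. UNIV" and \<Omega> = UNIV])
    have Ia: "A \<inter> A' \<in> ?Ea" if "A \<in> ?Ea" "A' \<in> ?Ea" for A A'
      using that by auto
    have Ib: "C \<inter> C' \<in> ?Eb" if IC: "C \<in> ?Eb" "C' \<in> ?Eb" for C C'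
    proof -
      consider "C = UNIV" | "C' = UNIV" | u v where "C = {ereal u..}" "C' = {ereal v..}"
        using IC by blast
      then show ?thesis
      proof cases
        case 3
        have "C \<inter> C' = {ereal (max u v)..}" unfolding 3 by auto
        then show ?thesis by (auto simp del: ereal_max)
      qed (use IC in auto)
    qed
    show "Int_stable {A \<times> C |A C. A \<in> ?Ea \<and> C \<in> ?Eb}"
    proof (rule Int_stableI)
      fix X Y assume "X \<in> {A \<times> C |A C. A \<in> ?Ea \<and> C \<in> ?Eb}" "Y \<in> {A \<times> C |A C. A \<in> ?Ea \<and> C \<in> ?Eb}"
      then obtain A C A' C' where "X = A \<times> C" "Y = A' \<times> C'" "A \<in> ?Ea" "C \<in> ?Eb" "A' \<in> ?Ea" "C' \<in> ?Eb"
        by blast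
      then show "X \<inter> Y \<in> {A \<times> C |A C. A \<in> ?Ea \<and> C \<in> ?Eb}"
        using Ia[of A A'] Ib[of C C'] unfolding Times_Int_Times by blast
    qed
    show "sets ?P = sigma_sets UNIV {A \<times> C |A C. A \<in> ?Ea \<and> C \<in> ?Eb}"
      using S by simp
    show "sets ?J = sigma_sets UNIV {A \<times> C |A C. A \<in> ?Ea \<and> C \<in> ?Eb}"
      using S unfolding sJ .
    show "range (\<lambda>_. UNIV) \<subseteq> {A \<times> C |A C. A \<in> ?Ea \<and> C \<in> ?Eb}"
      using UNIV_Times_UNIV by blast
    fix X assume "X \<in> {A \<times> C |A C. A \<in> ?Ea \<and> C \<in> ?Eb}"
    then obtain A C where X: "X = A \<times> C" and A: "A \<in> ?Ea" and C: "C \<in> ?Eb" by blast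
    have sA: "A \<in> sets borel" and sC: "C \<in> sets borel" using A C by auto
    obtain x where x: "A \<inter> {..t} = {..x}" "x \<le> t"
      using A by (auto intro: that[of "min _ t"])
    obtain y where y: "C \<inter> {ereal t..} = {ereal y..}" "t \<le> y"
    proof -
      consider "C = UNIV" | u where "C = {ereal u..}" using C by blast
      then show ?thesis
      proof cases
        case 1
        then show ?thesis by (intro that[of t]) auto
      next
        case 2
        have "C \<inter> {ereal t..} = {ereal (max u t)..}" unfolding 2 by auto
        then show ?thesis by (rule that) simp
      qed
    qed
    show "emeasure ?P X = emeasure ?J X"
      unfolding X redP[OF sA sC] redJ[OF sA sC] x(1) y(1) by (rule eq[OF x(2) y(2)])
  qed (use finP in auto)
qed

end

section \<open>The conditional laws\<close>

text \<open>The joint density and the marginal of the next zero carry the same drift factor, which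
  depends on b alone; with b fixed it cancels, and \<mu> with it.\<close>

lemma zeros_density_cond_last_zero:
  assumes t: "0 < t" and b: "t < b"
  shows "conditional_kernel K\<^sub>0 lborel (\<lambda>b a. zeros_density \<mu> t a b) (ereal b)
    = density lborel (\<lambda>a. indicator {0<..<t} a * ennreal (1 / 2 * (b / sqrt (a * t)) * sqrt ((b - t) / (b - a) ^ 3)))"
proof -
  have h: "(\<integral>\<^sup>+a. zeros_density \<mu> t a (ereal b) \<partial>lborel) = ennreal (next_zero_density \<mu> t b)"
    unfolding nn_integral_joint_density[OF t b, symmetric] using b
    by (intro nn_integral_cong) (auto simp: zeros_density_def split: split_indicator)
  have pos: "0 < next_zero_density \<mu> t b"
    using t b by (simp add: next_zero_density_def)
  have "zeros_density \<mu> t a (ereal b) / ennreal (next_zero_density \<mu> t b)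
      = indicator {0<..<t} a * ennreal (1 / 2 * (b / sqrt (a * t)) * sqrt ((b - t) / (b - a) ^ 3))" for a
  proof (cases "a \<in> {0<..<t}")
    case True
    then have "joint_density \<mu> a b / next_zero_density \<mu> t b = 1 / 2 * (b / sqrt (a * t)) * sqrt ((b - t) / (b - a) ^ 3)"
      using t b by (simp add: joint_density_def next_zero_density_def real_sqrt_mult real_sqrt_divide field_simps)
    moreover have "0 \<le> joint_density \<mu> a b"
      using True b by (simp add: joint_density_def)
    ultimately show ?thesis
      using True b pos by (simp add: zeros_density_def divide_ennreal)
  qed (auto simp: zeros_density_def)
  then show ?thesis
    using pos by (simp add: conditional_kernel_def h)
qed

lemma ereal_image_sets_borel: "A \<in> sets borel \<Longrightarrow> ereal ` A \<in> sets borel"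
proof -
  assume [measurable]: "A \<in> sets borel"
  have "ereal ` A = {z. z \<noteq> \<infinity> \<and> z \<noteq> - \<infinity> \<and> real_of_ereal z \<in> A}"
  proof (intro set_eqI iffI)
    fix z assume "z \<in> {z. z \<noteq> \<infinity> \<and> z \<noteq> - \<infinity> \<and> real_of_ereal z \<in> A}"
    then show "z \<in> ereal ` A" by (cases z) auto
  qed auto
  also have "\<dots> \<in> sets borel" by measurable
  finally show ?thesis .
qed

text \<open>D is the bracket in \<open>last_zero_marginal_eq\<close>. Its prefactor carries the
  drift factor at time t, so in the quotients only the drift over the time differences b - t and t -
  a survives.\<close>

lemma zeros_density_cond_next_zero:
  fixes \<mu> t a :: real and K\<^sub>0 :: "ereal measure"
  assumes t: "0 < t" and a: "0 < a" "a < t"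
  defines "D \<equiv> 1 + \<mu>\<^sup>2 * sqrt (a * (t - a)) * exp (\<mu>\<^sup>2 / 2 * (t - a)) *
        (LBINT y:{0..sqrt ((t - a) / a)}. exp (- (\<mu>\<^sup>2 * y\<^sup>2 * a / 2)))"
    and "\<kappa> \<equiv> conditional_kernel K\<^sub>0 (half_line_with_infinity t) (zeros_density \<mu> t) a"
  shows "\<And>A. A \<in> sets borel \<Longrightarrow> A \<subseteq> {t<..} \<Longrightarrow> emeasure \<kappa> (ereal ` A) =
      (\<integral>\<^sup>+b\<in>A. ennreal ((1 / 2 * sqrt ((t - a) / (b - a) ^ 3) * exp (- (\<mu>\<^sup>2 / 2) * (b - t))) / D) \<partial>lborel)"
    and "measure \<kappa> {\<infinity>} = (sqrt (pi / 2) * \<bar>\<mu>\<bar> * sqrt (t - a) * exp (\<mu>\<^sup>2 / 2 * (t - a))) / D"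
proof -
  let ?R = "half_line_with_infinity t"
  define m where "m = last_zero_marginal \<mu> t a"
  have m: "0 < m" unfolding m_def by (rule last_zero_marginal_pos[OF a])
  have meq: "m = exp (- (\<mu>\<^sup>2 * t / 2)) / (pi * sqrt (a * (t - a))) * D"
    unfolding m_def D_def by (rule last_zero_marginal_eq[OF a])
  have D: "D \<noteq> 0" using m meq by auto
  have "(\<integral>\<^sup>+b. zeros_density \<mu> t a b \<partial>?R)
      = (\<integral>\<^sup>+b\<in>{t<..}. zeros_density \<mu> t a (ereal b) \<partial>lborel) + zeros_density \<mu> t a \<infinity>"
    by (rule nn_integral_half_line_with_infinity[OF t]) measurable
  also have "\<dots> = (\<integral>\<^sup>+b\<in>{t<..}. ennreal (joint_density \<mu> a b) \<partial>lborel) + ennreal (last_zero_density \<mu> a)"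
    using a by (intro arg_cong2[where f = "(+)"] nn_integral_cong) (auto simp: zeros_density_def split: split_indicator)
  also have "\<dots> = ennreal m"
    unfolding m_def by (rule nn_integral_joint_density_right[OF a])
  finally have h: "(\<integral>\<^sup>+b. zeros_density \<mu> t a b \<partial>?R) = ennreal m" .
  have \<kappa>: "\<kappa> = density ?R (\<lambda>b. zeros_density \<mu> t a b / ennreal m)"
    using m by (simp add: \<kappa>_def conditional_kernel_def h)
  have em: "emeasure \<kappa> C = (\<integral>\<^sup>+b\<in>{t<..}. zeros_density \<mu> t a (ereal b) / ennreal m * indicator C (ereal b) \<partial>lborel)
      + zeros_density \<mu> t a \<infinity> / ennreal m * indicator C \<infinity>"
    if [measurable]: "C \<in> sets borel" for C
    unfolding \<kappa> by (simp add: emeasure_density nn_integral_half_line_with_infinity[OF t])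
  have q: "zeros_density \<mu> t a \<infinity> / ennreal m = ennreal (last_zero_density \<mu> a / m)"
    using a m by (simp add: zeros_density_def divide_ennreal last_zero_density_def)
  have e: "exp (- (\<mu>\<^sup>2 * u / 2)) / exp (- (\<mu>\<^sup>2 * t / 2)) = exp (\<mu>\<^sup>2 / 2 * (t - u))" for u
    by (simp add: exp_diff[symmetric] field_simps)
  have joint: "joint_density \<mu> a b / m = (1 / 2 * sqrt ((t - a) / (b - a) ^ 3) * exp (- (\<mu>\<^sup>2 / 2) * (b - t))) / D"
    if b: "t < b" for b
  proof -
    have "joint_density \<mu> a b / m = 1 / 2 * (sqrt (a * (t - a)) / sqrt (a * (b - a) ^ 3))
        * (exp (- (\<mu>\<^sup>2 * b / 2)) / exp (- (\<mu>\<^sup>2 * t / 2))) / D"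
      unfolding meq joint_density_def by (simp add: mult_ac)
    also have "sqrt (a * (t - a)) / sqrt (a * (b - a) ^ 3) = sqrt ((t - a) / (b - a) ^ 3)"
      using a by (simp add: real_sqrt_divide[symmetric])
    also have "exp (- (\<mu>\<^sup>2 * b / 2)) / exp (- (\<mu>\<^sup>2 * t / 2)) = exp (- (\<mu>\<^sup>2 / 2) * (b - t))"
      unfolding e by (simp only: right_diff_distrib) simp
    finally show ?thesis .
  qed
  show "measure \<kappa> {\<infinity>} = (sqrt (pi / 2) * \<bar>\<mu>\<bar> * sqrt (t - a) * exp (\<mu>\<^sup>2 / 2 * (t - a))) / D"
  proof -
    have "measure \<kappa> {\<infinity>} = last_zero_density \<mu> a / m"
      unfolding measure_def using em[of "{\<infinity>}"] a m by (simp add: q last_zero_density_def)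
    also have "\<dots> = \<bar>\<mu>\<bar> * (pi * sqrt (a * (t - a)) / sqrt (2 * pi * a))
        * (exp (- (\<mu>\<^sup>2 * a / 2)) / exp (- (\<mu>\<^sup>2 * t / 2))) / D"
      unfolding meq last_zero_density_def by (simp add: mult_ac)
    \<comment> \<open>Collects the constants of the atom: pi / sqrt (2 pi) is sqrt (pi / 2), and a
      cancels.\<close>
    also have "pi * sqrt (a * (t - a)) / sqrt (2 * pi * a) = sqrt (pi / 2) * sqrt (t - a)"
    proof -
      have "pi * sqrt (a * (t - a)) / sqrt (2 * pi * a) = sqrt pi * sqrt pi * sqrt (a * (t - a)) / sqrt (2 * pi * a)"
        by simp
      also have "\<dots> = sqrt (pi * pi * (a * (t - a)) / (2 * pi * a))"
        by (simp only: real_sqrt_mult real_sqrt_divide)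
      also have "pi * pi * (a * (t - a)) / (2 * pi * a) = pi / 2 * (t - a)"
        using a by simp
      finally show ?thesis by (simp only: real_sqrt_mult)
    qed
    finally show ?thesis unfolding e by (simp add: mult_ac)
  qed
  fix A :: "real set" assume [measurable]: "A \<in> sets borel" and A: "A \<subseteq> {t<..}"
  have "emeasure \<kappa> (ereal ` A) = (\<integral>\<^sup>+b\<in>{t<..}. zeros_density \<mu> t a (ereal b) / ennreal m * indicator (ereal ` A) (ereal b) \<partial>lborel)"
    using em[OF ereal_image_sets_borel[of A]] by (auto simp: indicator_def)
  also have "\<dots> = (\<integral>\<^sup>+b\<in>A. ennreal (joint_density \<mu> a b / m) \<partial>lborel)"
  proof (intro nn_integral_cong)
    fix b
    have "0 \<le> joint_density \<mu> a b" if "t < b"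
      using a that by (simp add: joint_density_def)
    then show "zeros_density \<mu> t a (ereal b) / ennreal m * indicator (ereal ` A) (ereal b) * indicator {t<..} b
        = ennreal (joint_density \<mu> a b / m) * indicator A b"
      using A a m by (auto simp: zeros_density_def divide_ennreal split: split_indicator)
  qed
  also have "\<dots> = (\<integral>\<^sup>+b\<in>A. ennreal ((1 / 2 * sqrt ((t - a) / (b - a) ^ 3) * exp (- (\<mu>\<^sup>2 / 2) * (b - t))) / D) \<partial>lborel)"
    using A by (intro nn_integral_cong) (auto simp: joint split: split_indicator)
  finally show "emeasure \<kappa> (ereal ` A) =
      (\<integral>\<^sup>+b\<in>A. ennreal ((1 / 2 * sqrt ((t - a) / (b - a) ^ 3) * exp (- (\<mu>\<^sup>2 / 2) * (b - t))) / D) \<partial>lborel)" .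
qed

context brownian_motion
begin

text \<open>Both orders of integration are recorded because either zero can be the conditioning
  variable, over which the outer integral has to run.\<close>

lemma emeasure_zeros:
  assumes t: "0 < t" and [measurable]: "A \<in> sets borel" "C \<in> sets borel"
  shows "emeasure M {\<omega> \<in> space M. last_zero_before (with_drift \<mu> B) t \<omega> \<in> A \<and> first_zero_after (with_drift \<mu> B) t \<omega> \<in> C}
      = (\<integral>\<^sup>+b\<in>C. (\<integral>\<^sup>+a\<in>A. zeros_density \<mu> t a b \<partial>lborel) \<partial>half_line_with_infinity t)"
    and "emeasure M {\<omega> \<in> space M. last_zero_before (with_drift \<mu> B) t \<omega> \<in> A \<and> first_zero_after (with_drift \<mu> B) t \<omega> \<in> C}
      = (\<integral>\<^sup>+a\<in>A. (\<integral>\<^sup>+b\<in>C. zeros_density \<mu> t a b \<partial>half_line_with_infinity t) \<partial>lborel)"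
proof -
  let ?R = "half_line_with_infinity t"
  interpret R: sigma_finite_measure ?R by (rule sigma_finite_half_line_with_infinity[OF t])
  interpret pair_sigma_finite lborel ?R ..
  note [measurable] = measurable_last_zero_before[OF t, of \<mu>] measurable_first_zero_after[OF t, of \<mu>]
  let ?f = "\<lambda>z. zeros_density \<mu> t (fst z) (snd z) * indicator (A \<times> C) z"
  have "emeasure M {\<omega> \<in> space M. last_zero_before (with_drift \<mu> B) t \<omega> \<in> A \<and> first_zero_after (with_drift \<mu> B) t \<omega> \<in> C}
      = emeasure (density (lborel \<Otimes>\<^sub>M ?R) (\<lambda>(a, b). zeros_density \<mu> t a b)) (A \<times> C)"
    unfolding distr_zeros[OF t, symmetric]
    by (subst emeasure_distr) (auto intro!: arg_cong[of _ _ "emeasure M"])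
  also have "\<dots> = (\<integral>\<^sup>+z. ?f z \<partial>(lborel \<Otimes>\<^sub>M ?R))"
    by (subst emeasure_density) (auto simp: case_prod_beta)
  finally have eq: "emeasure M {\<omega> \<in> space M. last_zero_before (with_drift \<mu> B) t \<omega> \<in> A \<and> first_zero_after (with_drift \<mu> B) t \<omega> \<in> C}
      = (\<integral>\<^sup>+z. ?f z \<partial>(lborel \<Otimes>\<^sub>M ?R))" .
  have [measurable]: "?f \<in> borel_measurable (lborel \<Otimes>\<^sub>M ?R)"
    by measurable
  have "(\<integral>\<^sup>+z. ?f z \<partial>(lborel \<Otimes>\<^sub>M ?R)) = (\<integral>\<^sup>+b. (\<integral>\<^sup>+a. ?f (a, b) \<partial>lborel) \<partial>?R)"
    by (rule nn_integral_snd[symmetric]) measurable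
  also have "\<dots> = (\<integral>\<^sup>+b\<in>C. (\<integral>\<^sup>+a\<in>A. zeros_density \<mu> t a b \<partial>lborel) \<partial>?R)"
    by (intro nn_integral_cong) (auto simp: indicator_times split: split_indicator)
  finally show "emeasure M {\<omega> \<in> space M. last_zero_before (with_drift \<mu> B) t \<omega> \<in> A \<and> first_zero_after (with_drift \<mu> B) t \<omega> \<in> C}
      = (\<integral>\<^sup>+b\<in>C. (\<integral>\<^sup>+a\<in>A. zeros_density \<mu> t a b \<partial>lborel) \<partial>?R)"
    unfolding eq .
  have "(\<integral>\<^sup>+z. ?f z \<partial>(lborel \<Otimes>\<^sub>M ?R)) = (\<integral>\<^sup>+a. (\<integral>\<^sup>+b. ?f (a, b) \<partial>?R) \<partial>lborel)"
    by (rule R.nn_integral_fst[symmetric]) measurable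
  also have "\<dots> = (\<integral>\<^sup>+a\<in>A. (\<integral>\<^sup>+b\<in>C. zeros_density \<mu> t a b \<partial>?R) \<partial>lborel)"
    by (intro nn_integral_cong) (auto simp: indicator_times split: split_indicator)
  finally show "emeasure M {\<omega> \<in> space M. last_zero_before (with_drift \<mu> B) t \<omega> \<in> A \<and> first_zero_after (with_drift \<mu> B) t \<omega> \<in> C}
      = (\<integral>\<^sup>+a\<in>A. (\<integral>\<^sup>+b\<in>C. zeros_density \<mu> t a b \<partial>?R) \<partial>lborel)"
    unfolding eq .
qed

text \<open>The point mass at 0 stands in where the marginal density vanishes: at values up to t,
  and at \<open>\<infinity>\<close> when \<mu> = 0.\<close>

lemma regular_conditional_distribution_last_zero:
  assumes t: "0 < t"
  shows "regular_conditional_distribution M borel (last_zero_before (with_drift \<mu> B) t)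
    borel (first_zero_after (with_drift \<mu> B) t)
    (conditional_kernel (return borel 0) lborel (\<lambda>b a. zeros_density \<mu> t a b))"
proof (rule regular_conditional_distribution_conditional_kernel)
  show "prob_space M" by (rule prob_space_axioms)
  show "sigma_finite_measure lborel" by (rule sigma_finite_lborel)
  show "(\<lambda>(b, a). zeros_density \<mu> t a b) \<in> borel_measurable (half_line_with_infinity t \<Otimes>\<^sub>M lborel)"
    by measurable
  show "prob_space (return borel (0::real))" by (rule prob_space_return) simp
qed (use measurable_last_zero_before[OF t] measurable_first_zero_after[OF t] emeasure_zeros(1)[OF t] in simp_all)

lemma regular_conditional_distribution_next_zero:
  assumes t: "0 < t"
  shows "regular_conditional_distribution M borel (first_zero_after (with_drift \<mu> B) t)
    borel (last_zero_before (with_drift \<mu> B) t)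
    (conditional_kernel (return borel 0) (half_line_with_infinity t) (zeros_density \<mu> t))"
proof (rule regular_conditional_distribution_conditional_kernel)
  show "prob_space M" by (rule prob_space_axioms)
  show "sigma_finite_measure (half_line_with_infinity t)"
    by (rule sigma_finite_half_line_with_infinity[OF t])
  show "(\<lambda>(a, b). zeros_density \<mu> t a b) \<in> borel_measurable (lborel \<Otimes>\<^sub>M half_line_with_infinity t)"
    by measurable
  show "prob_space (return borel (0::ereal))" by (rule prob_space_return) simp
  show "emeasure M {\<omega> \<in> space M. first_zero_after (with_drift \<mu> B) t \<omega> \<in> A \<and> last_zero_before (with_drift \<mu> B) t \<omega> \<in> C}
      = (\<integral>\<^sup>+a\<in>C. (\<integral>\<^sup>+b\<in>A. zeros_density \<mu> t a b \<partial>half_line_with_infinity t) \<partial>lborel)"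
    if "A \<in> sets borel" "C \<in> sets borel" for A C
    using emeasure_zeros(2)[OF t that(2,1), of \<mu>] by (simp add: conj_commute)
qed (use measurable_last_zero_before[OF t] measurable_first_zero_after[OF t] in simp_all)

end

theorem mainTheorem5:
  fixes M :: "'a measure" and B :: "real \<Rightarrow> 'a \<Rightarrow> real" and \<mu> t :: real
  assumes "brownian_motion M B" and "0 < t"
  defines "T0t \<equiv> last_zero_before (with_drift \<mu> B) t"
    and "Tt0 \<equiv> first_zero_after (with_drift \<mu> B) t"
  shows
    "(\<exists>\<kappa>. regular_conditional_distribution M borel T0t borel Tt0 \<kappa> \<and>
        (\<forall>b>t. \<kappa> (ereal b) =
           density lborel (\<lambda>a. indicator {0<..<t} a *
             ennreal (1 / 2 * (b / sqrt (a * t)) * sqrt ((b - t) / (b - a) ^ 3))))) \<and>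
     (\<exists>\<kappa>. regular_conditional_distribution M borel Tt0 borel T0t \<kappa> \<and>
        (\<forall>a\<in>{0<..<t}.
           (\<forall>A\<in>sets borel. A \<subseteq> {t<..} \<longrightarrow>
              emeasure (\<kappa> a) (ereal ` A) =
                (\<integral>\<^sup>+b\<in>A. ennreal
                   ((1 / 2 * sqrt ((t - a) / (b - a) ^ 3) * exp (- (\<mu>\<^sup>2 / 2) * (b - t))) /
                    (1 + \<mu>\<^sup>2 * sqrt (a * (t - a)) * exp (\<mu>\<^sup>2 / 2 * (t - a)) *
                      (LBINT y:{0..sqrt ((t - a) / a)}. exp (- (\<mu>\<^sup>2 * y\<^sup>2 * a / 2))))) \<partial>lborel)) \<and>
           measure (\<kappa> a) {\<infinity>} =
             (sqrt (pi / 2) * \<bar>\<mu>\<bar> * sqrt (t - a) * exp (\<mu>\<^sup>2 / 2 * (t - a))) /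
             (1 + \<mu>\<^sup>2 * sqrt (a * (t - a)) * exp (\<mu>\<^sup>2 / 2 * (t - a)) *
               (LBINT y:{0..sqrt ((t - a) / a)}. exp (- (\<mu>\<^sup>2 * y\<^sup>2 * a / 2))))))"
proof (intro conjI)
  interpret brownian_motion M B by fact
  let ?\<kappa> = "conditional_kernel (return borel 0) lborel (\<lambda>b a. zeros_density \<mu> t a b)"
  have "regular_conditional_distribution M borel T0t borel Tt0 ?\<kappa>"
    unfolding T0t_def Tt0_def using \<open>0 < t\<close> by (rule regular_conditional_distribution_last_zero)
  moreover have "\<forall>b>t. ?\<kappa> (ereal b) = density lborel (\<lambda>a. indicator {0<..<t} a *
      ennreal (1 / 2 * (b / sqrt (a * t)) * sqrt ((b - t) / (b - a) ^ 3)))"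
    using zeros_density_cond_last_zero[OF \<open>0 < t\<close>] by blast
  ultimately show "\<exists>\<kappa>. regular_conditional_distribution M borel T0t borel Tt0 \<kappa> \<and>
        (\<forall>b>t. \<kappa> (ereal b) =
           density lborel (\<lambda>a. indicator {0<..<t} a *
             ennreal (1 / 2 * (b / sqrt (a * t)) * sqrt ((b - t) / (b - a) ^ 3))))"
    by blast
next
  interpret brownian_motion M B by fact
  let ?\<kappa> = "conditional_kernel (return borel 0) (half_line_with_infinity t) (zeros_density \<mu> t)"
  have "regular_conditional_distribution M borel Tt0 borel T0t ?\<kappa>"
    unfolding T0t_def Tt0_def using \<open>0 < t\<close> by (rule regular_conditional_distribution_next_zero)
  then show "\<exists>\<kappa>. regular_conditional_distribution M borel Tt0 borel T0t \<kappa> \<and>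
        (\<forall>a\<in>{0<..<t}.
           (\<forall>A\<in>sets borel. A \<subseteq> {t<..} \<longrightarrow>
              emeasure (\<kappa> a) (ereal ` A) =
                (\<integral>\<^sup>+b\<in>A. ennreal
                   ((1 / 2 * sqrt ((t - a) / (b - a) ^ 3) * exp (- (\<mu>\<^sup>2 / 2) * (b - t))) /
                    (1 + \<mu>\<^sup>2 * sqrt (a * (t - a)) * exp (\<mu>\<^sup>2 / 2 * (t - a)) *
                      (LBINT y:{0..sqrt ((t - a) / a)}. exp (- (\<mu>\<^sup>2 * y\<^sup>2 * a / 2))))) \<partial>lborel)) \<and>
           measure (\<kappa> a) {\<infinity>} =
             (sqrt (pi / 2) * \<bar>\<mu>\<bar> * sqrt (t - a) * exp (\<mu>\<^sup>2 / 2 * (t - a))) /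
             (1 + \<mu>\<^sup>2 * sqrt (a * (t - a)) * exp (\<mu>\<^sup>2 / 2 * (t - a)) *
               (LBINT y:{0..sqrt ((t - a) / a)}. exp (- (\<mu>\<^sup>2 * y\<^sup>2 * a / 2)))))"
    using zeros_density_cond_next_zero[OF \<open>0 < t\<close>, where \<mu> = \<mu> and K\<^sub>0 = "return borel 0"]
    by (intro exI[of _ ?\<kappa>] conjI ballI impI) (simp_all only: greaterThanLessThan_iff)
qed

end
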